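(* For every (partial, nondeterministic, possibly circular) attributed tree transducer $A$, one can effectively construct a deterministic attributed tree transducer with look-around ($datt^U$) $D$ such that $\tau_D$ is a uniformizer of $\tau_A$; that is, $\tau_D$ is a function, $\tau_D\subseteq\tau_A$ and $\mathrm{dom}(\tau_D)=\mathrm{dom}(\tau_A)$.
   Context: Trees. A ranked alphabet $\Sigma$ is a finite set of symbols each with a unique rank $k\ge 0$; $\Sigma_k$ is the set of symbols of rank $k$; $T_\Sigma$ is the set of (finite ordered) trees over $\Sigma$, and $[k]=\{1,\dots,k\}$. Nodes are strings over $\mathbb{N}$: the root is $\epsilon$, the $i$-th child of $v$ is $v.i$; $V(t)$ is the set of nodes of $t$ and $t[v]$ the label of $v$. For a set $\Lambda$ disjoint from $\Sigma$, $T_\Sigma[\Lambda]$ is the set of trees over $\Sigma$ where elements of $\Lambda$ may also occur as leaf labels. Attributed tree transducers. An $att$ is $A=(S,I,\Sigma,\Delta,a_0,R)$ where $S,I$ are disjoint finite sets of synthesized and inherited attributes, $\Sigma,\Delta$ are ranked alphabets (input, output), $a_0\in S$ is the initial attribute, and $R=(R_\sigma\mid\sigma\in\Sigma\cup\{\#\})$ is a collection of finite rule sets, where $\#\notin\Sigma$ is a root marker of rank 1. For $\sigma\in\Sigma_k$, $R_\sigma$ contains arbitrarily many rules $a(\pi)\to\xi$ for each $a\in S$ and arbitrarily many rules $b(\pi i)\to\xi$ for each $b\in I$, $i\in[k]$, with $\xi\in T_\Delta[\{a'(\pi i)\mid a'\in S,i\in[k]\}\cup\{b'(\pi)\mid b'\in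 I\}]$ ($\pi$ is a node variable). $R_\#$ is defined analogously (with $k=1$), but contains no rules with synthesized attributes on the left-hand side and no inherited attributes on right-hand sides. $A$ is deterministic (a $datt$) if each left-hand side has at most one rule in each $R_\sigma$ and in $R_\#$. Semantics. For $s\in T_\Sigma$ let $s^\#=\#(s)$ and $\mathrm{SI}(s^\#)=\{\alpha(v)\mid \alpha\in S\cup I, v\in V(s^\#)\}$. With the conventions $\pi 0=\pi$, $v.0=v$, for $t,t'\in T_\Delta[\mathrm{SI}(s^\#)]$ write $t\Rightarrow_{A,s^\#}t'$ if $t'$ arises from $t$ by replacing one leaf labeled $\gamma(v.i)$ (where $i=0$ if $\gamma\in S$, and $i>0$ if $\gamma\in I$) by $\xi[\pi\leftarrow v]$ for some rule $\gamma(\pi i)\to\xi$ in $R_{s^\#[v]}$, where $[\pi\leftarrow v]$ replaces every occurrence of $\pi$ by $v$. The translation of $A$ is $\tau_A=\{(s,t)\in T_\Sigma\times T_\Delta\mid a_0(1)\Rightarrow^*_{A,s^\#}t\}$. Circular $atts$ (where some $\alpha(v)$ derives in one or more steps a tree containing $\alpha(v)$) are allowed. Look-around. A bottom-up relabeling is $B=(P,\Sigma,\Sigma',F,R)$ with finite state set $P$, ranked alphabets $\Sigma,\Sigma'$, final states $F\subseteq P$, and for every $\sigma\in\Sigma_k$, $p_1,\dots,p_k\in P$ at most one rule $\sigma(p_1(x_1),\dots,p_k(x_k))\to p(\sigma'(x_1,\dots,x_k))$ with $p\in P$, $\sigma'\in\Sigma'_k$; it relabels trees bottom-up in the usual way and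 $\tau_B=\{(s,s')\mid s\Rightarrow_B^* p(s'),\ p\in F\}$. A top-down relabeling is a $datt$ without inherited attributes in which every rule for $\sigma\in\Sigma_k$ has the form $q(\pi)\to\sigma'(q_1(\pi1),\dots,q_k(\pi k))$ with $\sigma'$ of rank $k$. A look-around is a pair $U=(B,T)$ of a bottom-up relabeling $B$ and a top-down relabeling $T$, with $\tau_U=\tau_B\circ\tau_T$ (first $B$, then $T$). An $att$ with look-around ($att^U$) is a pair $(U,A')$ of a look-around $U$ and an $att$ $A'$, realizing $\tau_U\circ\tau_{A'}$ (first $U$, then $A'$); it is a $datt^U$ if $A'$ is a $datt$. For a relation $\rho\subseteq X\times Y$, $\mathrm{dom}(\rho)=\{x\mid\exists y:(x,y)\in\rho\}$; relation composition is $\rho\circ\rho'=\{(x,z)\mid\exists y:(x,y)\in\rho,(y,z)\in\rho'\}$. *)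

theory Defs
  imports Main "HOL-Library.Nat_Bijection"
begin

datatype 'f tree = Node 'f "'f tree list"

text \<open>A ranked alphabet is a finite set of pairs (symbol, rank).\<close>

type_synonym 'f ralph = "('f \<times> nat) set"

definition ranked_alphabet :: "'f ralph \<Rightarrow> bool" where
  "ranked_alphabet \<Sigma> \<longleftrightarrow> finite \<Sigma> \<and> single_valued \<Sigma>"

inductive_set trees :: "'f ralph \<Rightarrow> 'f tree set" for \<Sigma> :: "'f ralph" where
  "(f, length ts) \<in> \<Sigma> \<Longrightarrow> (\<And>t. t \<in> set ts \<Longrightarrow> t \<in> trees \<Sigma>) \<Longrightarrow> Node f ts \<in> trees \<Sigma>"

text \<open>\<open>T\<^sub>\<Sigma>[\<Lambda>]\<close>: the sum type keeps \<open>\<Lambda>\<close> disjoint from \<open>\<Sigma>\<close>; elements of \<open>\<Lambda>\<close> get rank 0.\<close>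

definition trees_with :: "'f ralph \<Rightarrow> 'l set \<Rightarrow> ('f + 'l) tree set" where
  "trees_with \<Sigma> \<Lambda> = trees ((\<lambda>(f, k). (Inl f, k)) ` \<Sigma> \<union> (\<lambda>l. (Inr l, 0)) ` \<Lambda>)"

inductive is_node :: "'f tree \<Rightarrow> nat list \<Rightarrow> bool" where
  "is_node t []"
| "i \<in> {1..length ts} \<Longrightarrow> is_node (ts ! (i - 1)) v \<Longrightarrow> is_node (Node f ts) (i # v)"

definition nodes :: "'f tree \<Rightarrow> nat list set" where
  "nodes t = {v. is_node t v}"

fun label :: "'f tree \<Rightarrow> nat list \<Rightarrow> 'f" where
  "label (Node f ts) [] = f"
| "label (Node f ts) (i # v) = label (ts ! (i - 1)) v"

text \<open>\<open>v.i\<close>, with the convention \<open>v.0 = v\<close>.\<close>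

definition child :: "nat list \<Rightarrow> nat \<Rightarrow> nat list" where
  "child v i = (if i = 0 then v else v @ [i])"

text \<open>Closure of a relation on trees under rewriting a single subtree occurrence.\<close>

inductive in_context :: "('f tree \<Rightarrow> 'f tree \<Rightarrow> bool) \<Rightarrow> 'f tree \<Rightarrow> 'f tree \<Rightarrow> bool"
  for r :: "'f tree \<Rightarrow> 'f tree \<Rightarrow> bool" where
  here: "r t t' \<Longrightarrow> in_context r t t'"
| below: "j < length ts \<Longrightarrow> in_context r (ts ! j) t' \<Longrightarrow>
    in_context r (Node f ts) (Node f (ts[j := t']))"

text \<open>
  The root marker \<open>#\<close> is \<open>None\<close>, so that it lies outside every input alphabet.
  A pair \<open>(\<gamma>, i)\<close> in a rule stands for \<open>\<gamma>(\<pi> i)\<close>, where \<open>\<pi> 0 = \<pi>\<close>; a rule is a pair of a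
  left-hand side and a right-hand side. Only \<open>rules (Some \<sigma>)\<close> with \<open>\<sigma>\<close> an input symbol and
  \<open>rules None\<close> are meaningful.
\<close>

record ('q, 'f, 'g) att =
  syn :: "'q set"
  inh :: "'q set"
  ialph :: "'f ralph"
  oalph :: "'g ralph"
  init :: 'q
  rules :: "'f option \<Rightarrow> (('q \<times> nat) \<times> ('g + 'q \<times> nat) tree) set"

definition is_att :: "('q, 'f, 'g) att \<Rightarrow> bool" where
  "is_att A \<longleftrightarrow>
     finite (syn A) \<and> finite (inh A) \<and> syn A \<inter> inh A = {} \<and>
     ranked_alphabet (ialph A) \<and> ranked_alphabet (oalph A) \<and> init A \<in> syn A \<and>
     (\<forall>(\<sigma>, k) \<in> ialph A. finite (rules A (Some \<sigma>)) \<and>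
        (\<forall>((\<gamma>, i), \<xi>) \<in> rules A (Some \<sigma>).
           (\<gamma> \<in> syn A \<and> i = 0 \<or> \<gamma> \<in> inh A \<and> i \<in> {1..k}) \<and>
           \<xi> \<in> trees_with (oalph A) (syn A \<times> {1..k} \<union> inh A \<times> {0}))) \<and>
     finite (rules A None) \<and>
     (\<forall>((\<gamma>, i), \<xi>) \<in> rules A None.
        \<gamma> \<in> inh A \<and> i = 1 \<and> \<xi> \<in> trees_with (oalph A) (syn A \<times> {1}))"

definition deterministic :: "('q, 'f, 'g) att \<Rightarrow> bool" where
  "deterministic A \<longleftrightarrow>
     (\<forall>(\<sigma>, k) \<in> ialph A. single_valued (rules A (Some \<sigma>))) \<and> single_valued (rules A None)"

definition mark_root :: "'f tree \<Rightarrow> 'f option tree" where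
  "mark_root s = Node None [map_tree Some s]"

text \<open>A leaf \<open>Inr (\<gamma>, v)\<close> of a sentential form is the attribute occurrence \<open>\<gamma>(v)\<close>.\<close>

inductive att_rewrite ::
  "('q, 'f, 'g) att \<Rightarrow> 'f option tree \<Rightarrow>
   ('g + 'q \<times> nat list) tree \<Rightarrow> ('g + 'q \<times> nat list) tree \<Rightarrow> bool"
  for A :: "('q, 'f, 'g) att" and s :: "'f option tree" where
  "v \<in> nodes s \<Longrightarrow> ((\<gamma>, i), \<xi>) \<in> rules A (label s v) \<Longrightarrow>
   \<gamma> \<in> syn A \<and> i = 0 \<or> \<gamma> \<in> inh A \<and> i > 0 \<Longrightarrow>
   att_rewrite A s (Node (Inr (\<gamma>, child v i)) [])
     (map_tree (map_sum id (\<lambda>(\<gamma>', j). (\<gamma>', child v j))) \<xi>)"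

definition att_step ::
  "('q, 'f, 'g) att \<Rightarrow> 'f option tree \<Rightarrow>
   ('g + 'q \<times> nat list) tree \<Rightarrow> ('g + 'q \<times> nat list) tree \<Rightarrow> bool" where
  "att_step A s = in_context (att_rewrite A s)"

definition att_trans :: "('q, 'f, 'g) att \<Rightarrow> ('f tree \<times> 'g tree) set" where
  "att_trans A = {(s, t). s \<in> trees (ialph A) \<and> t \<in> trees (oalph A) \<and>
     (att_step A (mark_root s))\<^sup>*\<^sup>* (Node (Inr (init A, [1])) []) (map_tree Inl t)}"

text \<open>A rule \<open>((\<sigma>, ps), (p, \<sigma>'))\<close> stands for
  \<open>\<sigma>(p\<^sub>1(x\<^sub>1), \<dots>, p\<^sub>k(x\<^sub>k)) \<rightarrow> p(\<sigma>'(x\<^sub>1, \<dots>, x\<^sub>k))\<close>.\<close>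

record ('p, 'f, 'h) burel =
  bstates :: "'p set"
  bialph :: "'f ralph"
  boalph :: "'h ralph"
  bfinal :: "'p set"
  brules :: "(('f \<times> 'p list) \<times> ('p \<times> 'h)) set"

definition is_burel :: "('p, 'f, 'h) burel \<Rightarrow> bool" where
  "is_burel B \<longleftrightarrow>
     finite (bstates B) \<and> ranked_alphabet (bialph B) \<and> ranked_alphabet (boalph B) \<and>
     bfinal B \<subseteq> bstates B \<and> single_valued (brules B) \<and>
     (\<forall>((\<sigma>, ps), (p, \<sigma>')) \<in> brules B.
        (\<sigma>, length ps) \<in> bialph B \<and> set ps \<subseteq> bstates B \<and>
        p \<in> bstates B \<and> (\<sigma>', length ps) \<in> boalph B)"

text \<open>Labels of intermediate trees: input symbols, output symbols, and (unary) states.\<close>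

datatype ('p, 'f, 'h) blabel = In 'f | Out 'h | St 'p

inductive burel_rewrite ::
  "('p, 'f, 'h) burel \<Rightarrow> ('p, 'f, 'h) blabel tree \<Rightarrow> ('p, 'f, 'h) blabel tree \<Rightarrow> bool"
  for B :: "('p, 'f, 'h) burel" where
  "((\<sigma>, ps), (p, \<sigma>')) \<in> brules B \<Longrightarrow> length ts = length ps \<Longrightarrow>
   burel_rewrite B (Node (In \<sigma>) (map2 (\<lambda>p t. Node (St p) [t]) ps ts))
     (Node (St p) [Node (Out \<sigma>') ts])"

definition burel_step ::
  "('p, 'f, 'h) burel \<Rightarrow> ('p, 'f, 'h) blabel tree \<Rightarrow> ('p, 'f, 'h) blabel tree \<Rightarrow> bool" where
  "burel_step B = in_context (burel_rewrite B)"

definition burel_trans :: "('p, 'f, 'h) burel \<Rightarrow> ('f tree \<times> 'h tree) set" where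
  "burel_trans B = {(s, s'). s \<in> trees (bialph B) \<and> s' \<in> trees (boalph B) \<and>
     (\<exists>p \<in> bfinal B. (burel_step B)\<^sup>*\<^sup>* (map_tree In s) (Node (St p) [map_tree Out s']))}"

definition is_tdrel :: "('q, 'f, 'g) att \<Rightarrow> bool" where
  "is_tdrel T \<longleftrightarrow> is_att T \<and> deterministic T \<and> inh T = {} \<and>
     (\<forall>(\<sigma>, k) \<in> ialph T. \<forall>((q, i), \<xi>) \<in> rules T (Some \<sigma>).
        \<exists>\<sigma>' qs. (\<sigma>', k) \<in> oalph T \<and> length qs = k \<and>
          \<xi> = Node (Inl \<sigma>') (map2 (\<lambda>q' j. Node (Inr (q', j)) []) qs [1..<Suc k]))"

type_synonym ('p, 'f, 'h, 'q, 'i) lookaround = "('p, 'f, 'h) burel \<times> ('q, 'h, 'i) att"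

fun is_lookaround :: "('p, 'f, 'h, 'q, 'i) lookaround \<Rightarrow> bool" where
  "is_lookaround (B, T) \<longleftrightarrow> is_burel B \<and> is_tdrel T \<and> boalph B = ialph T"

fun lookaround_trans :: "('p, 'f, 'h, 'q, 'i) lookaround \<Rightarrow> ('f tree \<times> 'i tree) set" where
  "lookaround_trans (B, T) = burel_trans B O att_trans T"

type_synonym ('p, 'f, 'h, 'q, 'i, 'r, 'g) attU =
  "('p, 'f, 'h, 'q, 'i) lookaround \<times> ('r, 'i, 'g) att"

fun is_attU :: "('p, 'f, 'h, 'q, 'i, 'r, 'g) attU \<Rightarrow> bool" where
  "is_attU (U, A') \<longleftrightarrow> is_lookaround U \<and> is_att A' \<and> oalph (snd U) = ialph A'"

definition is_dattU :: "('p, 'f, 'h, 'q, 'i, 'r, 'g) attU \<Rightarrow> bool" where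
  "is_dattU D \<longleftrightarrow> is_attU D \<and> deterministic (snd D)"

fun attU_trans :: "('p, 'f, 'h, 'q, 'i, 'r, 'g) attU \<Rightarrow> ('f tree \<times> 'g tree) set" where
  "attU_trans (U, A') = lookaround_trans U O att_trans A'"

definition uniformizer :: "('a \<times> 'b) set \<Rightarrow> ('a \<times> 'b) set \<Rightarrow> bool" where
  "uniformizer \<tau> \<rho> \<longleftrightarrow> single_valued \<tau> \<and> \<tau> \<subseteq> \<rho> \<and> Domain \<tau> = Domain \<rho>"

text \<open>
  Total recursive functions of arity \<open>n\<close> in the sense of Kleene; minimization is applied to
  regular functions only. Just the values on argument lists of length \<open>n\<close> are meaningful.
\<close>

inductive recursive :: "nat \<Rightarrow> (nat list \<Rightarrow> nat) \<Rightarrow> bool" where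
  rec_zero: "recursive n (\<lambda>xs. 0)"
| rec_succ: "recursive 1 (\<lambda>xs. Suc (xs ! 0))"
| rec_proj: "i < n \<Longrightarrow> recursive n (\<lambda>xs. xs ! i)"
| rec_comp: "recursive (length gs) f \<Longrightarrow> (\<And>g. g \<in> set gs \<Longrightarrow> recursive n g) \<Longrightarrow>
    recursive n (\<lambda>xs. f (map (\<lambda>g. g xs) gs))"
| rec_prec: "recursive n f \<Longrightarrow> recursive (n + 2) g \<Longrightarrow>
    recursive (n + 1) (\<lambda>xs. rec_nat (f (tl xs)) (\<lambda>y r. g (y # r # tl xs)) (hd xs))"
| rec_min: "recursive (n + 1) f \<Longrightarrow> (\<And>xs. length xs = n \<Longrightarrow> \<exists>y. f (y # xs) = 0) \<Longrightarrow>
    recursive n (\<lambda>xs. LEAST y. f (y # xs) = 0)"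

definition computable :: "(nat \<Rightarrow> nat) \<Rightarrow> bool" where
  "computable F \<longleftrightarrow> (\<exists>f. recursive 1 f \<and> (\<forall>x. F x = f [x]))"

text \<open>
  Goedel numbers of transducers whose symbols, attributes and states are natural numbers.
  Finite sets are coded by \<open>set_encode\<close>, which is injective on them.
\<close>

definition code_ralph :: "nat ralph \<Rightarrow> nat" where
  "code_ralph \<Sigma> = set_encode (prod_encode ` \<Sigma>)"

fun code_tree :: "(nat + nat \<times> nat) tree \<Rightarrow> nat" where
  "code_tree (Node f ts) =
     prod_encode (sum_encode (map_sum id prod_encode f), list_encode (map code_tree ts))"

definition code_symbol :: "nat option \<Rightarrow> nat" where
  "code_symbol x = (case x of None \<Rightarrow> 0 | Some \<sigma> \<Rightarrow> Suc \<sigma>)"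

definition code_att :: "(nat, nat, nat) att \<Rightarrow> nat" where
  "code_att A = list_encode
     [set_encode (syn A), set_encode (inh A), code_ralph (ialph A), code_ralph (oalph A), init A,
      set_encode {prod_encode (code_symbol x, prod_encode (prod_encode l, code_tree \<xi>)) | x l \<xi>.
        x \<in> insert None (Some ` fst ` ialph A) \<and> (l, \<xi>) \<in> rules A x}]"

definition code_burel :: "(nat, nat, nat) burel \<Rightarrow> nat" where
  "code_burel B = list_encode
     [set_encode (bstates B), code_ralph (bialph B), code_ralph (boalph B), set_encode (bfinal B),
      set_encode {prod_encode (prod_encode (\<sigma>, list_encode ps), prod_encode (p, \<sigma>')) | \<sigma> ps p \<sigma>'.
        ((\<sigma>, ps), (p, \<sigma>')) \<in> brules B}]"

fun code_attU :: "(nat, nat, nat, nat, nat, nat, nat) attU \<Rightarrow> nat" where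
  "code_attU ((B, T), A') = list_encode [code_burel B, code_att T, code_att A']"

end

theory Submission
  imports Defs
begin

text \<open>
  An attribute occurrence \<open>\<gamma>(v)\<close> that derives an output tree does so by a rule whose leaves are
  occurrences with derivations of smaller height. Hence the occurrences that derive an output tree
  carry a partial order in which each has a rule with strictly smaller leaves. The traces of such an
  order on the attributes of the single nodes form an accepting run of a finite tree automaton: its
  states are partial orders on sets of attributes, and its transitions at a \<open>\<sigma>\<close>-node are partial
  orders \<open>c\<close> on the occurrences at the node and its children in which each occurrence with a rule in
  \<open>R\<^sub>\<sigma>\<close> has one with strictly smaller leaves. Conversely, along any accepting run the rules chosen by
  the transitions are not circular, because the order at a node controls how its synthesized
  attributes depend on its inherited ones. So the look-around selects a run, bottom-up by a subset
  construction and then top-down by selecting least transitions, and writes the transitions into the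
  labels; the transducer applies the least rule fitting the transition at its node.

  All choices are among finitely many bounded codes, so the construction is given by bounded
  quantification and minimization, without recursion over the coded objects.
\<close>


section \<open>Closure properties of computable functions\<close>

text \<open>A productive occurrence always has a rule whose leaves are productive, but choosing such
  rules independently at each node can close a cycle. Ranking occurrences by height would prevent
  this, yet heights are unbounded and a relabeling passes only finitely much between neighbours.
  What survives is the comparison of heights among the attributes of one node and its children; such
  comparisons are glued where they share a node. An accepting run need not come from heights, so no
  global order is at hand for it: termination is proved by induction over subtrees, combined with
  induction along each finite local order. All orders attainable at a subtree are carried upwards,
  because the rest of the tree decides which of them is acceptable. Effectiveness means a total
  recursive function on Goedel numbers, so every component is also described arithmetically and
  bounds are crude: the code of the given transducer exceeds its attributes and ranks, and a number
  m above all codes of pairs of occurrences yields 2^m codes of orders and 2^(2^m) codes of sets of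
  orders.\<close>

definition recfun :: "nat \<Rightarrow> (nat list \<Rightarrow> nat) \<Rightarrow> bool" where
  "recfun n g \<longleftrightarrow> (\<exists>f. recursive n f \<and> (\<forall>xs. length xs = n \<longrightarrow> f xs = g xs))"

lemma recfun_zero: "recfun n (\<lambda>xs. 0)"
  unfolding recfun_def using rec_zero by blast

lemma recfun_proj: "i < n \<Longrightarrow> recfun n (\<lambda>xs. xs ! i)"
  unfolding recfun_def using rec_proj by blast

text \<open>\<open>recursive\<close> gives meaning only to values on lists of the right length,
  hence the passage to \<open>recfun\<close>. Each inner function is replaced by a recursive one
  agreeing with it there; the replacement depends on the function alone, so it can be mapped over
  \<open>gs\<close>.\<close>

lemma recfun_comp:
  assumes "recfun (length gs) f" and "\<And>g. g \<in> set gs \<Longrightarrow> recfun n g"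
  shows "recfun n (\<lambda>xs. f (map (\<lambda>g. g xs) gs))"
proof -
  obtain f' where f': "recursive (length gs) f'" "\<And>ys. length ys = length gs \<Longrightarrow> f' ys = f ys"
    using assms(1) unfolding recfun_def by blast
  define r where "r g = (SOME g'. recursive n g' \<and> (\<forall>xs. length xs = n \<longrightarrow> g' xs = g xs))" for g
  have r: "recursive n (r g) \<and> (\<forall>xs. length xs = n \<longrightarrow> r g xs = g xs)" if "g \<in> set gs" for g
    using assms(2)[OF that] unfolding recfun_def r_def by (rule someI_ex)
  have "recursive n (\<lambda>xs. f' (map (\<lambda>g. g xs) (map r gs)))"
    by (rule rec_comp) (use f'(1) r in auto)
  moreover have "f' (map (\<lambda>g. g xs) (map r gs)) = f (map (\<lambda>g. g xs) gs)" if "length xs = n" for xs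
  proof -
    have "map (\<lambda>g. g xs) (map r gs) = map (\<lambda>g. g xs) gs"
      using r that by (auto simp: comp_def)
    then show ?thesis using f'(2)[of "map (\<lambda>g. g xs) gs"] by (simp only: length_map)
  qed
  ultimately show ?thesis unfolding recfun_def by blast
qed

lemma recfun_comp1: "recfun 1 f \<Longrightarrow> recfun n g \<Longrightarrow> recfun n (\<lambda>xs. f [g xs])"
  using recfun_comp[of "[g]" f n] by simp

lemma recfun_comp2: "recfun 2 f \<Longrightarrow> recfun n g \<Longrightarrow> recfun n h \<Longrightarrow> recfun n (\<lambda>xs. f [g xs, h xs])"
  using recfun_comp[of "[g, h]" f n] by (auto simp: numeral_2_eq_2)

lemma recfun_Suc: "recfun n g \<Longrightarrow> recfun n (\<lambda>xs. Suc (g xs))"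
  using recfun_comp1[of "\<lambda>xs. Suc (xs ! 0)" n g] rec_succ unfolding recfun_def by auto

lemma recfun_const: "recfun n (\<lambda>xs. c)"
  by (induction c) (auto intro: recfun_zero recfun_Suc)

lemma recfun_rec_nat:
  assumes "recfun n f" and "recfun (n + 2) g"
  shows "recfun (n + 1) (\<lambda>xs. rec_nat (f (tl xs)) (\<lambda>y r. g (y # r # tl xs)) (hd xs))"
proof -
  obtain f' where f': "recursive n f'" "\<And>ys. length ys = n \<Longrightarrow> f' ys = f ys"
    using assms(1) unfolding recfun_def by blast
  obtain g' where g': "recursive (n + 2) g'" "\<And>ys. length ys = n + 2 \<Longrightarrow> g' ys = g ys"
    using assms(2) unfolding recfun_def by blast
  have "rec_nat (f' (tl xs)) (\<lambda>y r. g' (y # r # tl xs)) (hd xs) =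
      rec_nat (f (tl xs)) (\<lambda>y r. g (y # r # tl xs)) (hd xs)" if "length xs = n + 1" for xs
  proof -
    have "length (tl xs) = n" using that by simp
    then have "rec_nat (f' (tl xs)) (\<lambda>y r. g' (y # r # tl xs)) m =
      rec_nat (f (tl xs)) (\<lambda>y r. g (y # r # tl xs)) m" for m
      by (induction m) (use f' g' in auto)
    then show ?thesis .
  qed
  then show ?thesis
    unfolding recfun_def using rec_prec[OF f'(1) g'(1)] by blast
qed

lemma recfun_Least:
  assumes "recfun (n + 1) f" and ex: "\<And>xs. length xs = n \<Longrightarrow> \<exists>y. f (y # xs) = 0"
  shows "recfun n (\<lambda>xs. LEAST y. f (y # xs) = 0)"
proof -
  obtain f' where f': "recursive (n + 1) f'" "\<And>ys. length ys = n + 1 \<Longrightarrow> f' ys = f ys"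
    using assms(1) unfolding recfun_def by blast
  have "recursive n (\<lambda>xs. LEAST y. f' (y # xs) = 0)"
    by (rule rec_min) (use f' ex in auto)
  moreover have "(LEAST y. f' (y # xs) = 0) = (LEAST y. f (y # xs) = 0)" if "length xs = n" for xs
    using f'(2) that by simp
  ultimately show ?thesis unfolding recfun_def by blast
qed

text \<open>Bound and parameter are computed from the argument list, which frees recursion from the
  fixed positions of \<open>rec_prec\<close>. One parameter is enough, because several can be paired
  into it.\<close>

lemma recfun_rec_nat2:
  assumes f: "recfun 1 (\<lambda>xs. f (xs ! 0))" and g: "recfun 3 (\<lambda>xs. g (xs ! 0) (xs ! 1) (xs ! 2))"
    and b: "recfun n b" and p: "recfun n p"
  shows "recfun n (\<lambda>xs. rec_nat (f (p xs)) (\<lambda>y r. g y r (p xs)) (b xs))"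
proof -
  have "recfun 2 (\<lambda>xs. rec_nat (f (tl xs ! 0)) (\<lambda>y r. g ((y # r # tl xs) ! 0) ((y # r # tl xs) ! 1)
      ((y # r # tl xs) ! 2)) (hd xs))"
    using recfun_rec_nat[OF f, of "\<lambda>xs. g (xs ! 0) (xs ! 1) (xs ! 2)"] g
    by (simp add: numeral_2_eq_2 numeral_3_eq_3)
  from recfun_comp2[OF this b p] show ?thesis by (simp add: numeral_2_eq_2)
qed

lemma recfun_add:
  assumes "recfun n g" and "recfun n h"
  shows "recfun n (\<lambda>xs. g xs + h xs)"
proof -
  have eq: "rec_nat y (\<lambda>_ r. Suc r) x = x + y" for x y :: nat
    by (induction x) auto
  have "recfun n (\<lambda>xs. rec_nat (h xs) (\<lambda>_ r. Suc r) (g xs))"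
    by (rule recfun_rec_nat2[of "\<lambda>x. x" "\<lambda>y r p. Suc r"]) (auto intro!: recfun_proj recfun_Suc assms)
  then show ?thesis by (simp add: eq)
qed

lemma recfun_mult:
  assumes "recfun n g" and "recfun n h"
  shows "recfun n (\<lambda>xs. g xs * h xs)"
proof -
  have eq: "rec_nat 0 (\<lambda>_ r. r + y) x = x * y" for x y :: nat
    by (induction x) auto
  have "recfun n (\<lambda>xs. rec_nat 0 (\<lambda>_ r. r + h xs) (g xs))"
    by (rule recfun_rec_nat2[of "\<lambda>x. 0" "\<lambda>y r p. r + p"])
      (auto intro!: recfun_proj recfun_add recfun_const assms)
  then show ?thesis by (simp add: eq)
qed

lemma recfun_diff:
  assumes "recfun n g" and "recfun n h"
  shows "recfun n (\<lambda>xs. g xs - h xs)"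
proof -
  have eq1: "rec_nat 0 (\<lambda>y _. y) x = x - 1" for x :: nat
    by (induction x) auto
  have pred: "recfun n (\<lambda>xs. g xs - 1)" if "recfun n g" for n g
  proof -
    have "recfun n (\<lambda>xs. rec_nat 0 (\<lambda>y _. y) (g xs))"
      by (rule recfun_rec_nat2[of "\<lambda>x. 0" "\<lambda>y r p. y" n g g])
        (auto intro!: recfun_proj recfun_const that)
    then show ?thesis by (simp only: eq1)
  qed
  have eq: "rec_nat y (\<lambda>_ r. r - 1) x = y - x" for x y :: nat
    by (induction x) auto
  have "recfun n (\<lambda>xs. rec_nat (g xs) (\<lambda>_ r. r - 1) (h xs))"
    by (rule recfun_rec_nat2[of "\<lambda>x. x" "\<lambda>y r p. r - 1"])
      (auto intro!: recfun_proj pred[simplified] assms)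
  then show ?thesis by (simp only: eq)
qed

lemma recfun_triangle:
  assumes "recfun n g"
  shows "recfun n (\<lambda>xs. triangle (g xs))"
proof -
  have eq: "rec_nat 0 (\<lambda>y r. r + Suc y) x = triangle x" for x :: nat
    by (induction x) auto
  have "recfun n (\<lambda>xs. rec_nat 0 (\<lambda>y r. r + Suc y) (g xs))"
    by (rule recfun_rec_nat2[of "\<lambda>x. 0" "\<lambda>y r p. r + Suc y" n g g])
      (intro recfun_proj recfun_add recfun_const recfun_Suc assms; simp)+
  then show ?thesis by (simp only: eq)
qed

lemma recfun_prod_encode:
  assumes "recfun n g" and "recfun n h"
  shows "recfun n (\<lambda>xs. prod_encode (g xs, h xs))"
  unfolding prod_encode_def by (simp add: recfun_add recfun_triangle assms)

section \<open>Inverting the Cantor pairing\<close>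

abbreviation pfst :: "nat \<Rightarrow> nat" where "pfst n \<equiv> fst (prod_decode n)"
abbreviation psnd :: "nat \<Rightarrow> nat" where "psnd n \<equiv> snd (prod_decode n)"

lemma triangle_mono: "m \<le> n \<Longrightarrow> triangle m \<le> triangle n"
  unfolding triangle_def by (intro div_le_mono mult_le_mono) auto

lemma decode_triangle: "n = triangle (pfst n + psnd n) + pfst n"
proof -
  have "prod_encode (pfst n, psnd n) = triangle (pfst n + psnd n) + pfst n"
    unfolding prod_encode_def by (simp only: case_prod_conv)
  then show ?thesis by (simp only: prod.collapse prod_decode_inverse)
qed

text \<open>The pairing enumerates diagonals: \<open>n\<close> lies on the diagonal \<open>s\<close>
  with \<open>triangle s \<le> n < triangle (Suc s)\<close>, so \<open>s\<close> is found by search.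
  Truncated subtraction turns the comparison into a test for zero.\<close>

lemma psum_eq_Least: "pfst n + psnd n = (LEAST s. Suc n - triangle (Suc s) = 0)"
proof (rule Least_equality[symmetric])
  show "Suc n - triangle (Suc (pfst n + psnd n)) = 0"
    using decode_triangle[of n] by (simp only: triangle_Suc diff_is_0_eq)
next
  fix s assume "Suc n - triangle (Suc s) = 0"
  then have "triangle (pfst n + psnd n) < triangle (Suc s)"
    using decode_triangle[of n] by (simp only: diff_is_0_eq)
  then have "\<not> Suc s \<le> pfst n + psnd n"
    using triangle_mono leD by blast
  then show "pfst n + psnd n \<le> s" by (simp only: not_less_eq_eq not_not)
qed

lemma pfst_eq: "pfst n = n - triangle (pfst n + psnd n)"
  using decode_triangle[of n] by (metis add_diff_cancel_left')

lemma recfun_psum: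
  assumes "recfun n g"
  shows "recfun n (\<lambda>xs. pfst (g xs) + psnd (g xs))"
proof -
  have "recfun 1 (\<lambda>xs. LEAST y. Suc ((y # xs) ! 1) - triangle (Suc ((y # xs) ! 0)) = 0)"
  proof (rule recfun_Least)
    show "recfun (1 + 1) (\<lambda>xs. Suc (xs ! 1) - triangle (Suc (xs ! 0)))"
      by (intro recfun_diff recfun_triangle recfun_Suc recfun_proj) auto
    fix xs :: "nat list" assume "length xs = 1"
    \<comment> \<open>The argument itself bounds the search, since a triangular number is at least
      its index.\<close>
    have "x \<le> triangle x" for x by (induction x) auto
    then have "Suc ((xs ! 0 # xs) ! 1) - triangle (Suc ((xs ! 0 # xs) ! 0)) = 0" by auto
    then show "\<exists>y. Suc ((y # xs) ! 1) - triangle (Suc ((y # xs) ! 0)) = 0" by blast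
  qed
  then have "recfun 1 (\<lambda>xs. pfst (xs ! 0) + psnd (xs ! 0))" by (simp add: psum_eq_Least)
  from recfun_comp1[OF this assms] show ?thesis by simp
qed

lemma recfun_pfst: "recfun n g \<Longrightarrow> recfun n (\<lambda>xs. pfst (g xs))"
  by (subst pfst_eq) (intro recfun_diff recfun_triangle recfun_psum)

lemma recfun_psnd: "recfun n g \<Longrightarrow> recfun n (\<lambda>xs. psnd (g xs))"
  using recfun_diff[OF recfun_psum recfun_pfst, of n g g] by simp

subsection \<open>Unary functions\<close>

text \<open>
  The argument \<open>e\<close> of the functions below is an environment. A binder extends it to
  \<open>prod_encode (e, y)\<close>, so that the closure rules apply by resolution under binders.
\<close>

lemma computable_recfun: "computable f \<longleftrightarrow> recfun 1 (\<lambda>xs. f (xs ! 0))"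
proof
  assume "computable f"
  then obtain g where g: "recursive 1 g" "\<And>x. f x = g [x]" unfolding computable_def by blast
  have "g xs = f (xs ! 0)" if "length xs = 1" for xs
    using that g(2) by (cases xs) auto
  then show "recfun 1 (\<lambda>xs. f (xs ! 0))" unfolding recfun_def using g(1) by blast
next
  assume "recfun 1 (\<lambda>xs. f (xs ! 0))"
  then obtain g where g: "recursive 1 g" "\<And>xs. length xs = 1 \<Longrightarrow> g xs = f (xs ! 0)"
    unfolding recfun_def by blast
  then have "f x = g [x]" for x by simp
  then show "computable f" unfolding computable_def using g(1) by blast
qed

lemma recfun_computable: "computable f \<Longrightarrow> recfun n g \<Longrightarrow> recfun n (\<lambda>xs. f (g xs))"
  using recfun_comp1[of "\<lambda>xs. f (xs ! 0)" n g] by (simp add: computable_recfun)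

lemma computable_id: "computable (\<lambda>e. e)"
  and computable_const: "computable (\<lambda>e. c)"
  and computable_Suc: "computable f \<Longrightarrow> computable (\<lambda>e. Suc (f e))"
  and computable_add: "computable f \<Longrightarrow> computable g \<Longrightarrow> computable (\<lambda>e. f e + g e)"
  and computable_mult: "computable f \<Longrightarrow> computable g \<Longrightarrow> computable (\<lambda>e. f e * g e)"
  and computable_diff: "computable f \<Longrightarrow> computable g \<Longrightarrow> computable (\<lambda>e. f e - g e)"
  and computable_prod_encode: "computable f \<Longrightarrow> computable g \<Longrightarrow> computable (\<lambda>e. prod_encode (f e, g e))"
  and computable_pfst: "computable f \<Longrightarrow> computable (\<lambda>e. pfst (f e))"
  and computable_psnd: "computable f \<Longrightarrow> computable (\<lambda>e. psnd (f e))"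
  unfolding computable_recfun
  by (intro recfun_proj recfun_const recfun_Suc recfun_add recfun_mult recfun_diff
      recfun_prod_encode recfun_pfst recfun_psnd; simp)+

lemma computable_comp: "computable f \<Longrightarrow> computable g \<Longrightarrow> computable (\<lambda>e. f (g e))"
  unfolding computable_recfun[of g] computable_recfun[of "\<lambda>e. f (g e)"] by (rule recfun_computable)

text \<open>The environment takes the place of the recursion parameter; the step function reads it
  together with counter and previous value from one packed triple.\<close>

lemma computable_rec_nat:
  assumes f: "computable f" and b: "computable b"
    and g: "computable (\<lambda>e. g (pfst e) (pfst (psnd e)) (psnd (psnd e)))"
  shows "computable (\<lambda>e. rec_nat (f e) (\<lambda>y r. g e y r) (b e))"
proof -
  have "recfun 3 (\<lambda>xs. (\<lambda>e. g (pfst e) (pfst (psnd e)) (psnd (psnd e)))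
      (prod_encode (xs ! 2, prod_encode (xs ! 0, xs ! 1))))"
    by (rule recfun_computable[OF g]) (intro recfun_prod_encode recfun_proj; simp)
  then have "recfun 3 (\<lambda>xs. g (xs ! 2) (xs ! 0) (xs ! 1))" by simp
  then have "recfun 1 (\<lambda>xs. rec_nat (f (xs ! 0)) (\<lambda>y r. g (xs ! 0) y r) (b (xs ! 0)))"
    by (intro recfun_rec_nat2[of f "\<lambda>y r p. g p y r"] recfun_proj)
       (use f b in \<open>auto simp: computable_recfun\<close>)
  then show ?thesis by (simp add: computable_recfun)
qed

section \<open>Decidable predicates, bounded search and binary digits\<close>

text \<open>Truth is coded by 0 because minimization looks for zeros.\<close>

definition decidable :: "(nat \<Rightarrow> bool) \<Rightarrow> bool" where
  "decidable P \<longleftrightarrow> computable (\<lambda>e. if P e then 0 else 1)"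

lemma computable_Least:
  assumes P: "decidable (\<lambda>e. P (pfst e) (psnd e))" and ex: "\<And>e. \<exists>y. P e y"
  shows "computable (\<lambda>e. LEAST y. P e y)"
proof -
  have "recfun (1 + 1) (\<lambda>xs. (\<lambda>e. if P (pfst e) (psnd e) then 0 else 1) (prod_encode (xs ! 1, xs ! 0)))"
    by (rule recfun_computable[OF P[unfolded decidable_def]]) (intro recfun_prod_encode recfun_proj; simp)
  then have "recfun (1 + 1) (\<lambda>xs. if P (xs ! 1) (xs ! 0) then 0 else 1)" by simp
  from recfun_Least[OF this] ex
  have "recfun 1 (\<lambda>xs. LEAST y. (if P ((y # xs) ! 1) ((y # xs) ! 0) then 0 else (1::nat)) = 0)"
    by auto
  moreover have "((if Q then 0 else (1::nat)) = 0) = Q" for Q by simp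
  ultimately show ?thesis unfolding computable_recfun by simp
qed

lemma computable_if:
  assumes "decidable P" and "computable f" and "computable g"
  shows "computable (\<lambda>e. if P e then f e else g e)"
proof -
  have "computable (\<lambda>e. f e * (1 - (if P e then 0 else 1)) + g e * (if P e then 0 else 1))"
    by (intro computable_add computable_mult computable_diff computable_const assms assms(1)[unfolded decidable_def])
  moreover have "f e * (1 - (if P e then 0 else 1)) + g e * (if P e then 0 else 1) = (if P e then f e else g e)" for e
    by simp
  ultimately show ?thesis by simp
qed

lemma decidable_const: "decidable (\<lambda>e. c)"
  unfolding decidable_def by (rule computable_const)

lemma decidable_not:
  assumes "decidable P"
  shows "decidable (\<lambda>e. \<not> P e)"
proof -
  have "(\<lambda>e. if \<not> P e then 0 else 1) = (\<lambda>e. if P e then 1 else (0::nat))" by auto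
  then show ?thesis
    unfolding decidable_def using computable_if[OF assms computable_const computable_const] by simp
qed

lemma decidable_if:
  assumes "decidable P" and "decidable Q" and "decidable R"
  shows "decidable (\<lambda>e. if P e then Q e else R e)"
proof -
  have "(\<lambda>e. if (if P e then Q e else R e) then 0 else 1) =
      (\<lambda>e. if P e then if Q e then 0 else 1 else if R e then 0 else (1::nat))" by auto
  then show ?thesis
    unfolding decidable_def using computable_if[OF assms(1) assms(2,3)[unfolded decidable_def]] by simp
qed

lemma decidable_conj:
  assumes "decidable P" and "decidable Q"
  shows "decidable (\<lambda>e. P e \<and> Q e)"
proof -
  have "(\<lambda>e. P e \<and> Q e) = (\<lambda>e. if P e then Q e else False)" by auto
  then show ?thesis using decidable_if[OF assms decidable_const] by simp
qed

lemma decidable_disj: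
  assumes "decidable P" and "decidable Q"
  shows "decidable (\<lambda>e. P e \<or> Q e)"
  using decidable_not[OF decidable_conj[OF assms[THEN decidable_not]]] by simp

lemma decidable_imp:
  assumes "decidable P" and "decidable Q"
  shows "decidable (\<lambda>e. P e \<longrightarrow> Q e)"
  unfolding imp_conv_disj by (intro decidable_disj decidable_not assms)

lemma decidable_le:
  assumes "computable f" and "computable g"
  shows "decidable (\<lambda>e. f e \<le> g e)"
proof -
  have "computable (\<lambda>e. 1 - (1 - (f e - g e)))"
    by (intro computable_diff computable_const assms)
  moreover have "1 - (1 - (f e - g e)) = (if f e \<le> g e then 0 else 1)" for e by auto
  ultimately show ?thesis unfolding decidable_def by simp
qed

lemma decidable_eq: "computable f \<Longrightarrow> computable g \<Longrightarrow> decidable (\<lambda>e. f e = g e)"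
  unfolding eq_iff by (intro decidable_conj decidable_le)

lemma decidable_less: "computable f \<Longrightarrow> computable g \<Longrightarrow> decidable (\<lambda>e. f e < g e)"
  unfolding not_le[symmetric] by (intro decidable_not decidable_le)

lemma decidable_comp: "decidable P \<Longrightarrow> computable f \<Longrightarrow> decidable (\<lambda>e. P (f e))"
  unfolding decidable_def by (rule computable_comp)

text \<open>The search stops at a witness or at the bound, so it is total; a witness exists exactly
  if it stops before the bound.\<close>

lemma decidable_bex_less:
  assumes b: "computable b" and P: "decidable (\<lambda>e. P (pfst e) (psnd e))"
  shows "decidable (\<lambda>e. \<exists>y<b e. P e y)"
proof -
  have "computable (\<lambda>e. LEAST y. b e \<le> y \<or> P e y)"
    by (rule computable_Least)
      (intro decidable_disj decidable_le P computable_psnd computable_id computable_comp[OF b] computable_pfst,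
       blast)
  then have "decidable (\<lambda>e. (LEAST y. b e \<le> y \<or> P e y) < b e)"
    by (rule decidable_less[OF _ b])
  moreover have "(LEAST y. b e \<le> y \<or> P e y) < b e \<longleftrightarrow> (\<exists>y<b e. P e y)" for e
    by (metis (mono_tags, lifting) LeastI Least_le le_less_trans linorder_not_le)
  ultimately show ?thesis by simp
qed

lemma decidable_ball_less:
  assumes "computable b" and "decidable (\<lambda>e. P (pfst e) (psnd e))"
  shows "decidable (\<lambda>e. \<forall>y<b e. P e y)"
  using decidable_not[OF decidable_bex_less[OF assms(1) decidable_not[OF assms(2)]]] by simp

lemma computable_power2:
  assumes "computable f"
  shows "computable (\<lambda>e. 2 ^ f e)"
proof -
  have "computable (\<lambda>e. rec_nat 1 (\<lambda>_ r. 2 * r) (f e))"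
    by (intro computable_rec_nat computable_const computable_mult computable_psnd computable_id assms)
  moreover have "rec_nat 1 (\<lambda>_ r. 2 * r) n = (2 ^ n :: nat)" for n
    by (induction n) auto
  ultimately show ?thesis by (simp only:)
qed

lemma computable_sum_less:
  assumes b: "computable b" and f: "computable (\<lambda>e. f (pfst e) (psnd e))"
  shows "computable (\<lambda>e. \<Sum>y<b e. f e y)"
proof -
  have f': "computable (\<lambda>e. f (g e) (h e))" if "computable g" "computable h" for g h
    using computable_comp[OF f computable_prod_encode[OF that]] by simp
  have "computable (\<lambda>e. rec_nat 0 (\<lambda>y r. r + f e y) (b e))"
    by (intro computable_rec_nat computable_const computable_add computable_psnd computable_pfst f' computable_id b)
  moreover have "rec_nat 0 (\<lambda>y r. r + f e y) n = (\<Sum>y<n. f e y)" for e n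
    by (induction n) auto
  ultimately show ?thesis by simp
qed

text \<open>Membership is a binary digit of the code, the parity of its quotient by a power of two.
  Both the quotient and the half of an even number are found by search.\<close>

lemma decidable_mem_set_decode:
  assumes "computable f" and "computable g"
  shows "decidable (\<lambda>e. f e \<in> set_decode (g e))"
proof -
  have div: "computable (\<lambda>e. LEAST q. g e < Suc q * 2 ^ f e)"
  proof (rule computable_Least)
    have "g e < Suc (g e) * 1" for e by simp
    also have "Suc (g e) * 1 \<le> Suc (g e) * 2 ^ f e" for e by (intro mult_le_mono) simp_all
    finally show "\<exists>y. g e < Suc y * 2 ^ f e" for e by blast
  qed (intro decidable_less computable_mult computable_power2 computable_Suc computable_pfst
      computable_psnd computable_id computable_comp[OF assms(1)] computable_comp[OF assms(2)])
  have eq: "(LEAST q. a < Suc q * 2 ^ n) = a div 2 ^ n" for a n :: nat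
  proof (rule Least_equality)
    show "a < Suc (a div 2 ^ n) * 2 ^ n"
      using dividend_less_times_div[of "2 ^ n" a] by (simp add: mult.commute)
    fix q assume "a < Suc q * 2 ^ n"
    then show "a div 2 ^ n \<le> q" by (simp add: less_mult_imp_div_less less_Suc_eq_le[symmetric] del: mult_Suc)
  qed
  have "decidable (\<lambda>e. \<not> (\<exists>y<Suc (g e div 2 ^ f e). g e div 2 ^ f e = 2 * y))"
    by (intro decidable_not decidable_bex_less decidable_eq computable_mult computable_const
        computable_psnd computable_id computable_Suc computable_comp[OF div[unfolded eq]] computable_pfst div[unfolded eq])
  moreover have "f e \<in> set_decode (g e) \<longleftrightarrow> \<not> (\<exists>y<Suc (g e div 2 ^ f e). g e div 2 ^ f e = 2 * y)"
    (is "_ \<longleftrightarrow> \<not> (\<exists>y<Suc ?d. _)") for e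
  proof -
    have "even ?d \<longleftrightarrow> (\<exists>y<Suc ?d. ?d = 2 * y)"
    proof
      assume "even ?d"
      then obtain y where "?d = 2 * y" by (elim evenE)
      then show "\<exists>y<Suc ?d. ?d = 2 * y" by (intro exI[of _ y]) linarith
    qed auto
    then show ?thesis unfolding set_decode_def by simp
  qed
  ultimately show ?thesis by simp
qed

subsection \<open>Families of finite sets\<close>

definition computable_sets :: "(nat \<Rightarrow> nat set) \<Rightarrow> bool" where
  "computable_sets S \<longleftrightarrow> (\<forall>e. finite (S e)) \<and> computable (\<lambda>e. set_encode (S e))"

text \<open>Each element contributes its own power of two. A finite set is thus bounded by its code,
  which supplies the bound for every quantifier over a coded set.\<close>

lemma mem_less_set_encode: "finite A \<Longrightarrow> n \<in> A \<Longrightarrow> n < set_encode A"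
proof -
  assume A: "finite A" "n \<in> A"
  then have "2 ^ n \<le> set_encode A" unfolding set_encode_def by (simp add: member_le_sum)
  then show ?thesis using less_exp[of n] by linarith
qed

lemma mem_set_decode_less: "n \<in> set_decode c \<Longrightarrow> n < c"
  using mem_less_set_encode[of "set_decode c" n] by simp

text \<open>The code is the sum of the powers of two at the selected numbers. Filtering, images and
  unions are reduced to this case by exhibiting a bound.\<close>

lemma computable_sets_bounded:
  assumes b: "computable b" and P: "decidable (\<lambda>e. P (pfst e) (psnd e))"
  shows "computable_sets (\<lambda>e. {y. y < b e \<and> P e y})"
proof -
  have "computable (\<lambda>e. \<Sum>y<b e. if P e y then 2 ^ y else 0)"
    by (intro computable_sum_less computable_if computable_const computable_power2 computable_psnd computable_id b P)
  moreover have "set_encode {y. y < b e \<and> P e y} = (\<Sum>y<b e. if P e y then 2 ^ y else 0)" for e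
    by (simp add: set_encode_def sum.If_cases) (rule arg_cong2[of _ _ _ _ sum], auto)
  ultimately show ?thesis unfolding computable_sets_def by simp
qed

lemma computable_set_encode: "computable_sets S \<Longrightarrow> computable (\<lambda>e. set_encode (S e))"
  unfolding computable_sets_def by blast

lemma computable_sets_finite: "computable_sets S \<Longrightarrow> finite (S e)"
  unfolding computable_sets_def by blast

lemma computable_sets_comp: "computable_sets S \<Longrightarrow> computable f \<Longrightarrow> computable_sets (\<lambda>e. S (f e))"
  unfolding computable_sets_def using computable_comp by auto

lemma decidable_mem:
  assumes "computable f" and "computable_sets S"
  shows "decidable (\<lambda>e. f e \<in> S e)"
  using decidable_mem_set_decode[OF assms(1) computable_set_encode[OF assms(2)]]
    computable_sets_finite[OF assms(2)] by simp

lemma computable_sets_decode: "computable f \<Longrightarrow> computable_sets (\<lambda>e. set_decode (f e))"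
  unfolding computable_sets_def by simp

lemma decidable_mem':
  assumes "computable_sets S"
  shows "decidable (\<lambda>e. psnd e \<in> S (pfst e))"
  by (intro decidable_mem computable_sets_comp[OF assms] computable_pfst computable_psnd computable_id)

lemma decidable_bex:
  assumes S: "computable_sets S" and P: "decidable (\<lambda>e. P (pfst e) (psnd e))"
  shows "decidable (\<lambda>e. \<exists>y\<in>S e. P e y)"
proof -
  have "decidable (\<lambda>e. \<exists>y<set_encode (S e). y \<in> S e \<and> P e y)"
    by (intro decidable_bex_less decidable_conj decidable_mem' computable_set_encode S P)
  moreover have "(\<exists>y<set_encode (S e). y \<in> S e \<and> P e y) \<longleftrightarrow> (\<exists>y\<in>S e. P e y)" for e
    using mem_less_set_encode[OF computable_sets_finite[OF S]] by blast
  ultimately show ?thesis by simp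
qed

lemma decidable_ball:
  assumes "computable_sets S" and "decidable (\<lambda>e. P (pfst e) (psnd e))"
  shows "decidable (\<lambda>e. \<forall>y\<in>S e. P e y)"
  using decidable_not[OF decidable_bex[OF assms(1) decidable_not[OF assms(2)]]] by simp

lemma computable_sets_lessThan: "computable b \<Longrightarrow> computable_sets (\<lambda>e. {..<b e})"
  using computable_sets_bounded[OF _ decidable_const[of True], of b] by (simp add: lessThan_def)

lemma computable_sets_filter:
  assumes S: "computable_sets S" and P: "decidable (\<lambda>e. P (pfst e) (psnd e))"
  shows "computable_sets (\<lambda>e. {y \<in> S e. P e y})"
proof -
  have "computable_sets (\<lambda>e. {y. y < set_encode (S e) \<and> y \<in> S e \<and> P e y})"
    by (intro computable_sets_bounded decidable_conj decidable_mem' computable_set_encode S P)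
  moreover have "{y. y < set_encode (S e) \<and> y \<in> S e \<and> P e y} = {y \<in> S e. P e y}" for e
    using mem_less_set_encode[OF computable_sets_finite[OF S]] by blast
  ultimately show ?thesis by simp
qed

lemma computable_sets_image:
  assumes S: "computable_sets S" and f: "computable (\<lambda>e. f (pfst e) (psnd e))"
  shows "computable_sets (\<lambda>e. f e ` S e)"
proof -
  \<comment> \<open>The sum runs over all numbers below the code of the set, hence over its members,
    and so dominates every image value.\<close>
  let ?b = "\<lambda>e. Suc (\<Sum>y<set_encode (S e). f e y)"
  have f': "computable (\<lambda>e. f (g e) (h e))" if "computable g" "computable h" for g h
    using computable_comp[OF f computable_prod_encode[OF that]] by simp
  have "computable_sets (\<lambda>e. {n. n < ?b e \<and> (\<exists>y\<in>S e. n = f e y)})"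
    by (intro computable_sets_bounded computable_Suc computable_sum_less computable_set_encode
        decidable_bex decidable_eq f' computable_pfst computable_psnd computable_id f S
        computable_sets_comp[OF S])
  moreover have "{n. n < ?b e \<and> (\<exists>y\<in>S e. n = f e y)} = f e ` S e" for e
  proof -
    have "f e y \<le> (\<Sum>y<set_encode (S e). f e y)" if "y \<in> S e" for y
      using mem_less_set_encode[OF computable_sets_finite[OF S] that] by (simp add: member_le_sum)
    then show ?thesis by (auto simp: less_Suc_eq_le)
  qed
  ultimately show ?thesis by simp
qed

lemma computable_sets_UN:
  assumes S: "computable_sets S" and T: "computable_sets (\<lambda>e. T (pfst e) (psnd e))"
  shows "computable_sets (\<lambda>e. \<Union>y\<in>S e. T e y)"
proof -
  let ?b = "\<lambda>e. \<Sum>y<set_encode (S e). set_encode (T e y)"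
  have T': "computable_sets (\<lambda>e. T (g e) (h e))" if "computable g" "computable h" for g h
    using computable_sets_comp[OF T computable_prod_encode[OF that]] by simp
  have fin: "finite (T e y)" for e y
    using computable_sets_finite[OF T, of "prod_encode (e, y)"] by simp
  have "computable_sets (\<lambda>e. {n. n < ?b e \<and> (\<exists>y\<in>S e. n \<in> T e y)})"
    by (intro computable_sets_bounded computable_sum_less computable_set_encode
        decidable_bex decidable_mem T' computable_pfst computable_psnd computable_id T S
        computable_sets_comp[OF S])
  moreover have "{n. n < ?b e \<and> (\<exists>y\<in>S e. n \<in> T e y)} = (\<Union>y\<in>S e. T e y)" for e
  proof -
    have "n < ?b e" if "y \<in> S e" "n \<in> T e y" for n y
    proof -
      have "n < set_encode (T e y)" by (rule mem_less_set_encode[OF fin that(2)])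
      also have "\<dots> \<le> ?b e"
        using mem_less_set_encode[OF computable_sets_finite[OF S] that(1)]
        by (intro member_le_sum) auto
      finally show ?thesis .
    qed
    then show ?thesis by blast
  qed
  ultimately show ?thesis by simp
qed

lemma computable_sets_insert:
  assumes "computable f" and "computable_sets S"
  shows "computable_sets (\<lambda>e. insert (f e) (S e))"
proof -
  have "computable_sets (\<lambda>e. {n. n < Suc (f e + set_encode (S e)) \<and> (n = f e \<or> n \<in> S e)})"
    by (intro computable_sets_bounded computable_Suc computable_add computable_set_encode decidable_disj
      decidable_eq decidable_mem' assms computable_psnd computable_pfst computable_id computable_comp[OF assms(1)])
  moreover have "{n. n < Suc (f e + set_encode (S e)) \<and> (n = f e \<or> n \<in> S e)} = insert (f e) (S e)" for e
    using mem_less_set_encode[OF computable_sets_finite[OF assms(2)], of _ e] by fastforce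
  ultimately show ?thesis by simp
qed

lemma computable_sets_Un:
  assumes "computable_sets S" and "computable_sets T"
  shows "computable_sets (\<lambda>e. S e \<union> T e)"
proof -
  have "computable_sets (\<lambda>e. {n. n < set_encode (S e) + set_encode (T e) \<and> (n \<in> S e \<or> n \<in> T e)})"
    by (intro computable_sets_bounded computable_add computable_set_encode decidable_disj decidable_mem' assms)
  moreover have "{n. n < set_encode (S e) + set_encode (T e) \<and> (n \<in> S e \<or> n \<in> T e)} = S e \<union> T e" for e
    using mem_less_set_encode[OF computable_sets_finite[OF assms(1)], of _ e]
      mem_less_set_encode[OF computable_sets_finite[OF assms(2)], of _ e] by fastforce
  ultimately show ?thesis by simp
qed

lemma computable_sets_empty: "computable_sets (\<lambda>e. {})"
  unfolding computable_sets_def by (simp add: computable_const)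

subsection \<open>Coded lists\<close>

text \<open>A nonempty list is coded by the successor of a pair, the empty list by 0. The value at 0
  keeps iteration past the end at the empty list.\<close>

definition tl_code :: "nat \<Rightarrow> nat" where
  "tl_code n = (if n = 0 then 0 else psnd (n - 1))"

lemma list_decode_tl_code: "list_decode (tl_code n) = tl (list_decode n)"
  unfolding tl_code_def by (cases n) (auto split: prod.split)

lemma list_decode_funpow_tl_code: "list_decode ((tl_code ^^ i) n) = drop i (list_decode n)"
  by (induction i) (auto simp: list_decode_tl_code drop_Suc tl_drop)

lemma computable_tl_code_funpow:
  assumes "computable f" and "computable i"
  shows "computable (\<lambda>e. (tl_code ^^ i e) (f e))"
proof -
  have tl: "computable (\<lambda>e. tl_code (g e))" if "computable g" for g
    unfolding tl_code_def
    by (intro computable_if decidable_eq computable_const computable_psnd computable_diff that)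
  have "computable (\<lambda>e. rec_nat (f e) (\<lambda>_ r. tl_code r) (i e))"
    by (intro computable_rec_nat tl computable_psnd computable_id assms)
  moreover have "rec_nat a (\<lambda>_ r. tl_code r) m = (tl_code ^^ m) a" for a m
    by (induction m) auto
  ultimately show ?thesis by simp
qed

lemma list_decode_eq_Nil: "list_decode n = [] \<longleftrightarrow> n = 0"
  by (metis list_decode.simps(1) list_decode_inverse)

lemma computable_length:
  assumes "computable f"
  shows "computable (\<lambda>e. length (list_decode (f e)))"
proof -
  have eq: "(tl_code ^^ i) n = 0 \<longleftrightarrow> length (list_decode n) \<le> i" for i n
    by (metis list_decode_eq_Nil list_decode_funpow_tl_code drop_eq_Nil)
  have "computable (\<lambda>e. LEAST i. (tl_code ^^ i) (f e) = 0)"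
    by (rule computable_Least)
      (intro decidable_eq computable_tl_code_funpow computable_const computable_psnd computable_pfst
        computable_id computable_comp[OF assms], auto simp: eq)
  moreover have "(LEAST i. (tl_code ^^ i) n = 0) = length (list_decode n)" for n
    unfolding eq by (rule Least_equality) auto
  ultimately show ?thesis by simp
qed

definition nth_code :: "nat \<Rightarrow> nat \<Rightarrow> nat" where
  "nth_code n i = (if i < length (list_decode n) then list_decode n ! i else 0)"

lemma nth_code_list_encode [simp]: "i < length xs \<Longrightarrow> nth_code (list_encode xs) i = xs ! i"
  unfolding nth_code_def by simp

lemma computable_nth_code:
  assumes "computable f" and "computable i"
  shows "computable (\<lambda>e. nth_code (f e) (i e))"
proof -
  have eq: "nth_code n i = (if i < length (list_decode n) then pfst ((tl_code ^^ i) n - 1) else 0)" for n i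
  proof (cases "i < length (list_decode n)")
    case True
    let ?m = "(tl_code ^^ i) n"
    have d: "list_decode ?m = list_decode n ! i # drop (Suc i) (list_decode n)"
      using True by (simp add: list_decode_funpow_tl_code Cons_nth_drop_Suc)
    then obtain m' where m': "?m = Suc m'" by (cases ?m) auto
    show ?thesis using d True unfolding nth_code_def m' by (auto split: prod.splits)
  qed (simp add: nth_code_def)
  show ?thesis unfolding eq
    by (intro computable_if decidable_less computable_length computable_pfst computable_diff
        computable_tl_code_funpow computable_const assms)
qed

text \<open>Every number codes exactly one list, so searching for a code with the prescribed length
  and entries replaces a recursion along the list.\<close>

lemma computable_list_encode_map_upt:
  assumes k: "computable k" and f: "computable (\<lambda>e. f (pfst e) (psnd e))"
  shows "computable (\<lambda>e. list_encode (map (f e) [0..<k e]))"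
proof -
  have f': "computable (\<lambda>e. f (g e) (h e))" if "computable g" "computable h" for g h
    using computable_comp[OF f computable_prod_encode[OF that]] by simp
  have "computable (\<lambda>e. LEAST n. length (list_decode n) = k e \<and> (\<forall>i<k e. nth_code n i = f e i))"
  proof (rule computable_Least)
    show "\<exists>n. length (list_decode n) = k e \<and> (\<forall>i<k e. nth_code n i = f e i)" for e
      by (rule exI[of _ "list_encode (map (f e) [0..<k e])"]) simp
  qed (intro decidable_conj decidable_eq decidable_ball_less computable_length computable_nth_code f'
      computable_pfst computable_psnd computable_id computable_comp[OF k])
  moreover have "(LEAST n. length (list_decode n) = k e \<and> (\<forall>i<k e. nth_code n i = f e i)) =
      list_encode (map (f e) [0..<k e])" for e
  proof (rule Least_equality, simp)
    fix n assume "length (list_decode n) = k e \<and> (\<forall>i<k e. nth_code n i = f e i)"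
    then have "list_decode n = map (f e) [0..<k e]"
      by (intro nth_equalityI) (auto simp: nth_code_def)
    then show "list_encode (map (f e) [0..<k e]) \<le> n" by (metis list_decode_inverse order_refl)
  qed
  ultimately show ?thesis by simp
qed

lemma computable_list_encode_Nil: "computable (\<lambda>e. list_encode [])"
  by (simp add: computable_const)

lemma computable_list_encode_Cons:
  "computable f \<Longrightarrow> computable (\<lambda>e. list_encode (xs e)) \<Longrightarrow> computable (\<lambda>e. list_encode (f e # xs e))"
  by (simp add: computable_Suc computable_prod_encode)

text \<open>The rules follow the syntax of expressions: a function written with arithmetic, bounded
  quantifiers and finite set comprehensions is shown computable by resolution alone.\<close>

lemmas computable_intros =
  computable_id computable_const computable_Suc computable_add computable_mult computable_diff
  computable_prod_encode computable_pfst computable_psnd computable_if computable_power2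
  computable_set_encode computable_length computable_nth_code computable_list_encode_map_upt
  computable_list_encode_Nil computable_list_encode_Cons
  decidable_const decidable_not decidable_if decidable_conj decidable_disj decidable_imp decidable_le
  decidable_less decidable_eq decidable_mem decidable_bex decidable_ball decidable_bex_less
  decidable_ball_less
  computable_sets_decode computable_sets_lessThan computable_sets_filter computable_sets_image
  computable_sets_UN computable_sets_insert computable_sets_Un computable_sets_empty


section \<open>Big-step semantics\<close>

abbreviation attr_leaf :: "'q \<Rightarrow> 'v \<Rightarrow> ('g + 'q \<times> 'v) tree" where
  "attr_leaf q v \<equiv> Node (Inr (q, v)) []"

definition inst :: "nat list \<Rightarrow> ('g + 'q \<times> nat) tree \<Rightarrow> ('g + 'q \<times> nat list) tree" where
  "inst v = map_tree (map_sum id (\<lambda>(q, j). (q, child v j)))"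

inductive ev :: "('q, 'f, 'g) att \<Rightarrow> 'f option tree \<Rightarrow> ('g + 'q \<times> nat list) tree \<Rightarrow> 'g tree \<Rightarrow> bool"
  for A s where
  ev_node: "list_all2 (ev A s) ts us \<Longrightarrow> ev A s (Node (Inl g) ts) (Node g us)"
| ev_attr: "v \<in> nodes s \<Longrightarrow> ((\<gamma>, i), \<xi>) \<in> rules A (label s v) \<Longrightarrow>
   \<gamma> \<in> syn A \<and> i = 0 \<or> \<gamma> \<in> inh A \<and> i > 0 \<Longrightarrow> ev A s (inst v \<xi>) t \<Longrightarrow>
   ev A s (attr_leaf \<gamma> (child v i)) t"

lemma ev_node_iff: "ev A s (Node (Inl g) ts) t \<longleftrightarrow> (\<exists>us. t = Node g us \<and> list_all2 (ev A s) ts us)"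
  by (auto elim: ev.cases intro: ev_node)

lemma ev_map_Inl: "ev A s (map_tree Inl t) t"
  by (induction t) (auto intro!: ev_node simp: list_all2_conv_all_nth)

lemma ev_in_context:
  assumes "in_context (att_rewrite A s) X Y" and "ev A s Y t"
  shows "ev A s X t"
  using assms
proof (induction X Y arbitrary: t rule: in_context.induct)
  case (here X Y)
  then show ?case by (auto elim!: att_rewrite.cases intro: ev_attr simp: inst_def)
next
  case (below j ts Y f)
  from below.prems show ?case
  proof cases
    case (ev_node us g)
    have "ev A s (ts ! i) (us ! i)" if "i < length ts" for i
    proof (cases "i = j")
      case True
      then show ?thesis using ev_node(3) below.hyps below.IH by (auto simp: list_all2_conv_all_nth)
    next
      case False
      then show ?thesis using ev_node(3) that by (auto simp: list_all2_conv_all_nth)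
    qed
    then show ?thesis using ev_node by (auto intro!: ev.ev_node simp: list_all2_conv_all_nth)
  qed (use below.hyps in auto)
qed

lemma in_context_arg:
  assumes "(in_context r)\<^sup>*\<^sup>* x y"
  shows "(in_context r)\<^sup>*\<^sup>* (Node f (zs @ x # ws)) (Node f (zs @ y # ws))"
  using assms
proof (induction rule: rtranclp_induct)
  case (step y z)
  have "in_context r (Node f (zs @ y # ws)) (Node f (zs @ z # ws))"
    using in_context.below[of "length zs" "zs @ y # ws" r z f] step.hyps by simp
  then show ?case using step.IH by simp
qed simp

text \<open>Arguments are rewritten from left to right; \<open>zs\<close> holds those already
  finished.\<close>

lemma in_context_args:
  assumes "list_all2 (in_context r)\<^sup>*\<^sup>* xs ys"
  shows "(in_context r)\<^sup>*\<^sup>* (Node f (zs @ xs)) (Node f (zs @ ys))"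
  using assms
proof (induction arbitrary: zs rule: list_all2_induct)
  case (Cons x xs y ys)
  show ?case
    using in_context_arg[OF Cons(1), of f zs xs] Cons.IH[of "zs @ [y]"] by simp
qed simp

lemma steps_iff_ev: "(att_step A s)\<^sup>*\<^sup>* X (map_tree Inl t) \<longleftrightarrow> ev A s X t"
proof
  assume "(att_step A s)\<^sup>*\<^sup>* X (map_tree Inl t)"
  then show "ev A s X t"
    by (induction rule: converse_rtranclp_induct) (auto simp: att_step_def intro: ev_in_context ev_map_Inl)
next
  assume "ev A s X t"
  then show "(att_step A s)\<^sup>*\<^sup>* X (map_tree Inl t)"
  proof (induction rule: ev.induct)
    case (ev_node ts us g)
    then show ?case
      using in_context_args[of "att_rewrite A s" ts "map (map_tree Inl) us" "Inl g" "[]"]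
      by (simp add: att_step_def list_all2_conv_all_nth)
  next
    case (ev_attr v \<gamma> i \<xi> t)
    have "att_step A s (attr_leaf \<gamma> (child v i)) (inst v \<xi>)"
      unfolding att_step_def inst_def using ev_attr.hyps by (intro in_context.here att_rewrite.intros)
    then show ?case using ev_attr.IH by simp
  qed
qed

lemma att_trans_iff:
  "(s, t) \<in> att_trans A \<longleftrightarrow> s \<in> trees (ialph A) \<and> t \<in> trees (oalph A) \<and>
     ev A (mark_root s) (attr_leaf (init A) [1]) t"
  by (simp add: att_trans_def steps_iff_ev)

subsection \<open>Nodes and subtrees\<close>

fun root :: "'f tree \<Rightarrow> 'f" where "root (Node f ts) = f"

fun children :: "'f tree \<Rightarrow> 'f tree list" where "children (Node f ts) = ts"

fun subtree :: "'f tree \<Rightarrow> nat list \<Rightarrow> 'f tree" where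
  "subtree t [] = t"
| "subtree (Node f ts) (i # v) = subtree (ts ! (i - 1)) v"

lemma label_eq_root: "label t v = root (subtree t v)"
  by (induction t v rule: label.induct) auto

lemma is_node_Nil [simp]: "is_node t []"
  by (rule is_node.intros)

lemma is_node_Cons [simp]: "is_node (Node f ts) (i # v) \<longleftrightarrow> i \<in> {1..length ts} \<and> is_node (ts ! (i - 1)) v"
  by (auto elim: is_node.cases intro: is_node.intros)

lemma is_node_snoc: "is_node t (v @ [i]) \<longleftrightarrow> is_node t v \<and> i \<in> {1..length (children (subtree t v))}"
proof (induction t v rule: subtree.induct)
  case (1 t)
  then show ?case by (cases t) simp
qed auto

lemma subtree_snoc: "subtree t (v @ [i]) = children (subtree t v) ! (i - 1)"
proof (induction t v rule: subtree.induct)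
  case (1 t)
  then show ?case by (cases t) simp
qed auto

lemma trees_Node_iff: "Node f ts \<in> trees \<Sigma> \<longleftrightarrow> (f, length ts) \<in> \<Sigma> \<and> (\<forall>t \<in> set ts. t \<in> trees \<Sigma>)"
  by (auto elim: trees.cases intro: trees.intros)

lemma subtree_in_trees: "t \<in> trees \<Sigma> \<Longrightarrow> is_node t v \<Longrightarrow> subtree t v \<in> trees \<Sigma>"
  by (induction t v rule: subtree.induct) (auto simp: trees_Node_iff)

lemma subtree_map_tree: "is_node t v \<Longrightarrow> subtree (map_tree h t) v = map_tree h (subtree t v)"
  by (induction t v rule: subtree.induct) auto

lemma is_node_map_tree [simp]: "is_node (map_tree h t) v \<longleftrightarrow> is_node t v"
  by (induction t v rule: subtree.induct) auto

lemma nodes_mark_root: "v \<in> nodes (mark_root s) \<longleftrightarrow> v = [] \<or> (\<exists>w. v = 1 # w \<and> is_node s w)"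
  unfolding nodes_def mark_root_def by (cases v) auto

lemma label_mark_root_Nil [simp]: "label (mark_root s) [] = None"
  by (simp add: mark_root_def)

lemma root_map_tree: "root (map_tree h t) = h (root t)"
  by (cases t) simp

lemma label_mark_root_Cons [simp]: "is_node s w \<Longrightarrow> label (mark_root s) (Suc 0 # w) = Some (label s w)"
  by (simp add: mark_root_def label_eq_root subtree_map_tree root_map_tree)

lemma label_in_alphabet:
  "s \<in> trees \<Sigma> \<Longrightarrow> is_node s w \<Longrightarrow> (label s w, length (children (subtree s w))) \<in> \<Sigma>"
  unfolding label_eq_root using subtree_in_trees[of s \<Sigma> w]
  by (cases "subtree s w" rule: tree.exhaust) (simp add: trees_Node_iff)

text \<open>The address alone does not fix the node whose rule applies, as \<open>child v 0\<close>
  may equal \<open>child v' i'\<close>. The second hypothesis reflects whether the occurrence is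
  synthesized or inherited, which settles this.\<close>

lemma child_inj:
  assumes "child v i = child v' i'" and "i = 0 \<longleftrightarrow> i' = 0"
  shows "v = v' \<and> i = i'"
  using assms by (auto simp: child_def split: if_splits)

subsection \<open>Determinism and totality\<close>

definition attrs :: "('g + 'q \<times> 'v) tree \<Rightarrow> ('q \<times> 'v) set" where
  "attrs \<xi> = {z. Inr z \<in> set_tree \<xi>}"

lemma attrs_Node: "attrs (Node f ts) = {z. f = Inr z} \<union> (\<Union>t\<in>set ts. attrs t)"
  unfolding attrs_def by auto

lemma attrs_inst:
  fixes \<xi> :: "('g + 'q \<times> nat) tree"
  shows "attrs (inst v \<xi>) = (\<lambda>(q, j). (q, child v j)) ` attrs \<xi>"
proof -
  let ?h = "\<lambda>(q, j). (q, child v j)"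
  have eq: "(Inr z = map_sum id ?h x) \<longleftrightarrow> (\<exists>y. x = Inr y \<and> z = ?h y)" for z and x :: "'g + 'q \<times> nat"
    by (cases x) auto
  have "attrs (inst v \<xi>) = {z. \<exists>x\<in>set_tree \<xi>. Inr z = map_sum id ?h x}"
    by (simp only: attrs_def inst_def tree.set_map image_iff)
  also have "\<dots> = ?h ` attrs \<xi>" unfolding eq attrs_def by (simp only: image_def mem_Collect_eq) blast
  finally show ?thesis .
qed

lemma trees_with_Inl [simp]:
  "Node (Inl g) ts \<in> trees_with \<Delta> \<Lambda> \<longleftrightarrow> (g, length ts) \<in> \<Delta> \<and> (\<forall>t\<in>set ts. t \<in> trees_with \<Delta> \<Lambda>)"
  unfolding trees_with_def trees_Node_iff by auto

lemma trees_with_Inr [simp]: "Node (Inr z) ts \<in> trees_with \<Delta> \<Lambda> \<longleftrightarrow> z \<in> \<Lambda> \<and> ts = []"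
  unfolding trees_with_def trees_Node_iff by auto

lemma trees_with_induct [consumes 1, case_names Inl Inr]:
  assumes "X \<in> trees_with \<Delta> \<Lambda>"
    and "\<And>g ts. (g, length ts) \<in> \<Delta> \<Longrightarrow> (\<And>t. t \<in> set ts \<Longrightarrow> t \<in> trees_with \<Delta> \<Lambda>) \<Longrightarrow>
      (\<And>t. t \<in> set ts \<Longrightarrow> P t) \<Longrightarrow> P (Node (Inl g) ts)"
    and "\<And>z. z \<in> \<Lambda> \<Longrightarrow> P (Node (Inr z) [])"
  shows "P X"
  using assms(1)
proof (induction X)
  case (Node f ts)
  then show ?case using assms(2,3) by (cases f) auto
qed

lemma attrs_subset: "X \<in> trees_with \<Delta> \<Lambda> \<Longrightarrow> attrs X \<subseteq> \<Lambda>"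
  by (induction rule: trees_with_induct) (auto simp: attrs_Node)

lemma trees_with_mono: "X \<in> trees_with \<Delta> \<Lambda> \<Longrightarrow> \<Lambda> \<subseteq> \<Lambda>' \<Longrightarrow> X \<in> trees_with \<Delta> \<Lambda>'"
  by (induction rule: trees_with_induct) auto

lemma inst_in_trees_with: "X \<in> trees_with \<Delta> \<Lambda> \<Longrightarrow> inst v X \<in> trees_with \<Delta> UNIV"
  by (induction rule: trees_with_induct) (auto simp: inst_def)

lemma is_att_rule_Some:
  assumes "is_att A" "(\<sigma>, k) \<in> ialph A" "((\<gamma>, i), \<xi>) \<in> rules A (Some \<sigma>)"
  shows "\<gamma> \<in> syn A \<and> i = 0 \<or> \<gamma> \<in> inh A \<and> i \<in> {1..k}"
    and "\<xi> \<in> trees_with (oalph A) (syn A \<times> {1..k} \<union> inh A \<times> {0})"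
  using assms unfolding is_att_def by fast+

lemma is_att_rule_None:
  assumes "is_att A" "((\<gamma>, i), \<xi>) \<in> rules A None"
  shows "\<gamma> \<in> inh A" "i = 1" "\<xi> \<in> trees_with (oalph A) (syn A \<times> {1})"
  using assms unfolding is_att_def by fast+

lemma rule_in_trees_with:
  assumes "is_att A" "s \<in> trees (ialph A)" "v \<in> nodes (mark_root s)"
    "(l, \<xi>) \<in> rules A (label (mark_root s) v)"
  shows "\<xi> \<in> trees_with (oalph A) UNIV"
proof -
  obtain \<gamma> i where l: "l = (\<gamma>, i)" by fastforce
  show ?thesis
  proof (cases "v = []")
    case True
    then show ?thesis using is_att_rule_None(3)[of A \<gamma> i \<xi>] assms l trees_with_mono[OF _ subset_UNIV] by auto
  next
    case False
    then obtain w where "v = 1 # w" "is_node s w" using assms(3) nodes_mark_root by blast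
    then show ?thesis
      using is_att_rule_Some(2)[OF assms(1) label_in_alphabet[OF assms(2)], of w \<gamma> i \<xi>] assms(4) l
        trees_with_mono[OF _ subset_UNIV] by auto
  qed
qed

text \<open>Rules introduce only symbols of \<open>oalph A\<close>, so the condition on outputs in
  \<open>att_trans\<close> holds for every value of the initial attribute.\<close>

lemma ev_in_trees:
  assumes "is_att A" "s \<in> trees (ialph A)" "ev A (mark_root s) X t" "X \<in> trees_with (oalph A) UNIV"
  shows "t \<in> trees (oalph A)"
  using assms(3,4)
proof (induction rule: ev.induct)
  case (ev_node ts us g)
  then show ?case by (fastforce simp: trees_Node_iff list_all2_conv_all_nth in_set_conv_nth)
next
  case (ev_attr v \<gamma> i \<xi> t)
  then show ?case using rule_in_trees_with[OF assms(1,2)] inst_in_trees_with by blast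
qed

text \<open>Leaves evaluate independently, so one value may be chosen for each. Membership in
  \<open>trees_with\<close> ensures that attribute labels occur only at leaves, where they can be
  rewritten.\<close>

lemma ev_total:
  assumes "X \<in> trees_with \<Delta> \<Lambda>" and "\<And>q v. (q, v) \<in> attrs X \<Longrightarrow> \<exists>t. ev A s (attr_leaf q v) t"
  shows "\<exists>t. ev A s X t"
  using assms
proof (induction rule: trees_with_induct)
  case (Inl g ts)
  have "\<exists>u. ev A s t u" if "t \<in> set ts" for t
    using Inl.IH[OF that] Inl.prems that unfolding attrs_Node by blast
  then obtain h where "\<And>t. t \<in> set ts \<Longrightarrow> ev A s t (h t)" by metis
  then have "ev A s (Node (Inl g) ts) (Node g (map h ts))"
    by (intro ev_node) (auto simp: list_all2_conv_all_nth)
  then show ?case by blast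
next
  case (Inr z)
  then show ?case by (cases z) (auto simp: attrs_Node)
qed

lemma deterministic_rules:
  assumes "deterministic A" "s \<in> trees (ialph A)" "v \<in> nodes (mark_root s)"
  shows "single_valued (rules A (label (mark_root s) v))"
proof (cases "v = []")
  case True
  then show ?thesis using assms(1) by (simp add: deterministic_def)
next
  case False
  then obtain w where "v = 1 # w" "is_node s w" using assms(3) nodes_mark_root by blast
  then show ?thesis using assms(1) label_in_alphabet[OF assms(2), of w] unfolding deterministic_def by auto
qed

text \<open>A synthesized occurrence is rewritten at its own node and an inherited one at the
  parent, so only one left-hand side matches; determinism leaves one rule.\<close>

lemma ev_unique:
  assumes A: "is_att A" "deterministic A" and s: "s \<in> trees (ialph A)"
    and "ev A (mark_root s) X t" and "ev A (mark_root s) X t'"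
  shows "t = t'"
  using assms(4,5)
proof (induction arbitrary: t' rule: ev.induct)
  case (ev_node ts us g)
  then obtain us' where us': "t' = Node g us'" "list_all2 (ev A (mark_root s)) ts us'"
    unfolding ev_node_iff by blast
  with ev_node.IH have "us = us'"
    by (intro nth_equalityI) (auto simp: list_all2_conv_all_nth)
  then show ?case using us' by simp
next
  case (ev_attr v \<gamma> i \<xi> t)
  from ev_attr.prems obtain v' i' \<xi>' where r': "v' \<in> nodes (mark_root s)"
    "((\<gamma>, i'), \<xi>') \<in> rules A (label (mark_root s) v')"
    "\<gamma> \<in> syn A \<and> i' = 0 \<or> \<gamma> \<in> inh A \<and> i' > 0" "ev A (mark_root s) (inst v' \<xi>') t'"
    "child v i = child v' i'"
    by (auto elim: ev.cases)
  have "i = 0 \<longleftrightarrow> i' = 0" using A(1) ev_attr.hyps(3) r'(3) unfolding is_att_def by auto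
  then have "v = v'" "i = i'" using child_inj[OF r'(5)] by auto
  then have "\<xi> = \<xi>'"
    using deterministic_rules[OF A(2) s r'(1)] r'(2) ev_attr.hyps(2) unfolding single_valued_def by blast
  then show ?case using ev_attr.IH r'(4) \<open>v = v'\<close> by blast
qed

lemma att_trans_single_valued: "is_att A \<Longrightarrow> deterministic A \<Longrightarrow> single_valued (att_trans A)"
  unfolding single_valued_def att_trans_iff using ev_unique by blast

subsection \<open>Bottom-up relabelings\<close>

text \<open>Besides input trees the relation covers the intermediate forms of a rewrite sequence, in
  which finished subtrees carry a state above their output.\<close>

inductive brun :: "('p, 'f, 'h) burel \<Rightarrow> ('p, 'f, 'h) blabel tree \<Rightarrow> 'p \<Rightarrow> 'h tree \<Rightarrow> bool" for B where
  brun_St: "brun B (Node (St p) [map_tree Out t]) p t"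
| brun_In: "((\<sigma>, ps), (p, \<sigma>')) \<in> brules B \<Longrightarrow> length Xs = length ps \<Longrightarrow> length us = length ps \<Longrightarrow>
    (\<And>i. i < length ps \<Longrightarrow> brun B (Xs ! i) (ps ! i) (us ! i)) \<Longrightarrow> brun B (Node (In \<sigma>) Xs) p (Node \<sigma>' us)"

lemma brun_In_iff: "brun B (Node (In \<sigma>) Xs) p u \<longleftrightarrow>
  (\<exists>ps \<sigma>' us. u = Node \<sigma>' us \<and> ((\<sigma>, ps), (p, \<sigma>')) \<in> brules B \<and> length Xs = length ps \<and>
     length us = length ps \<and> (\<forall>i < length ps. brun B (Xs ! i) (ps ! i) (us ! i)))"
proof
  show "brun B (Node (In \<sigma>) Xs) p u \<Longrightarrow> \<exists>ps \<sigma>' us. u = Node \<sigma>' us \<and> ((\<sigma>, ps), (p, \<sigma>')) \<in> brules B \<and>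
    length Xs = length ps \<and> length us = length ps \<and> (\<forall>i < length ps. brun B (Xs ! i) (ps ! i) (us ! i))"
    by (erule brun.cases) (simp, blast)
qed (auto intro: brun_In)

lemma brun_St_iff: "brun B (Node (St p) Xs) p' u \<longleftrightarrow> p' = p \<and> Xs = [map_tree Out u]"
  by (auto elim: brun.cases intro: brun_St)

text \<open>Every step leaves a state label behind, and a pure output tree has none. Hence no step
  inside a subtree can produce the finished output that \<open>brun\<close> requires below a
  state.\<close>

lemma no_step_to_Out: "in_context (burel_rewrite B) X Y \<Longrightarrow> Y \<noteq> map_tree Out t"
proof (induction X Y arbitrary: t rule: in_context.induct)
  case (here X Y)
  then show ?case by (cases t) (auto elim: burel_rewrite.cases)
next
  case (below j ts Y f)
  show ?case
  proof
    assume eq: "Node f (ts[j := Y]) = map_tree Out t"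
    obtain g us where t: "t = Node g us" by (cases t)
    have "ts[j := Y] = map (map_tree Out) us" using eq t by simp
    then have "ts[j := Y] ! j = map (map_tree Out) us ! j" "length ts = length us"
      by (auto dest: arg_cong[of _ _ length])
    then have "Y = map_tree Out (us ! j)" using below.hyps(1) by simp
    then show False using below.IH by blast
  qed
qed

lemma brun_in_context:
  assumes "in_context (burel_rewrite B) X Y" and "brun B Y p u"
  shows "brun B X p u"
  using assms
proof (induction X Y arbitrary: p u rule: in_context.induct)
  case (here X Y)
  from here(1) show ?case
  proof cases
    case (1 \<sigma> ps q \<sigma>' ts)
    then have p: "p = q" and "Node (Out \<sigma>') ts = map_tree Out u"
      using here(2) by (auto simp: brun_St_iff)
    then obtain us where us: "u = Node \<sigma>' us" "ts = map (map_tree Out) us" by (cases u) auto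
    show ?thesis unfolding 1 us p
    proof (rule brun_In[OF 1(3)])
      fix i assume "i < length ps"
      then show "brun B (map2 (\<lambda>p t. Node (St p) [t]) ps (map (map_tree Out) us) ! i) (ps ! i) (us ! i)"
        using 1(4) us by (simp add: brun_St)
    qed (use 1 us in auto)
  qed
next
  case (below j ts Y f)
  show ?case
  proof (cases f)
    case (In \<sigma>)
    from below.prems[unfolded In brun_In_iff] obtain ps \<sigma>' us where *:
      "u = Node \<sigma>' us" "((\<sigma>, ps), (p, \<sigma>')) \<in> brules B" "length ts = length ps" "length us = length ps"
      "\<And>i. i < length ps \<Longrightarrow> brun B (ts[j := Y] ! i) (ps ! i) (us ! i)" by auto
    have "brun B (ts ! i) (ps ! i) (us ! i)" if "i < length ps" for i
      using *(5)[OF that] below.IH that *(3) by (cases "i = j") auto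
    then show ?thesis unfolding In brun_In_iff using * by blast
  next
    case (St q)
    then have eq: "ts[j := Y] = [map_tree Out u]" using below.prems by (simp add: brun_St_iff)
    then have "length ts = 1" by (metis length_list_update length_Cons list.size(3) One_nat_def)
    then have "Y = map_tree Out u" using eq below.hyps(1) by (cases ts) auto
    then show ?thesis using no_step_to_Out[OF below.hyps(2)] by blast
  qed (use below.prems in \<open>auto elim: brun.cases\<close>)
qed

lemma burel_steps_iff: "(burel_step B)\<^sup>*\<^sup>* X (Node (St p) [map_tree Out u]) \<longleftrightarrow> brun B X p u"
proof
  assume "(burel_step B)\<^sup>*\<^sup>* X (Node (St p) [map_tree Out u])"
  then show "brun B X p u"
    by (induction rule: converse_rtranclp_induct) (auto simp: burel_step_def intro: brun_in_context brun_St)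
next
  assume "brun B X p u"
  then show "(burel_step B)\<^sup>*\<^sup>* X (Node (St p) [map_tree Out u])"
  proof (induction rule: brun.induct)
    case (brun_In \<sigma> ps p \<sigma>' Xs us)
    let ?ys = "map2 (\<lambda>p t. Node (St p) [t]) ps (map (map_tree Out) us)"
    have "list_all2 (in_context (burel_rewrite B))\<^sup>*\<^sup>* Xs ?ys"
      using brun_In by (auto simp: list_all2_conv_all_nth burel_step_def)
    from in_context_args[OF this, of "In \<sigma>" "[]"]
    have "(burel_step B)\<^sup>*\<^sup>* (Node (In \<sigma>) Xs) (Node (In \<sigma>) ?ys)" by (simp add: burel_step_def)
    moreover have "burel_step B (Node (In \<sigma>) ?ys) (Node (St p) [Node (Out \<sigma>') (map (map_tree Out) us)])"
      unfolding burel_step_def using brun_In.hyps by (intro in_context.here burel_rewrite.intros) auto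
    ultimately show ?case by simp
  qed simp
qed

lemma burel_trans_iff:
  "(s, u) \<in> burel_trans B \<longleftrightarrow> s \<in> trees (bialph B) \<and> u \<in> trees (boalph B) \<and>
     (\<exists>p \<in> bfinal B. brun B (map_tree In s) p u)"
  by (simp add: burel_trans_def burel_steps_iff)


section \<open>The construction\<close>

text \<open>
  A partial order is coded by the set of its pairs; its carrier consists of the reflexive pairs.
  The occurrence \<open>\<gamma>(\<pi>i)\<close> is coded by \<open>prod_encode (\<gamma>, i)\<close>, and \<open>proj i c\<close> is the order that
  the transition \<open>c\<close> induces on the attributes of the \<open>i\<close>-th child (of the node itself if
  \<open>i = 0\<close>). The bottom-up relabeling outputs \<open>(\<sigma>, W)\<close> with \<open>W\<close> the set of possible transitions,
  the top-down relabeling \<open>(\<sigma>, c)\<close> with \<open>c \<in> W\<close>; a state of the latter is a set of permitted orders.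
\<close>

definition le_in :: "nat \<Rightarrow> nat \<Rightarrow> nat \<Rightarrow> bool" where
  "le_in c x y \<longleftrightarrow> prod_encode (x, y) \<in> set_decode c"

definition order_code :: "nat \<Rightarrow> bool" where
  "order_code c \<longleftrightarrow> (\<forall>x y. le_in c x y \<longrightarrow> le_in c x x \<and> le_in c y y) \<and>
     (\<forall>x y. le_in c x y \<longrightarrow> le_in c y x \<longrightarrow> x = y) \<and>
     (\<forall>x y z. le_in c x y \<longrightarrow> le_in c y z \<longrightarrow> le_in c x z)"

definition proj :: "nat \<Rightarrow> nat \<Rightarrow> nat" where
  "proj i c = set_encode {n \<in> {..<c}. le_in c (prod_encode (pfst n, i)) (prod_encode (psnd n, i))}"

text \<open>Below and distinct means strictly smaller in the order \<open>c\<close>; this is what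
  keeps the chosen rules from being used in a circle.\<close>

definition fits :: "nat \<Rightarrow> nat \<times> nat \<Rightarrow> (nat + nat \<times> nat) tree \<Rightarrow> bool" where
  "fits c l \<xi> \<longleftrightarrow> (\<forall>z\<in>attrs \<xi>. le_in c (prod_encode z) (prod_encode l) \<and> z \<noteq> l)"

text \<open>All occurrences in a rule of \<open>#\<close> sit at node 1, so indices are dropped and
  the comparison takes place in the order at that node.\<close>

definition root_fits :: "nat \<Rightarrow> nat \<times> nat \<Rightarrow> (nat + nat \<times> nat) tree \<Rightarrow> bool" where
  "root_fits q l \<xi> \<longleftrightarrow> (\<forall>z\<in>attrs \<xi>. le_in q (fst z) (fst l) \<and> fst z \<noteq> fst l)"

text \<open>These occurrences are defined by the rules of the node itself. Its own inherited
  attributes are defined at its parent, the synthesized attributes of a child at that child.\<close>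

definition owned :: "('q, 'f, 'g) att \<Rightarrow> 'q \<Rightarrow> nat \<Rightarrow> bool" where
  "owned A \<gamma> i \<longleftrightarrow> \<gamma> \<in> syn A \<and> i = 0 \<or> \<gamma> \<in> inh A \<and> i > 0"

text \<open>Only owned occurrences must be justified here; the others in the carrier are justified
  at a neighbouring node, which sees the same trace of the order. The bound \<open>M\<close> leaves
  finitely many transitions.\<close>

definition valid :: "(nat, nat, nat) att \<Rightarrow> nat \<Rightarrow> nat \<Rightarrow> nat \<Rightarrow> bool" where
  "valid A M \<sigma> c \<longleftrightarrow> c < M \<and> order_code c \<and>
     (\<forall>\<gamma> i. le_in c (prod_encode (\<gamma>, i)) (prod_encode (\<gamma>, i)) \<and> owned A \<gamma> i \<longrightarrow>
       (\<exists>\<xi>. ((\<gamma>, i), \<xi>) \<in> rules A (Some \<sigma>) \<and> fits c (\<gamma>, i) \<xi>))"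

definition root_order :: "(nat, nat, nat) att \<Rightarrow> nat \<Rightarrow> bool" where
  "root_order A q \<longleftrightarrow> order_code q \<and> le_in q (init A) (init A) \<and>
     (\<forall>b\<in>inh A. le_in q b b \<longrightarrow> (\<exists>\<xi>. ((b, 1), \<xi>) \<in> rules A None \<and> root_fits q (b, 1) \<xi>))"

definition moves :: "(nat, nat, nat) att \<Rightarrow> nat \<Rightarrow> nat \<Rightarrow> nat list \<Rightarrow> nat" where
  "moves A M \<sigma> ps = set_encode {c. valid A M \<sigma> c \<and> (\<forall>i<length ps. proj (Suc i) c \<in> set_decode (ps ! i))}"

definition up :: "nat \<Rightarrow> nat" where
  "up W = set_encode (proj 0 ` set_decode W)"

definition least_move :: "nat \<Rightarrow> nat \<Rightarrow> nat \<Rightarrow> bool" where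
  "least_move W u c \<longleftrightarrow> c \<in> set_decode W \<and> proj 0 c \<in> set_decode u \<and>
     (\<forall>c'\<in>set_decode W. proj 0 c' \<in> set_decode u \<longrightarrow> c \<le> c')"

definition pick :: "('l \<times> (nat + nat \<times> nat) tree) set \<Rightarrow> ('l \<Rightarrow> (nat + nat \<times> nat) tree \<Rightarrow> bool) \<Rightarrow>
    ('l \<times> (nat + nat \<times> nat) tree) set" where
  "pick R P = {(l, \<xi>) \<in> R. P l \<xi> \<and> (\<forall>\<xi>'. (l, \<xi>') \<in> R \<and> P l \<xi>' \<longrightarrow> code_tree \<xi> \<le> code_tree \<xi>')}"

definition labelled_alphabet :: "nat ralph \<Rightarrow> nat \<Rightarrow> nat ralph" where
  "labelled_alphabet \<Sigma> N = {(prod_encode (\<sigma>, W), k) | \<sigma> W k. (\<sigma>, k) \<in> \<Sigma> \<and> W < N}"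

definition bu_relabeling :: "(nat, nat, nat) att \<Rightarrow> nat \<Rightarrow> (nat, nat, nat) burel" where
  "bu_relabeling A m = \<lparr>bstates = {..<2 ^ 2 ^ m}, bialph = ialph A,
     boalph = labelled_alphabet (ialph A) (2 ^ 2 ^ m),
     bfinal = {p \<in> {..<2 ^ 2 ^ m}. \<exists>q\<in>set_decode p. q < 2 ^ m \<and> root_order A q},
     brules = {((\<sigma>, ps), (up (moves A (2 ^ m) \<sigma> ps), prod_encode (\<sigma>, moves A (2 ^ m) \<sigma> ps))) | \<sigma> ps.
       (\<sigma>, length ps) \<in> ialph A \<and> set ps \<subseteq> {..<2 ^ 2 ^ m}}\<rparr>"

definition td_relabeling :: "(nat, nat, nat) att \<Rightarrow> nat \<Rightarrow> (nat, nat, nat) att" where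
  "td_relabeling A m = \<lparr>syn = {..<2 ^ 2 ^ m}, inh = {},
     ialph = labelled_alphabet (ialph A) (2 ^ 2 ^ m), oalph = labelled_alphabet (ialph A) (2 ^ m),
     init = set_encode {q \<in> {..<2 ^ m}. root_order A q},
     rules = (\<lambda>x. case x of None \<Rightarrow> {} | Some l \<Rightarrow>
       {((u, 0), Node (Inl (prod_encode (pfst l, c))) (map (\<lambda>j. attr_leaf (2 ^ proj j c) j) [1..<Suc k])) | u c k.
         u < 2 ^ 2 ^ m \<and> (pfst l, k) \<in> ialph A \<and> c < 2 ^ m \<and> least_move (psnd l) u c})\<rparr>"

text \<open>
  The symbol \<open>#\<close> carries no look-around information, so the choice of a rule for \<open>b(\<pi>1)\<close> in
  \<open>R\<^sub>#\<close> is delegated to node \<open>1\<close>: there \<open>ask K b\<close> selects a right-hand side \<open>\<xi>\<close>, which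
  \<open>#\<close> returns as the value of \<open>answer K b \<xi>\<close>.
\<close>

definition ask :: "nat \<Rightarrow> nat \<Rightarrow> nat" where
  "ask K b = K + 2 * b"

definition answer :: "nat \<Rightarrow> nat \<Rightarrow> nat \<Rightarrow> nat" where
  "answer K b n = Suc (K + 2 * prod_encode (b, n))"

text \<open>Each right-hand side at the root has its own \<open>answer\<close> attribute, so
  \<open>#\<close> never has to choose. Labels do not reveal which node is node 1, so all of them
  offer \<open>ask\<close> rules.\<close>

definition choice_att :: "(nat, nat, nat) att \<Rightarrow> nat \<Rightarrow> nat \<Rightarrow> (nat, nat, nat) att" where
  "choice_att A m K = \<lparr>syn = syn A \<union> ask K ` inh A,
     inh = inh A \<union> {answer K b (code_tree \<xi>) | b i \<xi>. ((b, i), \<xi>) \<in> rules A None},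
     ialph = labelled_alphabet (ialph A) (2 ^ m), oalph = oalph A, init = init A,
     rules = (\<lambda>x. case x of
       None \<Rightarrow> {((b, 1), attr_leaf (ask K b) 1) | b. b \<in> inh A} \<union>
         {((answer K b (code_tree \<xi>), 1), \<xi>) | b i \<xi>. ((b, i), \<xi>) \<in> rules A None}
     | Some l \<Rightarrow> pick (rules A (Some (pfst l))) (fits (psnd l)) \<union>
         {((ask K b, 0), attr_leaf (answer K b (code_tree \<xi>)) 0) | b i \<xi>.
           ((b, i), \<xi>) \<in> pick (rules A None) (root_fits (proj 0 (psnd l)))})\<rparr>"

definition uniformizing_attU :: "(nat, nat, nat) att \<Rightarrow> nat \<Rightarrow> nat \<Rightarrow> (nat, nat, nat, nat, nat, nat, nat) attU" where
  "uniformizing_attU A m K = ((bu_relabeling A m, td_relabeling A m), choice_att A m K)"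

subsection \<open>Codes\<close>

lemma prod_encode_mono: "a \<le> a' \<Longrightarrow> b \<le> b' \<Longrightarrow> prod_encode (a, b) \<le> prod_encode (a', b')"
  unfolding prod_encode_def by (simp add: add_mono triangle_mono)

lemma set_encode_less_power:
  assumes "S \<subseteq> {..<m}"
  shows "set_encode S < 2 ^ m"
proof -
  have "set_encode S \<le> (\<Sum>i<m. 2 ^ i)"
    unfolding set_encode_def by (rule sum_mono2) (use assms in auto)
  also have "(\<Sum>i<m. 2 ^ i) < (2 ^ m :: nat)"
    by (induction m) auto
  finally show ?thesis .
qed

lemma set_decode_less_power:
  assumes "n \<in> set_decode c" and "c < 2 ^ m"
  shows "n < m"
proof -
  have "(2::nat) ^ n \<le> c"
    using member_le_sum[of n "set_decode c" "\<lambda>n. (2::nat) ^ n"] assms(1) set_decode_inverse[of c]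
    unfolding set_encode_def by simp
  then have "(2::nat) ^ n < 2 ^ m" using assms(2) by linarith
  then show ?thesis by simp
qed

text \<open>Pairing is monotone and dominates its components, so each pair in question has a code
  below \<open>c\<close>, and the range in the definition of \<open>proj\<close> loses
  nothing.\<close>

lemma le_in_proj: "le_in (proj i c) x y \<longleftrightarrow> le_in c (prod_encode (x, i)) (prod_encode (y, i))"
proof -
  have "prod_encode (x, y) < c" if "le_in c (prod_encode (x, i)) (prod_encode (y, i))"
    using prod_encode_mono[OF le_prod_encode_1 le_prod_encode_1, of x y i i]
      mem_set_decode_less[OF that[unfolded le_in_def]] by linarith
  then show ?thesis unfolding proj_def le_in_def[of "set_encode _"] by auto
qed

lemma proj_less: "c < 2 ^ m \<Longrightarrow> proj i c < 2 ^ m"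
proof -
  assume c: "c < 2 ^ m"
  have "n < m" if "le_in c (prod_encode (pfst n, i)) (prod_encode (psnd n, i))" for n
    using prod_encode_mono[OF le_prod_encode_1 le_prod_encode_1, of "pfst n" "psnd n" i i]
      set_decode_less_power[OF that[unfolded le_in_def] c] by simp
  then show ?thesis unfolding proj_def by (intro set_encode_less_power) auto
qed

lemma le_in_eqI: "(\<And>x y. le_in c x y \<longleftrightarrow> le_in d x y) \<Longrightarrow> c = d"
proof -
  assume *: "\<And>x y. le_in c x y \<longleftrightarrow> le_in d x y"
  have "n \<in> set_decode c \<longleftrightarrow> n \<in> set_decode d" for n
    using *[of "pfst n" "psnd n"] unfolding le_in_def by simp
  then have "set_decode c = set_decode d" by blast
  then show "c = d" by (metis set_decode_inverse)
qed

lemma order_code_refl: "order_code c \<Longrightarrow> le_in c x y \<Longrightarrow> le_in c x x"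
  unfolding order_code_def by blast

lemma order_code_refl': "order_code c \<Longrightarrow> le_in c x y \<Longrightarrow> le_in c y y"
  unfolding order_code_def by blast

lemma order_code_antisym: "order_code c \<Longrightarrow> le_in c x y \<Longrightarrow> le_in c y x \<Longrightarrow> x = y"
  unfolding order_code_def by blast

lemma order_code_trans: "order_code c \<Longrightarrow> le_in c x y \<Longrightarrow> le_in c y z \<Longrightarrow> le_in c x z"
  unfolding order_code_def by blast

text \<open>A coded order is finite, hence its strict part is well-founded: passing to a strictly
  smaller element lowers the number of elements below.\<close>

lemma order_code_induct [consumes 2, case_names less]:
  assumes c: "order_code c" and "le_in c x x"
    and step: "\<And>x. le_in c x x \<Longrightarrow> (\<And>y. le_in c y x \<Longrightarrow> y \<noteq> x \<Longrightarrow> P y) \<Longrightarrow> P x"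
  shows "P x"
  using assms(2)
proof (induction "card {y. le_in c y x}" arbitrary: x rule: less_induct)
  case less
  have fin: "finite {y. le_in c y x}"
    by (rule finite_subset[of _ "pfst ` set_decode c"]) (force simp: le_in_def image_iff)+
  have "card {z. le_in c z y} < card {z. le_in c z x}" if "le_in c y x" "y \<noteq> x" for y
  proof (intro psubset_card_mono[OF fin] psubsetI)
    show "{z. le_in c z y} \<subseteq> {z. le_in c z x}"
      using order_code_trans[OF c _ that(1)] by blast
    have "\<not> le_in c x y" using order_code_antisym[OF c that(1)] that(2) by blast
    then show "{z. le_in c z y} \<noteq> {z. le_in c z x}" using less.prems by blast
  qed
  then show ?case
    using less.hyps order_code_refl[OF c] by (intro step[OF less.prems]) simp
qed

lemma order_code_proj: "order_code c \<Longrightarrow> order_code (proj i c)"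
  unfolding order_code_def[of "proj i c"] le_in_proj
  by (auto intro: order_code_trans order_code_refl order_code_refl' dest: order_code_antisym)

lemma code_tree_inj: "code_tree \<xi> = code_tree \<xi>' \<Longrightarrow> \<xi> = \<xi>'"
proof (induction \<xi> arbitrary: \<xi>')
  case (Node f ts)
  obtain g us where \<xi>': "\<xi>' = Node g us" by (cases \<xi>')
  have "map_sum id prod_encode f = map_sum id prod_encode g" and codes: "map code_tree ts = map code_tree us"
    using Node.prems by (auto simp: \<xi>' sum_encode_eq list_encode_eq)
  then have "f = g" by (cases f; cases g) auto
  moreover have "ts = us"
    using codes Node.IH by (metis list.inj_map_strong)
  ultimately show ?case using \<xi>' by simp
qed

lemma single_valued_pick: "single_valued (pick R P)"
  unfolding pick_def by (rule single_valuedI) (blast intro: code_tree_inj antisym)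

lemma pick_subset: "pick R P \<subseteq> R"
  unfolding pick_def by blast

lemma pick_ex:
  assumes "(l, \<xi>) \<in> R" and "P l \<xi>"
  shows "\<exists>\<xi>'. (l, \<xi>') \<in> pick R P \<and> P l \<xi>'"
proof -
  obtain \<xi>' where "(l, \<xi>') \<in> R \<and> P l \<xi>'" "\<And>\<xi>''. (l, \<xi>'') \<in> R \<and> P l \<xi>'' \<Longrightarrow> code_tree \<xi>' \<le> code_tree \<xi>''"
    using ex_has_least_nat[of "\<lambda>\<xi>. (l, \<xi>) \<in> R \<and> P l \<xi>" \<xi> code_tree] assms by blast
  then show ?thesis unfolding pick_def by blast
qed

lemma single_valued_labelled_alphabet: "single_valued \<Sigma> \<Longrightarrow> single_valued (labelled_alphabet \<Sigma> N)"
  unfolding labelled_alphabet_def single_valued_def by auto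

lemma finite_labelled_alphabet: "finite \<Sigma> \<Longrightarrow> finite (labelled_alphabet \<Sigma> N)"
proof -
  assume "finite \<Sigma>"
  moreover have "labelled_alphabet \<Sigma> N = (\<lambda>((\<sigma>, k), W). (prod_encode (\<sigma>, W), k)) ` (\<Sigma> \<times> {..<N})"
    unfolding labelled_alphabet_def by force
  ultimately show ?thesis by simp
qed

lemma ranked_labelled_alphabet: "ranked_alphabet \<Sigma> \<Longrightarrow> ranked_alphabet (labelled_alphabet \<Sigma> N)"
  unfolding ranked_alphabet_def by (simp add: single_valued_labelled_alphabet finite_labelled_alphabet)

lemma labelled_alphabet_mem [simp]:
  "(prod_encode (\<sigma>, W), k) \<in> labelled_alphabet \<Sigma> N \<longleftrightarrow> (\<sigma>, k) \<in> \<Sigma> \<and> W < N"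
  unfolding labelled_alphabet_def by auto

lemma labelled_alphabetD:
  "(l, k) \<in> labelled_alphabet \<Sigma> N \<Longrightarrow> (pfst l, k) \<in> \<Sigma> \<and> psnd l < N"
  unfolding labelled_alphabet_def by auto

lemma moves_mem:
  "c \<in> set_decode (moves A M \<sigma> ps) \<longleftrightarrow>
    valid A M \<sigma> c \<and> (\<forall>i<length ps. proj (Suc i) c \<in> set_decode (ps ! i))"
proof -
  have "finite {c. valid A M \<sigma> c \<and> (\<forall>i<length ps. proj (Suc i) c \<in> set_decode (ps ! i))}"
    by (rule finite_subset[of _ "{..<M}"]) (auto simp: valid_def)
  then show ?thesis unfolding moves_def by simp
qed

lemma moves_less: "moves A M \<sigma> ps < 2 ^ M"
  unfolding moves_def by (rule set_encode_less_power) (auto simp: valid_def)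

lemma up_mem: "q \<in> set_decode (up W) \<longleftrightarrow> (\<exists>c\<in>set_decode W. q = proj 0 c)"
  unfolding up_def by auto

lemma up_less: "W < 2 ^ 2 ^ m \<Longrightarrow> up W < 2 ^ 2 ^ m"
  unfolding up_def
  by (rule set_encode_less_power) (auto intro: proj_less dest: set_decode_less_power)

lemma least_move_ex:
  assumes "c \<in> set_decode W" and "proj 0 c \<in> set_decode u"
  shows "\<exists>c. least_move W u c"
  using ex_has_least_nat[of "\<lambda>c. c \<in> set_decode W \<and> proj 0 c \<in> set_decode u" c id] assms
  unfolding least_move_def by auto

lemma least_move_unique: "least_move W u c \<Longrightarrow> least_move W u d \<Longrightarrow> c = d"
  unfolding least_move_def by (meson antisym)


text \<open>\<open>m\<close> exceeds the code of every pair of occurrences at a node and its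
  children, so the orders to be guessed have codes below \<open>2 ^ m\<close>; from \<open>K\<close>
  upwards there is room for new attributes.\<close>

locale uniformization =
  fixes A :: "(nat, nat, nat) att" and m K :: nat
  assumes att: "is_att A"
    and order_bound: "\<And>\<sigma> k \<gamma> \<delta> i j. (\<sigma>, k) \<in> ialph A \<Longrightarrow> \<gamma> \<in> syn A \<union> inh A \<Longrightarrow> \<delta> \<in> syn A \<union> inh A \<Longrightarrow>
      i \<le> k \<Longrightarrow> j \<le> k \<Longrightarrow> prod_encode (prod_encode (\<gamma>, i), prod_encode (\<delta>, j)) < m"
    and attr_bound: "\<And>\<gamma>. \<gamma> \<in> syn A \<union> inh A \<Longrightarrow> \<gamma> < K"
begin

abbreviation "M \<equiv> 2 ^ m :: nat"
abbreviation "N \<equiv> 2 ^ M :: nat"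
abbreviation "B \<equiv> bu_relabeling A m"
abbreviation "T \<equiv> td_relabeling A m"
abbreviation "C \<equiv> choice_att A m K"

definition roots :: nat where
  "roots = set_encode {q \<in> {..<M}. root_order A q}"

lemma mem_roots: "q \<in> set_decode roots \<longleftrightarrow> q < M \<and> root_order A q"
  unfolding roots_def by auto

lemma roots_less: "roots < N"
  unfolding roots_def by (rule set_encode_less_power) auto

lemma disjoint: "\<gamma> \<in> syn A \<Longrightarrow> \<gamma> \<in> inh A \<Longrightarrow> False"
  using att unfolding is_att_def by auto

lemma ranked_ialph: "ranked_alphabet (ialph A)"
  using att unfolding is_att_def by auto

lemma rank_unique: "(\<sigma>, k) \<in> ialph A \<Longrightarrow> (\<sigma>, k') \<in> ialph A \<Longrightarrow> k = k'"
  using ranked_ialph unfolding ranked_alphabet_def single_valued_def by blast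

lemmas rule_Some = is_att_rule_Some[OF att]
lemmas rule_None = is_att_rule_None[OF att]

subsection \<open>Well-formedness\<close>

lemma is_burel_B: "is_burel B"
  unfolding is_burel_def bu_relabeling_def
  by (auto simp: ranked_ialph ranked_labelled_alphabet moves_less up_less single_valued_def)

lemma td_rhs:
  "map (\<lambda>j. attr_leaf (f j) j) [1..<Suc k] =
   map2 (\<lambda>q j. Node (Inr (q, j)) []) (map f [1..<Suc k]) [1..<Suc k]"
  by (rule nth_equalityI) (auto simp del: upt_Suc)

lemma power_proj_less: "c < M \<Longrightarrow> 2 ^ proj j c < N"
  by (simp add: proj_less)

lemma td_rulesE:
  assumes "((u, i), \<xi>) \<in> rules T (Some l)"
  obtains c k where "i = 0" "u < N" "(pfst l, k) \<in> ialph A" "c < M" "least_move (psnd l) u c"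
    "\<xi> = Node (Inl (prod_encode (pfst l, c))) (map (\<lambda>j. attr_leaf (2 ^ proj j c) j) [1..<Suc k])"
  using assms unfolding td_relabeling_def by (auto simp del: upt_Suc)

lemma deterministic_T: "deterministic T"
proof -
  have "single_valued (rules T (Some l))" for l
  proof (rule single_valuedI)
    fix x \<xi> \<xi>' assume *: "(x, \<xi>) \<in> rules T (Some l)" "(x, \<xi>') \<in> rules T (Some l)"
    obtain u i where x: "x = (u, i)" by fastforce
    show "\<xi> = \<xi>'"
      using *[unfolded x] by (elim td_rulesE) (metis rank_unique least_move_unique)
  qed
  moreover have "rules T None = {}" by (simp add: td_relabeling_def)
  ultimately show ?thesis unfolding deterministic_def by auto
qed

lemma is_att_T: "is_att T"
proof -
  have rank: "k' = k" if "(l, k) \<in> labelled_alphabet (ialph A) N" "(pfst l, k') \<in> ialph A" for l k k'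
    using labelled_alphabetD[OF that(1)] that(2) rank_unique by blast
  have fin: "finite (rules T (Some l))" if "(l, k) \<in> labelled_alphabet (ialph A) N" for l k
  proof (rule finite_subset)
    show "rules T (Some l) \<subseteq> (\<lambda>(u, c). ((u, 0), Node (Inl (prod_encode (pfst l, c)))
        (map (\<lambda>j. attr_leaf (2 ^ proj j c) j) [1..<Suc k]))) ` ({..<N} \<times> {..<M})"
    proof (rule subsetI)
      fix r assume "r \<in> rules T (Some l)"
      moreover obtain u i \<xi> where r: "r = ((u, i), \<xi>)" by (metis prod.exhaust)
      ultimately have "((u, i), \<xi>) \<in> rules T (Some l)" by simp
      then obtain c k' where *: "i = 0" "u < N" "(pfst l, k') \<in> ialph A" "c < M"
        "\<xi> = Node (Inl (prod_encode (pfst l, c))) (map (\<lambda>j. attr_leaf (2 ^ proj j c) j) [1..<Suc k'])"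
        by (elim td_rulesE)
      then show "r \<in> (\<lambda>(u, c). ((u, 0), Node (Inl (prod_encode (pfst l, c)))
        (map (\<lambda>j. attr_leaf (2 ^ proj j c) j) [1..<Suc k]))) ` ({..<N} \<times> {..<M})"
        using rank[OF that *(3)] unfolding r by (intro image_eqI[of _ _ "(u, c)"]) auto
    qed
  qed simp
  have wf: "\<gamma> < N \<and> i = 0 \<and> \<xi> \<in> trees_with (labelled_alphabet (ialph A) M) ({..<N} \<times> {1..k})"
    if "(l, k) \<in> labelled_alphabet (ialph A) N" "((\<gamma>, i), \<xi>) \<in> rules T (Some l)" for l k \<gamma> i \<xi>
    using that(2)
  proof (rule td_rulesE)
    fix c k' assume *: "i = 0" "\<gamma> < N" "(pfst l, k') \<in> ialph A" "c < M"
      "\<xi> = Node (Inl (prod_encode (pfst l, c))) (map (\<lambda>j. attr_leaf (2 ^ proj j c) j) [1..<Suc k'])"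
    then show ?thesis using rank[OF that(1) *(3)] by (auto simp: proj_less simp del: upt_Suc)
  qed
  have [simp]: "syn T = {..<N}" "inh T = {}" "ialph T = labelled_alphabet (ialph A) N"
    "oalph T = labelled_alphabet (ialph A) M" "rules T None = {}" "init T = roots"
    unfolding td_relabeling_def roots_def by simp_all
  show ?thesis
    unfolding is_att_def using fin wf roots_less
    by (auto simp: ranked_labelled_alphabet ranked_ialph)
qed

lemma is_tdrel_T: "is_tdrel T"
proof -
  have "\<exists>\<sigma>' qs. (\<sigma>', k) \<in> oalph T \<and> length qs = k \<and>
      \<xi> = Node (Inl \<sigma>') (map2 (\<lambda>q' j. Node (Inr (q', j)) []) qs [1..<Suc k])"
    if l: "(l, k) \<in> ialph T" and r: "((q, i), \<xi>) \<in> rules T (Some l)" for l k q i \<xi>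
    using r
  proof (rule td_rulesE)
    fix c k' assume *: "i = 0" "q < N" "(pfst l, k') \<in> ialph A" "c < M"
      "\<xi> = Node (Inl (prod_encode (pfst l, c))) (map (\<lambda>j. attr_leaf (2 ^ proj j c) j) [1..<Suc k'])"
    have "(pfst l, k) \<in> ialph A" using l unfolding td_relabeling_def by (auto dest: labelled_alphabetD)
    then have "k' = k" using rank_unique *(3) by blast
    moreover have "(prod_encode (pfst l, c), k) \<in> oalph T"
      using * \<open>k' = k\<close> unfolding td_relabeling_def by simp
    ultimately show ?thesis
      unfolding *(5) td_rhs by (intro exI[of _ "prod_encode (pfst l, c)"] exI[of _ "map (\<lambda>j. 2 ^ proj j c) [1..<Suc k]"]) auto
  qed
  moreover have "inh T = {}" unfolding td_relabeling_def by simp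
  ultimately show ?thesis
    unfolding is_tdrel_def using is_att_T deterministic_T by (auto simp del: upt_Suc)
qed

text \<open>The attributes of \<open>A\<close> lie below \<open>K\<close>, the new ones do not;
  among these, the parity of the offset from \<open>K\<close> separates \<open>ask\<close> from
  \<open>answer\<close>.\<close>

lemma new_attrs_distinct:
  assumes "\<gamma> \<in> syn A \<union> inh A"
  shows "\<gamma> \<noteq> ask K b" "\<gamma> \<noteq> answer K b n"
  using attr_bound[OF assms] by (auto simp: ask_def answer_def)

lemma new_attrs [simp]: "ask K b \<notin> syn A" "ask K b \<notin> inh A" "answer K b n \<notin> syn A" "answer K b n \<notin> inh A"
  using new_attrs_distinct by blast+

lemma ask_neq_answer [simp]: "ask K b \<noteq> answer K b' n"
  unfolding ask_def answer_def by presburger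

lemma ask_inj [simp]: "ask K b = ask K b' \<longleftrightarrow> b = b'"
  by (simp add: ask_def)

lemma answer_inj [simp]: "answer K b n = answer K b' n' \<longleftrightarrow> b = b' \<and> n = n'"
  by (simp add: answer_def)

lemma choice_simps [simp]:
  "syn C = syn A \<union> ask K ` inh A"
  "inh C = inh A \<union> {answer K b (code_tree \<xi>) | b i \<xi>. ((b, i), \<xi>) \<in> rules A None}"
  "ialph C = labelled_alphabet (ialph A) M" "oalph C = oalph A" "init C = init A"
  "rules C None = {((b, 1), attr_leaf (ask K b) 1) | b. b \<in> inh A} \<union>
     {((answer K b (code_tree \<xi>), 1), \<xi>) | b i \<xi>. ((b, i), \<xi>) \<in> rules A None}"
  "rules C (Some l) = pick (rules A (Some (pfst l))) (fits (psnd l)) \<union>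
     {((ask K b, 0), attr_leaf (answer K b (code_tree \<xi>)) 0) | b i \<xi>.
       ((b, i), \<xi>) \<in> pick (rules A None) (root_fits (proj 0 (psnd l)))}"
  unfolding choice_att_def by simp_all

lemma choice_rule_SomeE:
  assumes "((\<gamma>, i), \<xi>) \<in> rules C (Some l)"
  obtains (old) "((\<gamma>, i), \<xi>) \<in> pick (rules A (Some (pfst l))) (fits (psnd l))"
    | (ask) b j \<zeta> where "\<gamma> = ask K b" "i = 0" "\<xi> = attr_leaf (answer K b (code_tree \<zeta>)) 0"
      "((b, j), \<zeta>) \<in> pick (rules A None) (root_fits (proj 0 (psnd l)))"
  using assms unfolding choice_simps by blast

lemma choice_rule_NoneE:
  assumes "((\<gamma>, i), \<xi>) \<in> rules C None"
  obtains (ask) "\<gamma> \<in> inh A" "i = 1" "\<xi> = attr_leaf (ask K \<gamma>) 1"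
    | (answer) b j where "\<gamma> = answer K b (code_tree \<xi>)" "i = 1" "((b, j), \<xi>) \<in> rules A None"
  using assms unfolding choice_simps by blast

lemma finite_rules: "finite (rules A None)" "(\<sigma>, k) \<in> ialph A \<Longrightarrow> finite (rules A (Some \<sigma>))"
  using att unfolding is_att_def by auto

lemma finite_answers: "finite {f b \<xi> | b i \<xi>. ((b, i), \<xi>) \<in> rules A None}"
proof -
  have "{f b \<xi> | b i \<xi>. ((b, i), \<xi>) \<in> rules A None} = (\<lambda>((b, i), \<xi>). f b \<xi>) ` rules A None" by force
  then show ?thesis using finite_rules(1) by simp
qed

lemma is_att_C: "is_att C"
proof -
  have finite: "finite (syn C)" "finite (inh C)"
    using att finite_answers unfolding is_att_def by auto
  have disj: "syn C \<inter> inh C = {}"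
    using disjoint ask_neq_answer by (auto dest: sym)
  have finN: "finite (rules C None)"
  proof -
    have "finite {((b, 1), attr_leaf (ask K b) 1) | b. b \<in> inh A}"
      using att unfolding is_att_def by simp
    then show ?thesis unfolding choice_simps by (intro finite_UnI finite_answers)
  qed
  have finS: "finite (rules C (Some l))" if "(l, k) \<in> ialph C" for l k
  proof -
    have "(pfst l, k) \<in> ialph A" using that labelled_alphabetD by simp
    then have "finite (pick (rules A (Some (pfst l))) (fits (psnd l)))"
      by (rule finite_subset[OF pick_subset finite_rules(2)])
    moreover have "finite {((ask K b, 0), attr_leaf (answer K b (code_tree \<xi>)) 0) | b i \<xi>.
       ((b, i), \<xi>) \<in> pick (rules A None) (root_fits (proj 0 (psnd l)))}"
    proof (rule finite_subset)
      show "finite {((ask K b, 0), attr_leaf (answer K b (code_tree \<xi>)) 0) | b i \<xi>. ((b, i), \<xi>) \<in> rules A None}"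
        by (rule finite_answers)
    qed (use pick_subset in blast)
    ultimately show ?thesis unfolding choice_simps by (rule finite_UnI)
  qed
  have wfN: "\<gamma> \<in> inh C \<and> i = 1 \<and> \<xi> \<in> trees_with (oalph C) (syn C \<times> {1})"
    if r: "((\<gamma>, i), \<xi>) \<in> rules C None" for \<gamma> i \<xi>
  proof -
    have "\<xi> \<in> trees_with (oalph C) (syn C \<times> {1})" if "((b, j), \<xi>) \<in> rules A None" for b j
      unfolding choice_simps by (rule trees_with_mono[OF rule_None(3)[OF that]]) auto
    then show ?thesis using r rule_None(1) by auto
  qed
  have wfS: "(\<gamma> \<in> syn C \<and> i = 0 \<or> \<gamma> \<in> inh C \<and> i \<in> {1..k}) \<and>
      \<xi> \<in> trees_with (oalph C) (syn C \<times> {1..k} \<union> inh C \<times> {0})"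
    if l: "(l, k) \<in> ialph C" and r: "((\<gamma>, i), \<xi>) \<in> rules C (Some l)" for l k \<gamma> i \<xi>
  proof -
    have \<sigma>: "(pfst l, k) \<in> ialph A" using l labelled_alphabetD by simp
    from r show ?thesis
    proof (cases rule: choice_rule_SomeE)
      case old
      then have rl: "((\<gamma>, i), \<xi>) \<in> rules A (Some (pfst l))" using pick_subset by blast
      have "\<xi> \<in> trees_with (oalph A) (syn C \<times> {1..k} \<union> inh C \<times> {0})"
        by (rule trees_with_mono[OF rule_Some(2)[OF \<sigma> rl]]) auto
      then show ?thesis using rule_Some(1)[OF \<sigma> rl] by auto
    next
      case (ask b j \<zeta>)
      then have "((b, j), \<zeta>) \<in> rules A None" using pick_subset by blast
      then show ?thesis using ask rule_None(1) by auto
    qed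
  qed
  have "ranked_alphabet (ialph C)" "ranked_alphabet (oalph C)" "init C \<in> syn C"
    using att ranked_ialph ranked_labelled_alphabet unfolding is_att_def by auto
  then show ?thesis
    unfolding is_att_def using finite disj finN finS wfN wfS by blast
qed

lemma deterministic_C: "deterministic C"
proof -
  have "single_valued (rules C None)"
    unfolding choice_simps single_valued_def
    using rule_None(1) code_tree_inj by auto
  moreover have "single_valued (rules C (Some l))" if "(l, k) \<in> ialph C" for l k
  proof (rule single_valuedI)
    have \<sigma>: "(pfst l, k) \<in> ialph A" using that labelled_alphabetD by simp
    let ?P = "pick (rules A (Some (pfst l))) (fits (psnd l))"
    let ?Q = "pick (rules A None) (root_fits (proj 0 (psnd l)))"
    have old_neq: "\<gamma> \<noteq> ask K b" if "((\<gamma>, i), \<xi>) \<in> ?P" for \<gamma> i \<xi> b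
      using rule_Some(1)[OF \<sigma>, of \<gamma> i \<xi>] that pick_subset new_attrs_distinct by blast
    have Q: "i = 1" if "((b, i), \<xi>) \<in> ?Q" for b i \<xi>
      using rule_None(2) that pick_subset by blast
    fix x \<xi> \<xi>' assume *: "(x, \<xi>) \<in> rules C (Some l)" "(x, \<xi>') \<in> rules C (Some l)"
    obtain \<gamma> i where x: "x = (\<gamma>, i)" by fastforce
    from *(1)[unfolded x] show "\<xi> = \<xi>'"
    proof (cases rule: choice_rule_SomeE)
      case old
      from *(2)[unfolded x] show ?thesis
        by (cases rule: choice_rule_SomeE)
          (use old old_neq in \<open>auto dest: single_valuedD[OF single_valued_pick]\<close>)
    next
      case (ask b j \<zeta>)
      from *(2)[unfolded x] show ?thesis
      proof (cases rule: choice_rule_SomeE)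
        case (ask b' j' \<zeta>')
        with \<open>\<gamma> = ask K b\<close> have "b' = b" by simp
        then have "\<zeta>' = \<zeta>"
          using ask(4) \<open>((b, j), \<zeta>) \<in> ?Q\<close> Q single_valued_pick unfolding single_valued_def by metis
        then show ?thesis using ask(3) \<open>b' = b\<close> \<open>\<xi> = _\<close> by simp
      qed (use ask old_neq in auto)
    qed
  qed
  ultimately show ?thesis unfolding deterministic_def by auto
qed

lemma is_dattU: "is_dattU (uniformizing_attU A m K)"
  unfolding is_dattU_def uniformizing_attU_def
  using is_burel_B is_tdrel_T is_att_C deterministic_C
  by (simp add: bu_relabeling_def td_relabeling_def)

end


subsection \<open>Runs of the look-around\<close>

fun bu_state :: "(nat, nat, nat) att \<Rightarrow> nat \<Rightarrow> nat tree \<Rightarrow> nat" where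
  "bu_state A m (Node \<sigma> ts) = up (moves A (2 ^ m) \<sigma> (map (bu_state A m) ts))"

fun bu_tree :: "(nat, nat, nat) att \<Rightarrow> nat \<Rightarrow> nat tree \<Rightarrow> nat tree" where
  "bu_tree A m (Node \<sigma> ts) =
     Node (prod_encode (\<sigma>, moves A (2 ^ m) \<sigma> (map (bu_state A m) ts))) (map (bu_tree A m) ts)"

text \<open>Any permitted transition may be taken, not only the least. Leastness makes
  \<open>td_relabeling\<close> deterministic, whereas the chosen rules terminate already under the
  conditions stated here.\<close>

inductive run :: "(nat, nat, nat) att \<Rightarrow> nat \<Rightarrow> nat \<Rightarrow> nat tree \<Rightarrow> nat tree \<Rightarrow> bool" for A m where
  "c \<in> set_decode (moves A (2 ^ m) \<sigma> (map (bu_state A m) ts)) \<Longrightarrow> proj 0 c \<in> set_decode u \<Longrightarrow>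
   length us = length ts \<Longrightarrow>
   (\<And>i. i < length ts \<Longrightarrow> run A m (2 ^ proj (Suc i) c) (ts ! i) (us ! i)) \<Longrightarrow>
   run A m u (Node \<sigma> ts) (Node (prod_encode (\<sigma>, c)) us)"

lemma run_erase: "run A m u s s' \<Longrightarrow> map_tree pfst s' = s"
  by (induction rule: run.induct) (auto intro: nth_equalityI)

text \<open>Below the root a top-down state \<open>2 ^ proj j c\<close> thus permits exactly one
  order, the trace of the transition taken at the parent.\<close>

lemma set_decode_power [simp]: "set_decode (2 ^ n) = {n}"
proof -
  have "set_decode (2 ^ n + 0) = insert n (set_decode 0)"
    by (rule set_decode_plus_power_2) simp
  then show ?thesis by simp
qed

context uniformization
begin

lemma bu_state_less: "s \<in> trees (ialph A) \<Longrightarrow> bu_state A m s < N"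
  by (cases s) (simp add: up_less moves_less)

lemma bu_tree_in_trees: "s \<in> trees (ialph A) \<Longrightarrow> bu_tree A m s \<in> trees (labelled_alphabet (ialph A) N)"
  by (induction s) (auto simp: trees_Node_iff moves_less)

text \<open>There is exactly one rule for each input symbol and tuple of states of matching length,
  so the rewriting carries out the recursions \<open>bu_state\<close> and
  \<open>bu_tree\<close>.\<close>

lemma brun_B:
  assumes "s \<in> trees (ialph A)"
  shows "brun B (map_tree In s) p u \<longleftrightarrow> p = bu_state A m s \<and> u = bu_tree A m s"
  using assms
proof (induction s arbitrary: p u rule: tree.induct)
  case (Node \<sigma> ts)
  have \<sigma>: "(\<sigma>, length ts) \<in> ialph A" and ts: "\<And>t. t \<in> set ts \<Longrightarrow> t \<in> trees (ialph A)"
    using Node.prems by (auto simp: trees_Node_iff)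
  have IH: "brun B (map_tree In (ts ! i)) p u \<longleftrightarrow> p = bu_state A m (ts ! i) \<and> u = bu_tree A m (ts ! i)"
    if "i < length ts" for i p u
    using Node.IH ts that by simp
  have rule: "((\<sigma>, ps), (p, \<sigma>')) \<in> brules B \<longleftrightarrow> p = up (moves A M \<sigma> ps) \<and> \<sigma>' = prod_encode (\<sigma>, moves A M \<sigma> ps) \<and>
      (\<sigma>, length ps) \<in> ialph A \<and> set ps \<subseteq> {..<N}" for ps p \<sigma>'
    unfolding bu_relabeling_def by auto
  have sub: "set (map (bu_state A m) ts) \<subseteq> {..<N}" using ts bu_state_less by auto
  show ?case
  proof
    assume "brun B (map_tree In (Node \<sigma> ts)) p u"
    then obtain ps \<sigma>' us where *: "u = Node \<sigma>' us" "((\<sigma>, ps), (p, \<sigma>')) \<in> brules B" "length ts = length ps"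
      "length us = length ps" "\<And>i. i < length ps \<Longrightarrow> brun B (map_tree In (ts ! i)) (ps ! i) (us ! i)"
      by (auto simp: brun_In_iff)
    have "ps = map (bu_state A m) ts" "us = map (bu_tree A m) ts"
      using * IH by (auto intro!: nth_equalityI)
    then show "p = bu_state A m (Node \<sigma> ts) \<and> u = bu_tree A m (Node \<sigma> ts)" using *(1,2) rule by simp
  next
    assume "p = bu_state A m (Node \<sigma> ts) \<and> u = bu_tree A m (Node \<sigma> ts)"
    moreover have "brun B (Node (In \<sigma>) (map (map_tree In) ts)) (bu_state A m (Node \<sigma> ts)) (bu_tree A m (Node \<sigma> ts))"
      unfolding bu_tree.simps
      by (rule brun_In[where ps = "map (bu_state A m) ts"]) (use \<sigma> sub IH rule in auto)
    ultimately show "brun B (map_tree In (Node \<sigma> ts)) p u" by simp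
  qed
qed

lemma burel_trans_B:
  "(s, u) \<in> burel_trans B \<longleftrightarrow> s \<in> trees (ialph A) \<and> u = bu_tree A m s \<and>
     set_decode (bu_state A m s) \<inter> set_decode roots \<noteq> {}"
proof -
  have "bialph B = ialph A" "boalph B = labelled_alphabet (ialph A) N"
    "p \<in> bfinal B \<longleftrightarrow> p < N \<and> set_decode p \<inter> set_decode roots \<noteq> {}" for p
    unfolding bu_relabeling_def by (auto simp: mem_roots)
  then show ?thesis
    using brun_B bu_state_less bu_tree_in_trees unfolding burel_trans_iff by auto
qed

lemma subtree_bu_tree:
  "is_node s w \<Longrightarrow> is_node (bu_tree A m s) w \<and> subtree (bu_tree A m s) w = bu_tree A m (subtree s w)"
  by (induction s w rule: subtree.induct) auto

text \<open>An order common to \<open>u\<close> and the bottom-up state guarantees a least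
  transition. This transition lies in \<open>moves\<close>, so its traces are common orders at the
  children and the invariant is passed on.\<close>

lemma T_run_ex:
  assumes s0: "s0 \<in> trees (ialph A)" and "is_node s0 w" and "u < N"
    and "set_decode u \<inter> set_decode (bu_state A m (subtree s0 w)) \<noteq> {}"
  shows "\<exists>s'. ev T (mark_root (bu_tree A m s0)) (attr_leaf u (1 # w)) s' \<and> run A m u (subtree s0 w) s'"
  using assms(2-)
proof (induction "subtree s0 w" arbitrary: w u rule: tree.induct)
  case (Node \<sigma> ts)
  note st = Node.hyps(2)[symmetric]
  let ?W = "moves A M \<sigma> (map (bu_state A m) ts)"
  let ?s = "mark_root (bu_tree A m s0)"
  have \<sigma>: "(\<sigma>, length ts) \<in> ialph A"
    using subtree_in_trees[OF s0 Node.prems(1)] by (simp add: st trees_Node_iff)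
  obtain c0 where "c0 \<in> set_decode ?W" "proj 0 c0 \<in> set_decode u"
    using Node.prems(3) by (auto simp: st up_mem)
  then obtain c where c: "least_move ?W u c" using least_move_ex by blast
  then have cW: "c \<in> set_decode ?W" and cu: "proj 0 c \<in> set_decode u" unfolding least_move_def by auto
  then have "c < M" by (auto simp: moves_mem valid_def)
  have "\<exists>s'. ev T ?s (attr_leaf (2 ^ proj (Suc i) c) (1 # w @ [Suc i])) s' \<and>
      run A m (2 ^ proj (Suc i) c) (ts ! i) s'" if "i < length ts" for i
  proof -
    have child: "subtree s0 (w @ [Suc i]) = ts ! i" by (simp add: subtree_snoc st)
    show ?thesis
      using Node.hyps(1)[of "w @ [Suc i]" "2 ^ proj (Suc i) c"] that child Node.prems(1) cW
        power_proj_less[OF \<open>c < M\<close>] by (auto simp: is_node_snoc st moves_mem)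
  qed
  then obtain h where h: "\<And>i. i < length ts \<Longrightarrow>
      ev T ?s (attr_leaf (2 ^ proj (Suc i) c) (1 # w @ [Suc i])) (h i) \<and> run A m (2 ^ proj (Suc i) c) (ts ! i) (h i)"
    by metis
  let ?us = "map h [0..<length ts]"
  let ?xi = "Node (Inl (prod_encode (\<sigma>, c))) (map (\<lambda>j. attr_leaf (2 ^ proj j c) j) [1..<Suc (length ts)])"
  have "run A m u (Node \<sigma> ts) (Node (prod_encode (\<sigma>, c)) ?us)"
    using cW cu h by (intro run.intros) auto
  moreover have "ev T ?s (attr_leaf u (child (1 # w) 0)) (Node (prod_encode (\<sigma>, c)) ?us)"
  proof (rule ev_attr)
    show "1 # w \<in> nodes ?s" using subtree_bu_tree[OF Node.prems(1)] nodes_mark_root by auto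
    have "label ?s (1 # w) = Some (prod_encode (\<sigma>, ?W))"
      using subtree_bu_tree[OF Node.prems(1)] by (simp add: label_eq_root[of _ w] st)
    then show "((u, 0), ?xi) \<in> rules T (label ?s (1 # w))"
      using \<sigma> c Node.prems(2) \<open>c < M\<close> by (auto simp: td_relabeling_def simp del: upt_Suc)
    show "u \<in> syn T \<and> 0 = 0 \<or> u \<in> inh T \<and> 0 < 0"
      using Node.prems(2) by (simp add: td_relabeling_def)
    show "ev T ?s (inst (1 # w) ?xi) (Node (prod_encode (\<sigma>, c)) ?us)"
      using h by (auto simp: inst_def ev_node_iff list_all2_conv_all_nth child_def simp del: upt_Suc)
  qed
  ultimately show ?case unfolding st child_def by auto
qed

text \<open>The first rule applied at the root shows that initial state and bottom-up state share an
  order. The run constructed from there must be the given output because \<open>T\<close> is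
  deterministic.\<close>

lemma T_run:
  assumes "s \<in> trees (ialph A)" and "(bu_tree A m s, s') \<in> att_trans T"
  shows "run A m roots s s'"
proof -
  have ev: "ev T (mark_root (bu_tree A m s)) (attr_leaf roots (child [1] 0)) s'" and
    trees: "bu_tree A m s \<in> trees (ialph T)"
    using assms(2) unfolding att_trans_iff by (simp_all add: td_relabeling_def roots_def child_def)
  obtain v i \<xi> where v: "child [1] 0 = child v i" "roots \<in> syn T \<and> i = 0 \<or> roots \<in> inh T \<and> i > 0"
    and r: "((roots, i), \<xi>) \<in> rules T (label (mark_root (bu_tree A m s)) v)"
    using ev by (cases rule: ev.cases) auto
  have "v = [1]" using v by (auto simp: td_relabeling_def child_def)
  obtain \<sigma> ts where s: "s = Node \<sigma> ts" by (cases s)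
  let ?W = "moves A M \<sigma> (map (bu_state A m) ts)"
  have "((roots, i), \<xi>) \<in> rules T (Some (prod_encode (\<sigma>, ?W)))"
    using r \<open>v = [1]\<close> by (simp add: s)
  then obtain c where "least_move ?W roots c" by (elim td_rulesE) simp
  then have "set_decode roots \<inter> set_decode (bu_state A m s) \<noteq> {}"
    by (auto simp: least_move_def s disjoint_iff up_mem)
  then obtain s'' where s'': "ev T (mark_root (bu_tree A m s)) (attr_leaf roots [1]) s''" "run A m roots s s''"
    using T_run_ex[OF assms(1), of "[]" roots] roots_less by auto
  then have "s'' = s'" using ev_unique[OF is_att_T deterministic_T trees] ev by (simp add: child_def)
  then show ?thesis using s'' by simp
qed

lemma T_run_total:
  assumes "s \<in> trees (ialph A)" and "set_decode (bu_state A m s) \<inter> set_decode roots \<noteq> {}"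
  shows "\<exists>s'. (bu_tree A m s, s') \<in> att_trans T"
proof -
  obtain s' where s': "ev T (mark_root (bu_tree A m s)) (attr_leaf roots [1]) s'"
    using T_run_ex[OF assms(1), of "[]" roots] assms(2) roots_less by auto
  have "bu_tree A m s \<in> trees (ialph T)" "init T = roots" "roots \<in> syn T"
    using bu_tree_in_trees[OF assms(1)] roots_less by (simp_all add: td_relabeling_def roots_def)
  then show ?thesis
    using s' ev_in_trees[OF is_att_T _ s'] unfolding att_trans_iff by (auto intro!: exI[of _ s'])
qed

subsection \<open>Soundness\<close>

lemma attrs_rhs_less:
  assumes "(\<sigma>, k) \<in> ialph A" "(l, \<xi>) \<in> rules A (Some \<sigma>)" "z \<in> attrs \<xi>"
  shows "fst z \<in> syn A \<union> inh A \<and> fst z < K"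
proof -
  obtain \<gamma> i where l: "l = (\<gamma>, i)" by fastforce
  then have "fst z \<in> syn A \<union> inh A"
    using attrs_subset[OF rule_Some(2)[OF assms(1)], of \<gamma> i \<xi>] assms(2,3) by auto
  then show ?thesis using attr_bound by blast
qed

lemma attrs_root_rhs:
  assumes "(l, \<xi>) \<in> rules A None" "z \<in> attrs \<xi>"
  shows "fst z \<in> syn A \<and> snd z = 1 \<and> fst z < K"
proof -
  obtain \<gamma> i where l: "l = (\<gamma>, i)" by fastforce
  then have "fst z \<in> syn A \<and> snd z = 1"
    using attrs_subset[OF rule_None(3), of \<gamma> i \<xi>] assms by auto
  then show ?thesis using attr_bound by blast
qed

text \<open>At input symbols, the rules of \<open>C\<close> for old attributes are rules of
  \<open>A\<close>; at the root, the detour through \<open>ask\<close> and \<open>answer\<close>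
  amounts to one rule of \<open>#\<close>. The claims are proved together because the detour passes
  through all three kinds of attribute. Only \<open>#\<close> has rules for \<open>answer\<close>,
  so an \<open>ask\<close> with a value is asked at node 1.\<close>

lemma C_sound:
  assumes s': "s' \<in> trees (labelled_alphabet (ialph A) M)" and s: "s = map_tree pfst s'"
    and "ev C (mark_root s') X t"
  shows "((\<forall>z\<in>attrs X. fst z < K) \<longrightarrow> ev A (mark_root s) X t) \<and>
    (\<forall>b v. X = attr_leaf (ask K b) v \<longrightarrow> ev A (mark_root s) (attr_leaf b v) t) \<and>
    (\<forall>b i \<xi> v. X = attr_leaf (answer K b (code_tree \<xi>)) v \<longrightarrow> ((b, i), \<xi>) \<in> rules A None \<longrightarrow>
       v = [1] \<and> ev A (mark_root s) (inst [] \<xi>) t)"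
  using assms(3)
proof (induction rule: ev.induct)
  case (ev_node ts us g)
  have "ev A (mark_root s) (Node (Inl g) ts) (Node g us)" if less: "\<forall>z\<in>attrs (Node (Inl g) ts). fst z < K"
  proof (intro ev.ev_node list_all2_all_nthI)
    fix i assume i: "i < length ts"
    then have "\<forall>z\<in>attrs (ts ! i). fst z < K" using less nth_mem[OF i] unfolding attrs_Node by blast
    then show "ev A (mark_root s) (ts ! i) (us ! i)" using list_all2_nthD[OF ev_node.IH i] by blast
  qed (use ev_node.IH list_all2_lengthD in blast)
  then show ?case by simp
next
  case (ev_attr v \<gamma> i \<xi> t)
  have v: "v \<in> nodes (mark_root s)" using ev_attr.hyps(1) by (auto simp: s nodes_mark_root)
  show ?case
  proof (cases "v = []")
    case True
    then have "((\<gamma>, i), \<xi>) \<in> rules C None" using ev_attr.hyps(2) by simp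
    then show ?thesis
    proof (cases rule: choice_rule_NoneE)
      case ask
      have "ev A (mark_root s) (attr_leaf \<gamma> [1]) t"
        using ev_attr.IH ask True by (auto simp: inst_def child_def)
      then show ?thesis using ask True new_attrs by (auto simp: child_def)
    next
      case (answer b j)
      then have "\<gamma> \<ge> K" by (simp add: answer_def)
      moreover have "\<forall>z\<in>attrs (inst v \<xi>). fst z < K"
        using attrs_root_rhs[OF answer(3)] by (auto simp: attrs_inst)
      then have "ev A (mark_root s) (inst [] \<xi>) t" using ev_attr.IH True by simp
      ultimately show ?thesis
        using answer True ask_neq_answer by (auto simp: attrs_Node child_def dest!: code_tree_inj dest: sym)
    qed
  next
    case False
    then obtain w where w: "v = 1 # w" "is_node s' w" using ev_attr.hyps(1) nodes_mark_root by blast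
    let ?l = "label s' w"
    have \<sigma>: "(pfst ?l, length (children (subtree s' w))) \<in> ialph A"
      using label_in_alphabet[OF s' w(2)] labelled_alphabetD by blast
    have ls: "label (mark_root s) v = Some (pfst ?l)"
      using w by (simp add: s label_eq_root[of _ w] subtree_map_tree root_map_tree)
    have "((\<gamma>, i), \<xi>) \<in> rules C (Some ?l)" using ev_attr.hyps(2) w by simp
    then show ?thesis
    proof (cases rule: choice_rule_SomeE)
      case old
      then have r: "((\<gamma>, i), \<xi>) \<in> rules A (Some (pfst ?l))" using pick_subset by blast
      have \<gamma>: "\<gamma> \<in> syn A \<and> i = 0 \<or> \<gamma> \<in> inh A \<and> i > 0" using rule_Some(1)[OF \<sigma> r] by auto
      have "\<forall>z\<in>attrs (inst v \<xi>). fst z < K"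
        using attrs_rhs_less[OF \<sigma> r] by (auto simp: attrs_inst)
      then have "ev A (mark_root s) (inst v \<xi>) t" using ev_attr.IH by simp
      then have "ev A (mark_root s) (attr_leaf \<gamma> (child v i)) t"
        by (rule ev.ev_attr[rotated 3]) (use v r ls \<gamma> in auto)
      then show ?thesis using \<gamma> new_attrs by auto
    next
      case (ask b j \<zeta>)
      then have r: "((b, j), \<zeta>) \<in> rules A None" using pick_subset by blast
      have "\<gamma> \<ge> K" using ask by (simp add: ask_def)
      moreover have *: "v = [1]" "ev A (mark_root s) (inst [] \<zeta>) t"
        using ev_attr.IH r ask by (auto simp: inst_def child_def)
      have "ev A (mark_root s) (attr_leaf b (child [] 1)) t"
        by (rule ev.ev_attr[OF _ _ _ *(2)]) (use r rule_None(1,2)[OF r] nodes_mark_root in auto)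
      ultimately show ?thesis using ask *(1) ask_neq_answer by (auto simp: attrs_Node child_def)
    qed
  qed
qed

lemma attU_trans_sound: "attU_trans (uniformizing_attU A m K) \<subseteq> att_trans A"
proof (rule subrelI)
  fix s t assume "(s, t) \<in> attU_trans (uniformizing_attU A m K)"
  then obtain u s' where "(s, u) \<in> burel_trans B" and T: "(u, s') \<in> att_trans T" and C: "(s', t) \<in> att_trans C"
    unfolding uniformizing_attU_def by auto
  then have s: "s \<in> trees (ialph A)" and u: "u = bu_tree A m s" using burel_trans_B by auto
  have "map_tree pfst s' = s" using run_erase[OF T_run[OF s]] T u by blast
  moreover have "init A \<in> syn A" using att unfolding is_att_def by simp
  ultimately have "ev A (mark_root s) (attr_leaf (init A) [1]) t"
    using C_sound[of s' s "attr_leaf (init A) [1]" t] C attr_bound[of "init A"]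
    unfolding att_trans_iff by (auto simp: attrs_Node)
  then show "(s, t) \<in> att_trans A" using s C unfolding att_trans_iff by simp
qed

lemma attU_trans_single_valued: "single_valued (attU_trans (uniformizing_attU A m K))"
proof -
  have "single_valued (burel_trans B)" unfolding single_valued_def burel_trans_B by blast
  then show ?thesis
    unfolding uniformizing_attU_def
    by (simp add: single_valued_relcomp att_trans_single_valued is_att_T deterministic_T is_att_C deterministic_C)
qed

end


subsection \<open>Completeness\<close>

text \<open>These are the approximants of a least fixed point: stage \<open>n\<close> collects the
  occurrences with a derivation of height at most \<open>n\<close>, without mentioning the output
  tree.\<close>

fun derivable :: "('q, 'f, 'g) att \<Rightarrow> 'f option tree \<Rightarrow> nat \<Rightarrow> ('q \<times> nat list) set" where
  "derivable A s 0 = {}"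
| "derivable A s (Suc n) = {(\<gamma>, child v i) | \<gamma> v i. v \<in> nodes s \<and> owned A \<gamma> i \<and>
     (\<exists>\<xi>. ((\<gamma>, i), \<xi>) \<in> rules A (label s v) \<and> attrs (inst v \<xi>) \<subseteq> derivable A s n)}"

definition productive :: "('q, 'f, 'g) att \<Rightarrow> 'f option tree \<Rightarrow> ('q \<times> nat list) set" where
  "productive A s = (\<Union>n. derivable A s n)"

definition height :: "('q, 'f, 'g) att \<Rightarrow> 'f option tree \<Rightarrow> 'q \<times> nat list \<Rightarrow> nat" where
  "height A s x = (LEAST n. x \<in> derivable A s n)"

text \<open>Distinct occurrences of equal height are incomparable, which gives antisymmetry without
  breaking ties.\<close>

definition occ_le :: "('q, 'f, 'g) att \<Rightarrow> 'f option tree \<Rightarrow> 'q \<times> nat list \<Rightarrow> 'q \<times> nat list \<Rightarrow> bool" where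
  "occ_le A s x y \<longleftrightarrow> x \<in> productive A s \<and> y \<in> productive A s \<and> (x = y \<or> height A s x < height A s y)"

lemma derivable_Suc_mono: "derivable A s n \<subseteq> derivable A s (Suc n)"
proof (induction n)
  case (Suc n)
  show ?case
  proof
    fix x assume "x \<in> derivable A s (Suc n)"
    then obtain \<gamma> v i \<xi> where "x = (\<gamma>, child v i)" "v \<in> nodes s" "owned A \<gamma> i"
      "((\<gamma>, i), \<xi>) \<in> rules A (label s v)" "attrs (inst v \<xi>) \<subseteq> derivable A s n" by auto
    then show "x \<in> derivable A s (Suc (Suc n))"
      using Suc unfolding derivable.simps(2)[of A s "Suc n"] by blast
  qed
qed simp

lemma derivable_mono: "n \<le> n' \<Longrightarrow> derivable A s n \<subseteq> derivable A s n'"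
  by (rule lift_Suc_mono_le[of "derivable A s"]) (rule derivable_Suc_mono)

lemma ev_derivable: "ev A s X t \<Longrightarrow> \<exists>n. attrs X \<subseteq> derivable A s n"
proof (induction rule: ev.induct)
  case (ev_node ts us g)
  have "\<exists>n. attrs t \<subseteq> derivable A s n" if "t \<in> set ts" for t
    using ev_node.IH that by (auto simp: list_all2_conv_all_nth in_set_conv_nth)
  then obtain h where h: "\<And>t. t \<in> set ts \<Longrightarrow> attrs t \<subseteq> derivable A s (h t)" by metis
  have "attrs t \<subseteq> derivable A s (Max (h ` set ts))" if "t \<in> set ts" for t
    using h[OF that] derivable_mono[of "h t" "Max (h ` set ts)" A s] that by auto
  then show ?case by (auto simp: attrs_Node)
next
  case (ev_attr v \<gamma> i \<xi> t)
  then obtain n where "attrs (inst v \<xi>) \<subseteq> derivable A s n" by blast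
  then have "(\<gamma>, child v i) \<in> derivable A s (Suc n)"
    using ev_attr.hyps(1-3) unfolding derivable.simps owned_def by blast
  then have "attrs (attr_leaf \<gamma> (child v i)) \<subseteq> derivable A s (Suc n)" by (simp add: attrs_Node)
  then show ?case by blast
qed

text \<open>At the least stage containing \<open>x\<close> some rule has all its leaves in the
  preceding stage. That stage exists because stage 0 is empty.\<close>

lemma productive_rule:
  assumes "x \<in> productive A s"
  obtains \<gamma> v i \<xi> where "x = (\<gamma>, child v i)" "v \<in> nodes s" "owned A \<gamma> i" "((\<gamma>, i), \<xi>) \<in> rules A (label s v)"
    "\<And>z. z \<in> attrs (inst v \<xi>) \<Longrightarrow> z \<in> productive A s \<and> height A s z < height A s x"
proof -
  have *: "x \<in> derivable A s (height A s x)"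
    using assms unfolding productive_def height_def by (auto intro: LeastI)
  then obtain n where n: "height A s x = Suc n" by (cases "height A s x") auto
  then obtain \<gamma> v i \<xi> where x: "x = (\<gamma>, child v i)" "v \<in> nodes s" "owned A \<gamma> i"
      "((\<gamma>, i), \<xi>) \<in> rules A (label s v)" "attrs (inst v \<xi>) \<subseteq> derivable A s n" using * by auto
  have "z \<in> productive A s \<and> height A s z < height A s x" if "z \<in> attrs (inst v \<xi>)" for z
  proof -
    have "z \<in> derivable A s n" using that x(5) by blast
    then show ?thesis unfolding n unfolding productive_def height_def by (auto simp: less_Suc_eq_le intro: Least_le)
  qed
  then show ?thesis using that x(1-4) by blast
qed

section \<open>Traces of the height order at the nodes\<close>

definition cluster :: "(nat, 'f, 'g) att \<Rightarrow> 'f option tree \<Rightarrow> nat list \<Rightarrow> nat" where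
  "cluster A s v = set_encode {prod_encode (x, y) | x y.
     occ_le A s (pfst x, child v (psnd x)) (pfst y, child v (psnd y))}"

definition node_order :: "(nat, 'f, 'g) att \<Rightarrow> 'f option tree \<Rightarrow> nat list \<Rightarrow> nat" where
  "node_order A s v = set_encode {prod_encode (x, y) | x y. occ_le A s (x, v) (y, v)}"

lemma child_eq_iff: "child v i = child v j \<longleftrightarrow> i = j"
  by (auto simp: child_def)

context uniformization
begin

lemma owned_unique:
  assumes "owned A \<gamma> i" "owned A \<gamma> j" "child v i = child w j"
  shows "v = w \<and> i = j"
  using assms disjoint by (intro child_inj) (auto simp: owned_def)

text \<open>Productivity alone does not say that the target of an inherited attribute is a node of
  the tree; this follows from the index range in the rule format. It makes the traces of the order
  finite sets with bounded codes.\<close>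

lemma productive_node:
  assumes s: "s \<in> trees (ialph A)" and "(\<gamma>, v) \<in> productive A (mark_root s)"
  shows "\<gamma> \<in> syn A \<union> inh A \<and> v \<in> nodes (mark_root s)"
  using assms(2)
proof (cases rule: productive_rule)
  case (1 \<gamma>' v' i \<xi>)
  then have \<gamma>: "\<gamma>' = \<gamma>" and v: "v = child v' i" by auto
  show ?thesis
  proof (cases "i = 0")
    case True
    then show ?thesis using 1 by (auto simp: owned_def child_def)
  next
    case False
    show ?thesis
    proof (cases "v' = []")
      case True
      then have "i = 1" using 1(4) rule_None(2) by simp
      then show ?thesis using 1(3) True \<gamma> v by (auto simp: owned_def child_def nodes_mark_root)
    next
      case v': False
      then obtain w where w: "v' = 1 # w" "is_node s w" using 1(2) nodes_mark_root by blast
      have "((\<gamma>, i), \<xi>) \<in> rules A (Some (label s w))" using 1(4) w \<gamma> by simp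
      from rule_Some(1)[OF label_in_alphabet[OF s w(2)] this] False
      have "is_node s (w @ [i])" using w(2) by (simp add: is_node_snoc)
      then show ?thesis using 1(3) \<gamma> v w False by (auto simp: owned_def child_def nodes_mark_root)
    qed
  qed
qed

lemma le_in_node_order:
  assumes "s \<in> trees (ialph A)"
  shows "le_in (node_order A (mark_root s) v) x y \<longleftrightarrow> occ_le A (mark_root s) (x, v) (y, v)"
proof -
  have fin: "finite (syn A \<union> inh A)" using att unfolding is_att_def by simp
  have "finite {prod_encode (x, y) | x y. occ_le A (mark_root s) (x, v) (y, v)}"
    by (rule finite_subset[of _ "prod_encode ` ((syn A \<union> inh A) \<times> (syn A \<union> inh A))"])
      (use productive_node[OF assms] fin in \<open>auto simp: occ_le_def intro!: imageI\<close>)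
  then show ?thesis unfolding node_order_def le_in_def by auto
qed

context
  fixes s w
  assumes s: "s \<in> trees (ialph A)" and w: "is_node s w"
begin

abbreviation (input) "cl \<equiv> cluster A (mark_root s) (1 # w)"

lemma cluster_bound:
  assumes "occ_le A (mark_root s) (pfst x, child (1 # w) (psnd x)) (pfst y, child (1 # w) (psnd y))"
  shows "prod_encode (x, y) < m"
proof -
  let ?k = "length (children (subtree s w))"
  have k: "(label s w, ?k) \<in> ialph A" by (rule label_in_alphabet[OF s w])
  have rank: "i \<le> ?k" if "child (1 # w) i \<in> nodes (mark_root s)" for i
    using that by (auto simp: child_def nodes_mark_root is_node_snoc split: if_splits)
  have "pfst x \<in> syn A \<union> inh A" "psnd x \<le> ?k" "pfst y \<in> syn A \<union> inh A" "psnd y \<le> ?k"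
    using assms productive_node[OF s] rank unfolding occ_le_def by blast+
  from order_bound[OF k this(1,3,2,4)] show ?thesis by simp
qed

lemma le_in_cluster:
  "le_in cl x y \<longleftrightarrow> occ_le A (mark_root s) (pfst x, child (1 # w) (psnd x)) (pfst y, child (1 # w) (psnd y))"
proof -
  have "finite {prod_encode (x, y) | x y.
     occ_le A (mark_root s) (pfst x, child (1 # w) (psnd x)) (pfst y, child (1 # w) (psnd y))}"
    by (rule finite_subset[of _ "{..<m}"]) (use cluster_bound in auto)
  then show ?thesis unfolding cluster_def le_in_def by auto
qed

lemma cluster_less: "cl < M"
  unfolding cluster_def by (rule set_encode_less_power) (use cluster_bound in auto)

text \<open>All traces come from one relation on the whole tree. Hence the clusters of a node and of
  its child agree on the child, which is the compatibility that a run demands.\<close>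

lemma proj_cluster: "proj i cl = node_order A (mark_root s) (child (1 # w) i)"
  by (rule le_in_eqI) (simp add: le_in_proj le_in_cluster le_in_node_order[OF s] del: One_nat_def)

lemma order_code_cluster: "order_code cl"
proof -
  have "x = y" if "pfst x = pfst y" "psnd x = psnd y" for x y
    using that by (metis prod_eqI prod_decode_eq)
  then show ?thesis
    unfolding order_code_def le_in_cluster occ_le_def child_eq_iff[symmetric, of _ _ "1 # w"]
    by (intro conjI allI impI) (auto simp: child_eq_iff)
qed

lemma valid_cluster: "valid A M (label s w) cl"
proof -
  have "\<exists>\<xi>. ((\<gamma>, i), \<xi>) \<in> rules A (Some (label s w)) \<and> fits cl (\<gamma>, i) \<xi>"
    if le: "le_in cl (prod_encode (\<gamma>, i)) (prod_encode (\<gamma>, i))" and own: "owned A \<gamma> i" for \<gamma> i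
  proof -
    have p: "(\<gamma>, child (1 # w) i) \<in> productive A (mark_root s)"
      using le by (simp add: le_in_cluster occ_le_def del: One_nat_def)
    from p show ?thesis
    proof (cases rule: productive_rule)
      case (1 \<gamma>' v' i' \<xi>)
      \<comment> \<open>Ownership excludes the other reading of the address, so the rule supplied by
        productivity belongs to this very node.\<close>
      then have "v' = 1 # w" "i' = i" "\<gamma>' = \<gamma>"
        using owned_unique[of \<gamma> i i' "1 # w" v'] own by auto
      then have "((\<gamma>, i), \<xi>) \<in> rules A (Some (label s w))" using 1(4) w by simp
      moreover have "fits cl (\<gamma>, i) \<xi>"
        unfolding fits_def
      proof
        fix z assume z: "z \<in> attrs \<xi>"
        then have "(fst z, child (1 # w) (snd z)) \<in> attrs (inst v' \<xi>)"
          by (auto simp: attrs_inst \<open>v' = 1 # w\<close> intro!: image_eqI[of _ _ z] split: prod.split)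
        from 1(5)[OF this] show "le_in cl (prod_encode z) (prod_encode (\<gamma>, i)) \<and> z \<noteq> (\<gamma>, i)"
          using p by (auto simp: le_in_cluster occ_le_def simp del: One_nat_def)
      qed
      ultimately show ?thesis by blast
    qed
  qed
  then show ?thesis unfolding valid_def using cluster_less order_code_cluster by blast
qed

end

text \<open>By induction over subtrees each cluster is a possible transition, so the subset
  construction retains the run given by heights.\<close>

lemma node_order_mem_bu_state:
  assumes s: "s \<in> trees (ialph A)" and "is_node s w"
  shows "node_order A (mark_root s) (1 # w) \<in> set_decode (bu_state A m (subtree s w))"
  using assms(2)
proof (induction "subtree s w" arbitrary: w rule: tree.induct)
  case (Node \<sigma> ts)
  note st = Node.hyps(2)[symmetric]
  let ?c = "cluster A (mark_root s) (1 # w)"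
  have "label s w = \<sigma>" by (simp add: label_eq_root st)
  then have "valid A M \<sigma> ?c" using valid_cluster[OF s Node.prems] by simp
  moreover have "proj (Suc i) ?c \<in> set_decode (map (bu_state A m) ts ! i)" if "i < length ts" for i
  proof -
    have child: "subtree s (w @ [Suc i]) = ts ! i" by (simp add: subtree_snoc st)
    have "node_order A (mark_root s) (1 # w @ [Suc i]) \<in> set_decode (bu_state A m (ts ! i))"
      using Node.hyps(1)[of "w @ [Suc i]"] that Node.prems unfolding child by (simp add: is_node_snoc st)
    then show ?thesis using that proj_cluster[OF s Node.prems, of "Suc i"] by (simp add: child_def)
  qed
  ultimately have "?c \<in> set_decode (moves A M \<sigma> (map (bu_state A m) ts))" by (simp add: moves_mem)
  moreover have "proj 0 ?c = node_order A (mark_root s) (1 # w)"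
    using proj_cluster[OF s Node.prems, of 0] by (simp add: child_def)
  ultimately show ?case unfolding st bu_state.simps up_mem by metis
qed

lemma root_order_node_order:
  assumes s: "s \<in> trees (ialph A)" and ev: "ev A (mark_root s) (attr_leaf (init A) [1]) t"
  shows "node_order A (mark_root s) [1] \<in> set_decode roots"
proof -
  let ?q = "node_order A (mark_root s) [1]"
  have q: "?q = proj 0 (cluster A (mark_root s) [1])"
    using proj_cluster[OF s, of "[]" 0] by (simp add: child_def)
  have "?q < M" unfolding q using cluster_less[OF s, of "[]"] by (simp add: proj_less)
  moreover have "order_code ?q"
    unfolding q using order_code_cluster[OF s, of "[]"] by (simp add: order_code_proj)
  moreover have "le_in ?q (init A) (init A)"
    using ev_derivable[OF ev] by (auto simp: le_in_node_order[OF s] occ_le_def productive_def attrs_Node)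
  moreover have "\<exists>\<xi>. ((b, 1), \<xi>) \<in> rules A None \<and> root_fits ?q (b, 1) \<xi>"
    if b: "b \<in> inh A" and le: "le_in ?q b b" for b
  proof -
    have p: "(b, [1]) \<in> productive A (mark_root s)" using le by (simp add: le_in_node_order[OF s] occ_le_def)
    then show ?thesis
    proof (cases rule: productive_rule)
      case (1 \<gamma>' v' i' \<xi>)
      have "child [] 1 = child v' i'" "owned A b 1" using 1(1) b by (auto simp: child_def owned_def)
      then have "v' = []" "i' = 1" "\<gamma>' = b" using owned_unique[of b 1 i' "[]" v'] 1(1,3) by auto
      then have r: "((b, 1), \<xi>) \<in> rules A None" using 1(4) by simp
      moreover have "root_fits ?q (b, 1) \<xi>"
        unfolding root_fits_def
      proof
        fix z assume z: "z \<in> attrs \<xi>"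
        have "snd z = 1" using attrs_root_rhs[OF r z] by simp
        then have "(fst z, [1]) \<in> attrs (inst v' \<xi>)"
          using z by (auto simp: attrs_inst \<open>v' = []\<close> child_def intro!: image_eqI[of _ _ z] split: prod.split)
        from 1(5)[OF this] show "le_in ?q (fst z) (fst (b, 1)) \<and> fst z \<noteq> fst (b, 1)"
          using p by (auto simp: le_in_node_order[OF s] occ_le_def)
      qed
      ultimately show ?thesis by blast
    qed
  qed
  ultimately show ?thesis by (auto simp: mem_roots root_order_def)
qed

section \<open>Evaluation along an arbitrary run\<close>

abbreviation (input) evaluable :: "nat tree \<Rightarrow> nat \<Rightarrow> nat list \<Rightarrow> bool" where
  "evaluable s' \<gamma> v \<equiv> \<exists>t. ev C (mark_root s') (attr_leaf \<gamma> v) t"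

lemma evaluable_rule:
  assumes "v \<in> nodes (mark_root s')" "((\<gamma>, i), \<xi>) \<in> rules C (label (mark_root s') v)" "owned C \<gamma> i"
    and "\<xi> \<in> trees_with \<Delta> \<Lambda>"
    and "\<And>\<delta> j. (\<delta>, j) \<in> attrs \<xi> \<Longrightarrow> evaluable s' \<delta> (child v j)"
  shows "evaluable s' \<gamma> (child v i)"
proof -
  have "\<exists>t. ev C (mark_root s') (inst v \<xi>) t"
    by (rule ev_total[OF inst_in_trees_with[OF assms(4)]]) (use assms(5) in \<open>auto simp: attrs_inst\<close>)
  then show ?thesis using assms(1-3) ev_attr unfolding owned_def by metis
qed

text \<open>
  The order at the root of a subtree bounds the dependence of its synthesized attributes on the
  inherited ones, so the children can be treated as black boxes.
\<close>

lemma run_evaluable: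
  assumes "run A m u s1 s1'" and "s1 \<in> trees (ialph A)" and "is_node s' w" and "subtree s' w = s1'"
  shows "\<exists>q\<in>set_decode u. order_code q \<and> q = proj 0 (psnd (label s' w)) \<and>
    (\<forall>a\<in>syn A. le_in q a a \<longrightarrow> (\<forall>b\<in>inh A. le_in q b a \<longrightarrow> evaluable s' b (1 # w)) \<longrightarrow>
       evaluable s' a (1 # w))"
  using assms
proof (induction arbitrary: w rule: run.induct)
  case (1 c \<sigma> ts u us)
  have valid: "valid A M \<sigma> c" and "order_code c" using 1(1) by (auto simp: moves_mem valid_def)
  have \<sigma>: "(\<sigma>, length ts) \<in> ialph A" and ts: "\<And>t. t \<in> set ts \<Longrightarrow> t \<in> trees (ialph A)"
    using 1(6) by (auto simp: trees_Node_iff)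
  have label: "label s' w = prod_encode (\<sigma>, c)" using 1(8) by (simp add: label_eq_root)
  have "evaluable s' a (1 # w)"
    if a: "a \<in> syn A" and le: "le_in (proj 0 c) a a"
      and inh: "\<And>b. b \<in> inh A \<Longrightarrow> le_in (proj 0 c) b a \<Longrightarrow> evaluable s' b (1 # w)" for a
  proof -
    \<comment> \<open>Only occurrences below \<open>a\<close> are treated, since the assumption
      \<open>inh\<close> speaks of no others. The induction runs along the strict order of
      \<open>c\<close>.\<close>
    have "\<forall>\<gamma> i. x = prod_encode (\<gamma>, i) \<longrightarrow> le_in c x (prod_encode (a, 0)) \<longrightarrow> \<gamma> \<in> syn A \<union> inh A \<longrightarrow>
        i \<le> length ts \<longrightarrow> evaluable s' \<gamma> (child (1 # w) i)" if "le_in c x x" for x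
      using \<open>order_code c\<close> that
    proof (induction rule: order_code_induct)
      case (less x)
      show ?case
      proof (intro allI impI)
        fix \<gamma> i assume x: "x = prod_encode (\<gamma>, i)" and xa: "le_in c x (prod_encode (a, 0))"
          and \<gamma>: "\<gamma> \<in> syn A \<union> inh A" and i: "i \<le> length ts"
        have IH: "evaluable s' \<delta> (child (1 # w) j)"
          if "le_in c (prod_encode (\<delta>, j)) x" "(\<delta>, j) \<noteq> (\<gamma>, i)" "\<delta> \<in> syn A \<union> inh A" "j \<le> length ts" for \<delta> j
          using less.IH[of "prod_encode (\<delta>, j)"] that order_code_trans[OF \<open>order_code c\<close> that(1) xa] x by auto
        \<comment> \<open>An occurrence is defined above the node, within the subtree of a child, or
          at the node itself; these cases use the assumption \<open>inh\<close>, the hypothesis for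
          that child, and the rule fitting \<open>c\<close>.\<close>
        consider (inh) "\<gamma> \<in> inh A" "i = 0" | (syn) "\<gamma> \<in> syn A" "i > 0" | (own) "owned A \<gamma> i"
          using \<gamma> unfolding owned_def by auto
        then show "evaluable s' \<gamma> (child (1 # w) i)"
        proof cases
          case inh
          then show ?thesis using \<open>\<And>b. b \<in> inh A \<Longrightarrow> _ \<Longrightarrow> _\<close>[of \<gamma>] xa x by (simp add: le_in_proj child_def)
        next
          case syn
          let ?i = "i - 1"
          have i': "?i < length ts" "Suc ?i = i" using syn i by auto
          have node: "is_node s' (w @ [i])" and sub: "subtree s' (w @ [i]) = us ! ?i"
            using 1(3,7,8) syn i by (simp_all add: is_node_snoc subtree_snoc)
          have "ts ! ?i \<in> trees (ialph A)" using ts i' by simp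
          \<comment> \<open>The state at the child is a singleton, so the order obtained from the
            hypothesis is \<open>proj i c\<close>.\<close>
          from 1(5)[OF i'(1) this node sub] i'(2)
          have *: "le_in (proj i c) a' a' \<Longrightarrow> (\<And>b. b \<in> inh A \<Longrightarrow> le_in (proj i c) b a' \<Longrightarrow>
              evaluable s' b (1 # w @ [i])) \<Longrightarrow> a' \<in> syn A \<Longrightarrow> evaluable s' a' (1 # w @ [i])" for a'
            by auto
          have "evaluable s' \<gamma> (1 # w @ [i])"
          proof (rule *)
            show "le_in (proj i c) \<gamma> \<gamma>" using less.hyps x by (simp add: le_in_proj)
            fix b assume "b \<in> inh A" "le_in (proj i c) b \<gamma>"
            then show "evaluable s' b (1 # w @ [i])"
              using IH[of b i] x i disjoint[OF syn(1)] syn by (auto simp: le_in_proj child_def)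
          qed (rule syn(1))
          then show ?thesis using syn by (simp add: child_def)
        next
          case own
          then obtain \<xi> where "((\<gamma>, i), \<xi>) \<in> rules A (Some \<sigma>)" "fits c (\<gamma>, i) \<xi>"
            using valid less.hyps x unfolding valid_def by blast
          then obtain \<xi>' where \<xi>': "((\<gamma>, i), \<xi>') \<in> pick (rules A (Some \<sigma>)) (fits c)" "fits c (\<gamma>, i) \<xi>'"
            using pick_ex by metis
          then have r: "((\<gamma>, i), \<xi>') \<in> rules A (Some \<sigma>)" using pick_subset by blast
          note wf = rule_Some(2)[OF \<sigma> r]
          show ?thesis
          proof (rule evaluable_rule[OF _ _ _ wf])
            show "1 # w \<in> nodes (mark_root s')" using 1(7) nodes_mark_root by auto
            show "((\<gamma>, i), \<xi>') \<in> rules C (label (mark_root s') (1 # w))"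
              using \<xi>'(1) 1(7) label by simp
            show "owned C \<gamma> i" using own by (auto simp: owned_def)
            fix \<delta> j assume z: "(\<delta>, j) \<in> attrs \<xi>'"
            then show "evaluable s' \<delta> (child (1 # w) j)"
              using \<xi>'(2) attrs_subset[OF wf] x unfolding fits_def by (intro IH) auto
          qed
        qed
      qed
    qed
    from this[of "prod_encode (a, 0)"] show ?thesis using le a by (simp add: le_in_proj child_def)
  qed
  then show ?case
    using 1(2) label order_code_proj[OF \<open>order_code c\<close>] by (intro bexI[of _ "proj 0 c"]) auto
qed

text \<open>The black box for the whole input tree still expects its inherited attributes. Order
  induction at node 1 closes the loop: a synthesized attribute uses the box, an inherited one a rule
  of \<open>#\<close> with strictly smaller leaves.\<close>

lemma root_evaluable:
  assumes s: "s \<in> trees (ialph A)" and run: "run A m roots s s'"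
  shows "evaluable s' (init A) [1]"
proof -
  obtain q where q: "q \<in> set_decode roots" "order_code q" "q = proj 0 (psnd (label s' []))"
    and syn: "\<And>a. a \<in> syn A \<Longrightarrow> le_in q a a \<Longrightarrow> (\<And>b. b \<in> inh A \<Longrightarrow> le_in q b a \<Longrightarrow> evaluable s' b [1]) \<Longrightarrow>
      evaluable s' a [1]"
    using run_evaluable[OF run s, of s' "[]"] by auto
  have root: "root_order A q" using q(1) mem_roots by blast
  have "\<gamma> \<in> syn A \<union> inh A \<longrightarrow> evaluable s' \<gamma> [1]" if "le_in q \<gamma> \<gamma>" for \<gamma>
    using q(2) that
  proof (induction rule: order_code_induct)
    case (less \<gamma>)
    show ?case
    proof
      assume "\<gamma> \<in> syn A \<union> inh A"
      then show "evaluable s' \<gamma> [1]"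
      proof
        assume \<gamma>: "\<gamma> \<in> syn A"
        show ?thesis
        proof (rule syn[OF \<gamma>])
          fix b assume b: "b \<in> inh A" and "le_in q b \<gamma>"
          moreover have "b \<noteq> \<gamma>" using disjoint \<gamma> b by blast
          ultimately show "evaluable s' b [1]" using less.IH by blast
        qed (rule less.hyps)
      next
        assume \<gamma>: "\<gamma> \<in> inh A"
        then obtain \<xi> where "((\<gamma>, 1), \<xi>) \<in> rules A None" "root_fits q (\<gamma>, 1) \<xi>"
          using root less.hyps unfolding root_order_def by blast
        then obtain \<xi>' where \<xi>': "((\<gamma>, 1), \<xi>') \<in> pick (rules A None) (root_fits q)" "root_fits q (\<gamma>, 1) \<xi>'"
          using pick_ex by metis
        then have r: "((\<gamma>, 1), \<xi>') \<in> rules A None" using pick_subset by blast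
        \<comment> \<open>The detour is followed backwards, from \<open>answer\<close> over
          \<open>ask\<close> to the old attribute. The rule picked for \<open>q\<close> is the one
          that \<open>ask\<close> selects, because \<open>q\<close> is the trace of the transition
          written at node 1.\<close>
        have answer: "evaluable s' (answer K \<gamma> (code_tree \<xi>')) (child [] 1)"
        proof (rule evaluable_rule[OF _ _ _ rule_None(3)[OF r]])
          fix \<delta> j assume z: "(\<delta>, j) \<in> attrs \<xi>'"
          then have "le_in q \<delta> \<gamma>" "\<delta> \<noteq> \<gamma>" "\<delta> \<in> syn A" "j = 1"
            using \<xi>'(2) attrs_root_rhs[OF r z] unfolding root_fits_def by auto
          then show "evaluable s' \<delta> (child [] j)" using less.IH by (simp add: child_def)
        qed (use r in \<open>auto simp: nodes_mark_root owned_def\<close>)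
        have wf: "attr_leaf x i \<in> trees_with {} UNIV" for x i :: nat by simp
        have ask: "evaluable s' (ask K \<gamma>) (child [1] 0)"
        proof (rule evaluable_rule[OF _ _ _ wf])
          show "((ask K \<gamma>, 0), attr_leaf (answer K \<gamma> (code_tree \<xi>')) 0) \<in> rules C (label (mark_root s') [1])"
            using \<xi>'(1) q(3) by auto
          show "evaluable s' \<delta> (child [1] j)" if "(\<delta>, j) \<in> attrs (attr_leaf (answer K \<gamma> (code_tree \<xi>')) 0)" for \<delta> j
            using that answer by (auto simp: attrs_Node child_def)
        qed (use \<gamma> in \<open>auto simp: nodes_mark_root owned_def\<close>)
        have "evaluable s' \<gamma> (child [] 1)"
        proof (rule evaluable_rule[OF _ _ _ wf])
          show "((\<gamma>, 1), attr_leaf (ask K \<gamma>) 1) \<in> rules C (label (mark_root s') [])" using \<gamma> by auto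
          show "evaluable s' \<delta> (child [] j)" if "(\<delta>, j) \<in> attrs (attr_leaf (ask K \<gamma>) 1)" for \<delta> j
            using that ask by (auto simp: attrs_Node child_def)
        qed (use \<gamma> in \<open>auto simp: nodes_mark_root owned_def\<close>)
        then show ?thesis by (simp add: child_def)
      qed
    qed
  qed
  then show ?thesis using root att unfolding root_order_def is_att_def by auto
qed

lemma attU_trans_complete: "Domain (att_trans A) \<subseteq> Domain (attU_trans (uniformizing_attU A m K))"
proof
  fix s assume "s \<in> Domain (att_trans A)"
  then obtain t where s: "s \<in> trees (ialph A)" and ev: "ev A (mark_root s) (attr_leaf (init A) [1]) t"
    unfolding Domain_iff att_trans_iff by blast
  have ne: "set_decode (bu_state A m s) \<inter> set_decode roots \<noteq> {}"
    using root_order_node_order[OF s ev] node_order_mem_bu_state[OF s, of "[]"] by auto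
  then have B: "(s, bu_tree A m s) \<in> burel_trans B" using burel_trans_B s by simp
  obtain s' where T: "(bu_tree A m s, s') \<in> att_trans T" using T_run_total[OF s ne] by blast
  then have s': "s' \<in> trees (ialph C)" unfolding att_trans_iff by (simp add: td_relabeling_def)
  obtain t' where t': "ev C (mark_root s') (attr_leaf (init C) [1]) t'"
    using root_evaluable[OF s T_run[OF s T]] by auto
  have "init C \<in> syn C" using is_att_C unfolding is_att_def by blast
  then have "(s', t') \<in> att_trans C"
    using s' t' ev_in_trees[OF is_att_C s' t'] unfolding att_trans_iff by auto
  then show "s \<in> Domain (attU_trans (uniformizing_attU A m K))"
    using B T unfolding uniformizing_attU_def by auto
qed

lemma uniformizer_attU_trans: "uniformizer (attU_trans (uniformizing_attU A m K)) (att_trans A)"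
  unfolding uniformizer_def using attU_trans_single_valued attU_trans_sound attU_trans_complete Domain_mono[OF attU_trans_sound] by blast

end


section \<open>Computability of the construction\<close>

text \<open>A binary operation has to be treated only on the two projections of a pair; arbitrary
  computable arguments are then substituted.\<close>

lemma computable2:
  "computable (\<lambda>e. f (pfst e) (psnd e)) \<Longrightarrow> computable g \<Longrightarrow> computable h \<Longrightarrow> computable (\<lambda>e. f (g e) (h e))"
  using computable_comp[OF _ computable_prod_encode, of "\<lambda>e. f (pfst e) (psnd e)" g h] by simp

lemma computable3:
  "computable (\<lambda>e. f (pfst e) (pfst (psnd e)) (psnd (psnd e))) \<Longrightarrow> computable g \<Longrightarrow> computable h \<Longrightarrow>
   computable k \<Longrightarrow> computable (\<lambda>e. f (g e) (h e) (k e))"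
  using computable2[of "\<lambda>x y. f x (pfst y) (psnd y)" g "\<lambda>e. prod_encode (h e, k e)"]
  by (simp add: computable_prod_encode)

lemma decidable2:
  "decidable (\<lambda>e. P (pfst e) (psnd e)) \<Longrightarrow> computable g \<Longrightarrow> computable h \<Longrightarrow> decidable (\<lambda>e. P (g e) (h e))"
  unfolding decidable_def by (rule computable2)

lemma decidable3:
  "decidable (\<lambda>e. P (pfst e) (pfst (psnd e)) (psnd (psnd e))) \<Longrightarrow> computable g \<Longrightarrow> computable h \<Longrightarrow>
   computable k \<Longrightarrow> decidable (\<lambda>e. P (g e) (h e) (k e))"
  unfolding decidable_def by (rule computable3)

lemma computable_sets2:
  "computable_sets (\<lambda>e. S (pfst e) (psnd e)) \<Longrightarrow> computable g \<Longrightarrow> computable h \<Longrightarrow>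
   computable_sets (\<lambda>e. S (g e) (h e))"
  using computable_sets_comp[OF _ computable_prod_encode, of "\<lambda>e. S (pfst e) (psnd e)" g h] by simp

lemma computable_sets3:
  "computable_sets (\<lambda>e. S (pfst e) (pfst (psnd e)) (psnd (psnd e))) \<Longrightarrow> computable g \<Longrightarrow> computable h \<Longrightarrow>
   computable k \<Longrightarrow> computable_sets (\<lambda>e. S (g e) (h e) (k e))"
  using computable_sets2[of "\<lambda>x y. S x (pfst y) (psnd y)" g "\<lambda>e. prod_encode (h e, k e)"]
  by (simp add: computable_prod_encode)

subsection \<open>Leaves of coded trees\<close>

definition closed_code :: "nat \<Rightarrow> bool" where
  "closed_code w \<longleftrightarrow> (\<forall>d\<in>set_decode w. \<forall>i<length (list_decode (psnd d)). nth_code (psnd d) i \<in> set_decode w)"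

text \<open>
  The subtrees of a tree with code \<open>n\<close> form the least closed set containing \<open>n\<close>; quantifying over
  the codes of all such sets replaces a recursion over the coded tree.
\<close>

definition leaf_in :: "nat \<Rightarrow> nat \<Rightarrow> bool" where
  "leaf_in z n \<longleftrightarrow> (\<forall>w<2 ^ Suc n. n \<in> set_decode w \<and> closed_code w \<longrightarrow> (\<exists>d\<in>set_decode w. pfst d = Suc (2 * z)))"

fun subtrees :: "'f tree \<Rightarrow> 'f tree set" where
  "subtrees (Node f ts) = insert (Node f ts) (\<Union>t\<in>set ts. subtrees t)"

lemma subtrees_refl: "\<xi> \<in> subtrees \<xi>"
  by (cases \<xi>) simp

lemma finite_subtrees: "finite (subtrees \<xi>)"
  by (induction \<xi>) auto

lemma mem_less_list_encode: "x \<in> set xs \<Longrightarrow> x < list_encode xs"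
proof (induction xs)
  case (Cons y ys)
  then show ?case
    using le_prod_encode_1[of y "list_encode ys"] le_prod_encode_2[of "list_encode ys" y] by auto
qed simp

lemma code_subtree_le: "\<zeta> \<in> subtrees \<xi> \<Longrightarrow> code_tree \<zeta> \<le> code_tree \<xi>"
proof (induction \<xi>)
  case (Node f ts)
  show ?case
  proof (cases "\<zeta> = Node f ts")
    case False
    then obtain t where t: "t \<in> set ts" "\<zeta> \<in> subtrees t" using Node.prems by auto
    then have "code_tree \<zeta> \<le> code_tree t" using Node.IH by blast
    also have "code_tree t < list_encode (map code_tree ts)" using t by (intro mem_less_list_encode) auto
    also have "\<dots> \<le> code_tree (Node f ts)" by (simp add: le_prod_encode_2)
    finally show ?thesis by simp
  qed simp
qed

lemma subtrees_children: "Node f ts \<in> subtrees \<xi> \<Longrightarrow> t \<in> set ts \<Longrightarrow> t \<in> subtrees \<xi>"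
proof (induction \<xi>)
  case (Node g us)
  then show ?case using subtrees_refl[of t] by auto
qed

lemma attrs_subtrees: "z \<in> attrs \<xi> \<longleftrightarrow> (\<exists>ts. Node (Inr z) ts \<in> subtrees \<xi>)"
  by (induction \<xi>) (auto simp: attrs_Node)

text \<open>\<open>sum_encode\<close> sends \<open>Inr z\<close> to \<open>Suc (2 * z)\<close>, so
  attribute labels are the ones with odd code.\<close>

lemma pfst_code_tree: "pfst (code_tree (Node f ts)) = Suc (2 * z) \<longleftrightarrow> f = Inr (prod_decode z)"
proof -
  have "sum_encode (map_sum id prod_encode f) = sum_encode (Inr z) \<longleftrightarrow> map_sum id prod_encode f = Inr z"
    by (rule sum_encode_eq)
  then show ?thesis by (cases f) (auto simp: sum_encode_def)
qed

lemma closed_subtrees: "closed_code (set_encode (code_tree ` subtrees \<xi>))"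
proof -
  have "nth_code (psnd (code_tree \<zeta>)) i \<in> code_tree ` subtrees \<xi>"
    if \<zeta>: "\<zeta> \<in> subtrees \<xi>" and i: "i < length (list_decode (psnd (code_tree \<zeta>)))" for \<zeta> i
  proof -
    obtain f ts where "\<zeta> = Node f ts" by (cases \<zeta>)
    then show ?thesis using \<zeta> i subtrees_children[of f ts \<xi> "ts ! i"] by simp
  qed
  then show ?thesis unfolding closed_code_def by (auto simp: finite_subtrees)
qed

lemma closed_code_subtrees:
  "closed_code w \<Longrightarrow> code_tree \<xi> \<in> set_decode w \<Longrightarrow> \<zeta> \<in> subtrees \<xi> \<Longrightarrow> code_tree \<zeta> \<in> set_decode w"
proof (induction \<xi>)
  case (Node f ts)
  have "code_tree t \<in> set_decode w" if t: "t \<in> set ts" for t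
  proof -
    obtain i where i: "i < length ts" "ts ! i = t" using t unfolding in_set_conv_nth by blast
    have "\<forall>i<length (list_decode (psnd (code_tree (Node f ts)))).
        nth_code (psnd (code_tree (Node f ts))) i \<in> set_decode w"
      using Node.prems(1,2) unfolding closed_code_def by blast
    moreover have "list_decode (psnd (code_tree (Node f ts))) = map code_tree ts" by simp
    ultimately have "nth_code (psnd (code_tree (Node f ts))) i \<in> set_decode w" using i(1) by (metis length_map)
    then show ?thesis using i by simp
  qed
  then show ?case using Node.IH Node.prems by (cases "\<zeta> = Node f ts") auto
qed

text \<open>The set of all subtree codes is closed and bounded by the code of the tree, so it is
  among the sets \<open>w\<close> tested. Conversely a closed set containing the tree contains all
  its subtrees.\<close>

lemma leaf_in_code_tree: "leaf_in z (code_tree \<xi>) \<longleftrightarrow> prod_decode z \<in> attrs \<xi>"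
proof
  let ?w = "set_encode (code_tree ` subtrees \<xi>)"
  have w: "set_decode ?w = code_tree ` subtrees \<xi>" by (simp add: finite_subtrees)
  assume "leaf_in z (code_tree \<xi>)"
  moreover have "?w < 2 ^ Suc (code_tree \<xi>)"
    by (rule set_encode_less_power) (auto simp: less_Suc_eq_le code_subtree_le)
  ultimately have "\<exists>d\<in>set_decode ?w. pfst d = Suc (2 * z)"
    unfolding leaf_in_def using closed_subtrees[of \<xi>] subtrees_refl[of \<xi>] w by blast
  then obtain \<zeta> where \<zeta>: "\<zeta> \<in> subtrees \<xi>" "pfst (code_tree \<zeta>) = Suc (2 * z)" unfolding w by blast
  obtain f ts where "\<zeta> = Node f ts" by (cases \<zeta>)
  then show "prod_decode z \<in> attrs \<xi>" using \<zeta> pfst_code_tree attrs_subtrees by metis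
next
  assume "prod_decode z \<in> attrs \<xi>"
  then obtain ts where "Node (Inr (prod_decode z)) ts \<in> subtrees \<xi>" using attrs_subtrees by blast
  then show "leaf_in z (code_tree \<xi>)"
    unfolding leaf_in_def using closed_code_subtrees pfst_code_tree by blast
qed

lemma leaf_in_less: "leaf_in z (code_tree \<xi>) \<Longrightarrow> z < code_tree \<xi>"
proof -
  assume "leaf_in z (code_tree \<xi>)"
  then obtain ts where ts: "Node (Inr (prod_decode z)) ts \<in> subtrees \<xi>"
    using leaf_in_code_tree attrs_subtrees by blast
  have "z < Suc (2 * z)" by simp
  also have "Suc (2 * z) \<le> code_tree (Node (Inr (prod_decode z)) ts)"
    by (simp add: sum_encode_def le_prod_encode_1)
  also have "\<dots> \<le> code_tree \<xi>" by (rule code_subtree_le[OF ts])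
  finally show ?thesis .
qed

text \<open>An occurrence at a leaf has a smaller code than the tree, so a quantifier over leaves
  becomes bounded.\<close>

lemma ball_attrs: "(\<forall>z\<in>attrs \<xi>. P (prod_encode z)) \<longleftrightarrow> (\<forall>z<code_tree \<xi>. leaf_in z (code_tree \<xi>) \<longrightarrow> P z)"
proof
  assume *: "\<forall>z\<in>attrs \<xi>. P (prod_encode z)"
  then show "\<forall>z<code_tree \<xi>. leaf_in z (code_tree \<xi>) \<longrightarrow> P z"
    using leaf_in_code_tree by (metis prod_decode_inverse)
next
  assume *: "\<forall>z<code_tree \<xi>. leaf_in z (code_tree \<xi>) \<longrightarrow> P z"
  show "\<forall>z\<in>attrs \<xi>. P (prod_encode z)"
  proof
    fix z assume "z \<in> attrs \<xi>"
    then have "leaf_in (prod_encode z) (code_tree \<xi>)" by (simp add: leaf_in_code_tree)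
    then show "P (prod_encode z)" using * leaf_in_less by blast
  qed
qed

lemma decidable_closed_code: "computable f \<Longrightarrow> decidable (\<lambda>e. closed_code (f e))"
  by (rule decidable_comp) (unfold closed_code_def, intro computable_intros)

lemma decidable_leaf_in: "computable f \<Longrightarrow> computable g \<Longrightarrow> decidable (\<lambda>e. leaf_in (f e) (g e))"
  by (rule decidable2) (unfold leaf_in_def, intro computable_intros decidable_closed_code)

subsection \<open>The construction on codes\<close>

text \<open>Attributes and ranks of a transducer are smaller than its code \<open>x\<close>, and
  pairing is monotone; the bound thus holds without decoding \<open>x\<close>.\<close>

definition order_bound :: "nat \<Rightarrow> nat" where
  "order_bound x = Suc (prod_encode (prod_encode (x, x), prod_encode (x, x)))"

text \<open>Component 5 of the code is the rule set; the tag \<open>y\<close> is 0 for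
  \<open>#\<close> and \<open>Suc \<sigma>\<close> for an input symbol.\<close>

definition coded_rules :: "nat \<Rightarrow> nat \<Rightarrow> nat set" where
  "coded_rules x y = psnd ` {r \<in> set_decode (nth_code x 5). pfst r = y}"

definition fits_code :: "nat \<Rightarrow> nat \<Rightarrow> nat \<Rightarrow> bool" where
  "fits_code c l n \<longleftrightarrow> (\<forall>z<n. leaf_in z n \<longrightarrow> le_in c z l \<and> z \<noteq> l)"

definition root_fits_code :: "nat \<Rightarrow> nat \<Rightarrow> nat \<Rightarrow> bool" where
  "root_fits_code q l n \<longleftrightarrow> (\<forall>z<n. leaf_in z n \<longrightarrow> le_in q (pfst z) (pfst l) \<and> pfst z \<noteq> pfst l)"

definition owned_code :: "nat \<Rightarrow> nat \<Rightarrow> bool" where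
  "owned_code x l \<longleftrightarrow> pfst l \<in> set_decode (nth_code x 0) \<and> psnd l = 0 \<or>
     pfst l \<in> set_decode (nth_code x 1) \<and> 0 < psnd l"

definition valid_code :: "nat \<Rightarrow> nat \<Rightarrow> nat \<Rightarrow> bool" where
  "valid_code x \<sigma> c \<longleftrightarrow> c < 2 ^ order_bound x \<and> order_code c \<and>
     (\<forall>d\<in>set_decode c. pfst d = psnd d \<and> owned_code x (pfst d) \<longrightarrow>
       (\<exists>r\<in>coded_rules x (Suc \<sigma>). pfst r = pfst d \<and> fits_code c (pfst d) (psnd r)))"

definition root_order_code :: "nat \<Rightarrow> nat \<Rightarrow> bool" where
  "root_order_code x q \<longleftrightarrow> order_code q \<and> le_in q (nth_code x 4) (nth_code x 4) \<and>
     (\<forall>b\<in>set_decode (nth_code x 1). le_in q b b \<longrightarrow>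
       (\<exists>r\<in>coded_rules x 0. pfst r = prod_encode (b, 1) \<and> root_fits_code q (pfst r) (psnd r)))"

definition moves_code :: "nat \<Rightarrow> nat \<Rightarrow> nat \<Rightarrow> nat" where
  "moves_code x \<sigma> p = set_encode {c \<in> {..<2 ^ order_bound x}. valid_code x \<sigma> c \<and>
     (\<forall>i<length (list_decode p). proj (Suc i) c \<in> set_decode (nth_code p i))}"

definition labelled_code :: "nat \<Rightarrow> nat \<Rightarrow> nat set" where
  "labelled_code x N = (\<Union>s\<in>set_decode (nth_code x 2). (\<lambda>W. prod_encode (prod_encode (pfst s, W), psnd s)) ` {..<N})"

text \<open>Codes of lists grow with the entries, so the constant list of \<open>N\<close> bounds
  all tuples with entries below \<open>N\<close>.\<close>

definition tuples :: "nat \<Rightarrow> nat \<Rightarrow> nat set" where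
  "tuples N k = {p \<in> {..<Suc (list_encode (map (\<lambda>i. N) [0..<k]))}.
     length (list_decode p) = k \<and> (\<forall>i<k. nth_code p i < N)}"

definition burel_code :: "nat \<Rightarrow> nat" where
  "burel_code x = list_encode
     [set_encode {..<2 ^ 2 ^ order_bound x}, nth_code x 2, set_encode (labelled_code x (2 ^ 2 ^ order_bound x)),
      set_encode {p \<in> {..<2 ^ 2 ^ order_bound x}. \<exists>q\<in>set_decode p. q < 2 ^ order_bound x \<and> root_order_code x q},
      set_encode (\<Union>s\<in>set_decode (nth_code x 2).
        (\<lambda>p. prod_encode (prod_encode (pfst s, p),
           prod_encode (up (moves_code x (pfst s) p), prod_encode (pfst s, moves_code x (pfst s) p)))) `
        tuples (2 ^ 2 ^ order_bound x) (psnd s))]"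

text \<open>The odd number codes an attribute label, the final 0 the empty list of children.\<close>

definition leaf_code :: "nat \<Rightarrow> nat \<Rightarrow> nat" where
  "leaf_code q j = prod_encode (Suc (2 * prod_encode (q, j)), 0)"

definition td_rhs_code :: "nat \<Rightarrow> nat \<Rightarrow> nat" where
  "td_rhs_code s c = prod_encode (2 * prod_encode (pfst s, c),
     list_encode (map (\<lambda>i. leaf_code (2 ^ proj (Suc i) c) (Suc i)) [0..<psnd s]))"

definition td_code :: "nat \<Rightarrow> nat" where
  "td_code x = list_encode
     [set_encode {..<2 ^ 2 ^ order_bound x}, set_encode {}, set_encode (labelled_code x (2 ^ 2 ^ order_bound x)),
      set_encode (labelled_code x (2 ^ order_bound x)),
      set_encode {q \<in> {..<2 ^ order_bound x}. root_order_code x q},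
      set_encode (\<Union>s\<in>set_decode (nth_code x 2). \<Union>W\<in>{..<2 ^ 2 ^ order_bound x}.
        (\<lambda>r. prod_encode (Suc (prod_encode (pfst s, W)), r)) `
        (\<Union>u\<in>{..<2 ^ 2 ^ order_bound x}. (\<lambda>c. prod_encode (prod_encode (u, 0), td_rhs_code s c)) `
          {c \<in> {..<2 ^ order_bound x}. least_move W u c}))]"

definition picked :: "nat \<Rightarrow> nat \<Rightarrow> nat \<Rightarrow> nat set" where
  "picked x \<sigma> c = {r \<in> coded_rules x (Suc \<sigma>). fits_code c (pfst r) (psnd r) \<and>
     (\<forall>r'\<in>coded_rules x (Suc \<sigma>). pfst r' = pfst r \<and> fits_code c (pfst r) (psnd r') \<longrightarrow> psnd r \<le> psnd r')}"

definition picked_root :: "nat \<Rightarrow> nat \<Rightarrow> nat set" where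
  "picked_root x q = {r \<in> coded_rules x 0. root_fits_code q (pfst r) (psnd r) \<and>
     (\<forall>r'\<in>coded_rules x 0. pfst r' = pfst r \<and> root_fits_code q (pfst r) (psnd r') \<longrightarrow> psnd r \<le> psnd r')}"

definition choice_code :: "nat \<Rightarrow> nat" where
  "choice_code x = list_encode
     [set_encode (set_decode (nth_code x 0) \<union> ask x ` set_decode (nth_code x 1)),
      set_encode (set_decode (nth_code x 1) \<union> (\<lambda>r. answer x (pfst (pfst r)) (psnd r)) ` coded_rules x 0),
      set_encode (labelled_code x (2 ^ order_bound x)), nth_code x 3, nth_code x 4,
      set_encode ((\<lambda>r. prod_encode (0, r)) `
          ((\<lambda>b. prod_encode (prod_encode (b, 1), leaf_code (ask x b) 1)) ` set_decode (nth_code x 1) \<union>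
           (\<lambda>r. prod_encode (prod_encode (answer x (pfst (pfst r)) (psnd r), 1), psnd r)) ` coded_rules x 0) \<union>
        (\<Union>s\<in>set_decode (nth_code x 2). \<Union>c\<in>{..<2 ^ order_bound x}.
          (\<lambda>r. prod_encode (Suc (prod_encode (pfst s, c)), r)) `
          (picked x (pfst s) c \<union>
           (\<lambda>r. prod_encode (prod_encode (ask x (pfst (pfst r)), 0), leaf_code (answer x (pfst (pfst r)) (psnd r)) 0)) `
             picked_root x (proj 0 c))))]"

definition uniformizer_code :: "nat \<Rightarrow> nat" where
  "uniformizer_code x = list_encode [burel_code x, td_code x, choice_code x]"

section \<open>Decidability of the ingredients\<close>

lemma all_le_in: "(\<forall>x y. le_in c x y \<longrightarrow> P x y) \<longleftrightarrow> (\<forall>d\<in>set_decode c. P (pfst d) (psnd d))"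
  unfolding le_in_def by (metis fst_conv prod.collapse prod_decode_inverse prod_encode_inverse snd_conv)

text \<open>Quantifiers over all elements are replaced by quantifiers over the finitely many coded
  pairs; transitivity joins two pairs with a common middle element.\<close>

lemma order_code_bounded: "order_code c \<longleftrightarrow>
   (\<forall>d\<in>set_decode c. le_in c (pfst d) (pfst d) \<and> le_in c (psnd d) (psnd d)) \<and>
   (\<forall>d\<in>set_decode c. le_in c (psnd d) (pfst d) \<longrightarrow> pfst d = psnd d) \<and>
   (\<forall>d\<in>set_decode c. \<forall>d'\<in>set_decode c. psnd d = pfst d' \<longrightarrow> le_in c (pfst d) (psnd d'))"
proof -
  have "(\<forall>x y z. le_in c x y \<longrightarrow> le_in c y z \<longrightarrow> le_in c x z) \<longleftrightarrow>
    (\<forall>x y. le_in c x y \<longrightarrow> (\<forall>y' z. le_in c y' z \<longrightarrow> y = y' \<longrightarrow> le_in c x z))" by blast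
  then show ?thesis unfolding order_code_def by (simp only: all_le_in)
qed

lemma decidable_le_in:
  "computable f \<Longrightarrow> computable g \<Longrightarrow> computable h \<Longrightarrow> decidable (\<lambda>e. le_in (f e) (g e) (h e))"
  unfolding le_in_def by (intro computable_intros)

lemma decidable_order_code: "computable f \<Longrightarrow> decidable (\<lambda>e. order_code (f e))"
  by (rule decidable_comp) (unfold order_code_bounded, intro computable_intros decidable_le_in)

lemma computable_proj: "computable f \<Longrightarrow> computable g \<Longrightarrow> computable (\<lambda>e. proj (f e) (g e))"
  by (rule computable2) (unfold proj_def, intro computable_intros decidable_le_in)

lemma computable_order_bound: "computable f \<Longrightarrow> computable (\<lambda>e. order_bound (f e))"
  unfolding order_bound_def by (intro computable_intros)

lemma computable_coded_rules: "computable f \<Longrightarrow> computable g \<Longrightarrow> computable_sets (\<lambda>e. coded_rules (f e) (g e))"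
  by (rule computable_sets2) (unfold coded_rules_def, intro computable_intros)

lemma decidable_fits_code:
  "computable f \<Longrightarrow> computable g \<Longrightarrow> computable h \<Longrightarrow> decidable (\<lambda>e. fits_code (f e) (g e) (h e))"
  by (rule decidable3) (unfold fits_code_def, intro computable_intros decidable_leaf_in decidable_le_in)

lemma decidable_root_fits_code:
  "computable f \<Longrightarrow> computable g \<Longrightarrow> computable h \<Longrightarrow> decidable (\<lambda>e. root_fits_code (f e) (g e) (h e))"
  by (rule decidable3) (unfold root_fits_code_def, intro computable_intros decidable_leaf_in decidable_le_in)

lemma decidable_owned_code: "computable f \<Longrightarrow> computable g \<Longrightarrow> decidable (\<lambda>e. owned_code (f e) (g e))"
  unfolding owned_code_def by (intro computable_intros)

lemmas computable_intros2 = computable_intros decidable_le_in decidable_order_code computable_proj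
  computable_order_bound computable_coded_rules decidable_fits_code decidable_root_fits_code decidable_owned_code

lemma decidable_valid_code:
  "computable f \<Longrightarrow> computable g \<Longrightarrow> computable h \<Longrightarrow> decidable (\<lambda>e. valid_code (f e) (g e) (h e))"
  by (rule decidable3) (unfold valid_code_def, intro computable_intros2)

lemma decidable_root_order_code: "computable f \<Longrightarrow> computable g \<Longrightarrow> decidable (\<lambda>e. root_order_code (f e) (g e))"
  by (rule decidable2) (unfold root_order_code_def, intro computable_intros2)

lemma computable_moves_code:
  "computable f \<Longrightarrow> computable g \<Longrightarrow> computable h \<Longrightarrow> computable (\<lambda>e. moves_code (f e) (g e) (h e))"
  by (rule computable3) (unfold moves_code_def, intro computable_intros2 decidable_valid_code)

lemma computable_labelled_code:
  "computable f \<Longrightarrow> computable g \<Longrightarrow> computable_sets (\<lambda>e. labelled_code (f e) (g e))"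
  by (rule computable_sets2) (unfold labelled_code_def, intro computable_intros2)

lemma computable_tuples: "computable f \<Longrightarrow> computable g \<Longrightarrow> computable_sets (\<lambda>e. tuples (f e) (g e))"
  by (rule computable_sets2) (unfold tuples_def, intro computable_intros2)

lemma computable_up: "computable f \<Longrightarrow> computable (\<lambda>e. up (f e))"
  unfolding up_def by (intro computable_intros2)

lemma computable_leaf_code: "computable f \<Longrightarrow> computable g \<Longrightarrow> computable (\<lambda>e. leaf_code (f e) (g e))"
  unfolding leaf_code_def by (intro computable_intros)

lemma computable_td_rhs_code: "computable f \<Longrightarrow> computable g \<Longrightarrow> computable (\<lambda>e. td_rhs_code (f e) (g e))"
  by (rule computable2) (unfold td_rhs_code_def, intro computable_intros2 computable_leaf_code)

lemma decidable_least_move: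
  "computable f \<Longrightarrow> computable g \<Longrightarrow> computable h \<Longrightarrow> decidable (\<lambda>e. least_move (f e) (g e) (h e))"
  by (rule decidable3) (unfold least_move_def, intro computable_intros2)

lemma computable_ask: "computable f \<Longrightarrow> computable g \<Longrightarrow> computable (\<lambda>e. ask (f e) (g e))"
  unfolding ask_def by (intro computable_intros)

lemma computable_answer:
  "computable f \<Longrightarrow> computable g \<Longrightarrow> computable h \<Longrightarrow> computable (\<lambda>e. answer (f e) (g e) (h e))"
  unfolding answer_def by (intro computable_intros)

lemma computable_picked:
  "computable f \<Longrightarrow> computable g \<Longrightarrow> computable h \<Longrightarrow> computable_sets (\<lambda>e. picked (f e) (g e) (h e))"
  by (rule computable_sets3) (unfold picked_def, intro computable_intros2)

lemma computable_picked_root: "computable f \<Longrightarrow> computable g \<Longrightarrow> computable_sets (\<lambda>e. picked_root (f e) (g e))"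
  by (rule computable_sets2) (unfold picked_root_def, intro computable_intros2)

lemmas computable_intros3 = computable_intros2 decidable_valid_code decidable_root_order_code
  computable_moves_code computable_labelled_code computable_tuples computable_up computable_leaf_code
  computable_td_rhs_code decidable_least_move computable_ask computable_answer computable_picked
  computable_picked_root

lemma computable_burel_code: "computable burel_code"
  unfolding burel_code_def[abs_def] by (intro computable_intros3)

lemma computable_td_code: "computable td_code"
  unfolding td_code_def[abs_def] by (intro computable_intros3)

lemma computable_choice_code: "computable choice_code"
  unfolding choice_code_def[abs_def] by (intro computable_intros3)

lemma computable_uniformizer_code: "computable uniformizer_code"
  unfolding uniformizer_code_def[abs_def]
  by (intro computable_intros computable_burel_code computable_td_code computable_choice_code)


subsection \<open>The codes describe the construction\<close>

definition enc_rule :: "(nat \<times> nat) \<times> (nat + nat \<times> nat) tree \<Rightarrow> nat" where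
  "enc_rule r = prod_encode (prod_encode (fst r), code_tree (snd r))"

text \<open>The code of a transducer runs over symbols without rank, the sets computed from it over
  the pairs in the alphabet. Splitting off \<open>#\<close> brings both to the same form.\<close>

lemma code_rules:
  "{prod_encode (code_symbol y, prod_encode (prod_encode l, code_tree \<xi>)) | y l \<xi>.
      y \<in> insert None (Some ` fst ` \<Sigma>) \<and> (l, \<xi>) \<in> R y} =
   (\<lambda>r. prod_encode (0, r)) ` enc_rule ` R None \<union>
   (\<Union>s\<in>\<Sigma>. (\<lambda>r. prod_encode (Suc (fst s), r)) ` enc_rule ` R (Some (fst s)))"
  (is "?L = ?N \<union> ?S")
proof (intro equalityI subsetI)
  fix n assume "n \<in> ?L"
  then obtain y l \<xi> where y: "y \<in> insert None (Some ` fst ` \<Sigma>)" and r: "(l, \<xi>) \<in> R y"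
    and n: "n = prod_encode (code_symbol y, enc_rule (l, \<xi>))"
    unfolding enc_rule_def by (simp only: mem_Collect_eq fst_conv snd_conv) blast
  from y consider "y = None" | s where "s \<in> \<Sigma>" "y = Some (fst s)" by blast
  then show "n \<in> ?N \<union> ?S"
  proof cases
    case 1
    then have "n \<in> ?N" using r n by (simp add: code_symbol_def)
    then show ?thesis ..
  next
    case 2
    then have "n \<in> ?S" using r n by (intro UN_I[OF 2(1)]) (simp add: code_symbol_def)
    then show ?thesis ..
  qed
next
  have mem: "prod_encode (code_symbol y, enc_rule r) \<in> ?L"
    if "y \<in> insert None (Some ` fst ` \<Sigma>)" "r \<in> R y" for y r
    using that unfolding enc_rule_def
    by (intro CollectI exI[of _ y] exI[of _ "fst r"] exI[of _ "snd r"]) (simp only: prod.collapse simp_thms)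
  fix n assume "n \<in> ?N \<union> ?S"
  then show "n \<in> ?L"
  proof
    assume "n \<in> ?N"
    then obtain r where "r \<in> R None" "n = prod_encode (0, enc_rule r)" by blast
    then show ?thesis using mem[of None r] by (simp add: code_symbol_def)
  next
    assume "n \<in> ?S"
    then obtain s r where "s \<in> \<Sigma>" "r \<in> R (Some (fst s))" "n = prod_encode (Suc (fst s), enc_rule r)" by blast
    then show ?thesis using mem[of "Some (fst s)" r] by (simp add: code_symbol_def)
  qed
qed

lemma list_encode_mono: "list_all2 (\<le>) xs ys \<Longrightarrow> list_encode xs \<le> list_encode ys"
  by (induction rule: list_all2_induct) (auto intro: prod_encode_mono)

lemma tuples_eq: "tuples N k = list_encode ` {ps. length ps = k \<and> set ps \<subseteq> {..<N}}"
proof (intro equalityI subsetI)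
  fix p assume p: "p \<in> tuples N k"
  have "list_decode p ! i < N" if "i < k" for i
    using p that unfolding tuples_def nth_code_def by force
  then have "p = list_encode (list_decode p)" "length (list_decode p) = k" "set (list_decode p) \<subseteq> {..<N}"
    using p unfolding tuples_def by (auto simp: in_set_conv_nth)
  then show "p \<in> list_encode ` {ps. length ps = k \<and> set ps \<subseteq> {..<N}}" by blast
next
  fix p assume "p \<in> list_encode ` {ps. length ps = k \<and> set ps \<subseteq> {..<N}}"
  then obtain ps where ps: "p = list_encode ps" "length ps = k" "set ps \<subseteq> {..<N}" by auto
  have *: "ps ! i < N" if "i < k" for i using ps(2,3) that by (metis lessThan_iff nth_mem subsetD)
  then have "list_all2 (\<le>) ps (map (\<lambda>i. N) [0..<k])"
    using ps(2) by (auto simp: list_all2_conv_all_nth less_imp_le)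
  then show "p \<in> tuples N k"
    using * ps(1,2) list_encode_mono unfolding tuples_def by (auto simp: less_Suc_eq_le)
qed

lemma all_prod_encode: "(\<forall>n. P n) \<longleftrightarrow> (\<forall>i j. P (prod_encode (i, j)))"
  by (metis prod_decode_inverse surj_pair)

lemma code_tree_leaf: "code_tree (attr_leaf q j) = leaf_code q j"
  by (simp add: leaf_code_def sum_encode_def)

context
  fixes A :: "(nat, nat, nat) att" and x :: nat
  assumes A: "is_att A" and x: "x = code_att A"
begin

abbreviation "mx \<equiv> order_bound x"

lemma finite_parts: "finite (syn A)" "finite (inh A)" "finite (ialph A)" "finite (oalph A)"
  using A unfolding is_att_def ranked_alphabet_def by auto

lemma finite_code_rules: "finite ((\<lambda>r. prod_encode (0, r)) ` enc_rule ` rules A None \<union>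
   (\<Union>s\<in>ialph A. (\<lambda>r. prod_encode (Suc (fst s), r)) ` enc_rule ` rules A (Some (fst s))))"
  using A finite_parts unfolding is_att_def by auto

lemma components:
  "set_decode (nth_code x 0) = syn A" "set_decode (nth_code x 1) = inh A"
  "nth_code x 2 = code_ralph (ialph A)" "set_decode (nth_code x 2) = prod_encode ` ialph A"
  "nth_code x 3 = code_ralph (oalph A)" "nth_code x 4 = init A"
  "set_decode (nth_code x 5) = (\<lambda>r. prod_encode (0, r)) ` enc_rule ` rules A None \<union>
   (\<Union>s\<in>ialph A. (\<lambda>r. prod_encode (Suc (fst s), r)) ` enc_rule ` rules A (Some (fst s)))"
  using finite_parts finite_code_rules unfolding x code_att_def code_rules code_ralph_def
  by (simp_all del: list_encode.simps)

lemma coded_rules_None: "coded_rules x 0 = enc_rule ` rules A None"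
  unfolding coded_rules_def components(7) by force

text \<open>The code records rules of input symbols only, which is why the correspondences for node
  rules assume \<open>(\<sigma>, k) \<in> ialph A\<close>.\<close>

lemma coded_rules_Some: "(\<sigma>, k) \<in> ialph A \<Longrightarrow> coded_rules x (Suc \<sigma>) = enc_rule ` rules A (Some \<sigma>)"
  unfolding coded_rules_def components(7) by force

lemma component_less: "i < 6 \<Longrightarrow> nth_code x i < x"
  unfolding x code_att_def by (simp add: nth_code_list_encode del: list_encode.simps) (intro mem_less_list_encode nth_mem, simp)

text \<open>The code of the transducer itself serves as \<open>K\<close>: an attribute is smaller
  than the code of the set containing it, and that code is smaller than \<open>x\<close>.\<close>

interpretation uniformization A mx x
proof
  fix \<gamma> assume "\<gamma> \<in> syn A \<union> inh A"
  then have "\<gamma> < nth_code x 0 \<or> \<gamma> < nth_code x 1"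
    unfolding components(1,2)[symmetric] using mem_set_decode_less by blast
  then show "\<gamma> < x" using component_less[of 0] component_less[of 1] by auto
next
  have attr: "\<gamma> \<le> x" if "\<gamma> \<in> syn A \<union> inh A" for \<gamma>
  proof -
    have "\<gamma> < nth_code x 0 \<or> \<gamma> < nth_code x 1"
      using that unfolding components(1,2)[symmetric] using mem_set_decode_less by blast
    then show ?thesis using component_less[of 0] component_less[of 1] by auto
  qed
  fix \<sigma> k \<gamma> \<delta> i j
  assume \<sigma>: "(\<sigma>, k) \<in> ialph A" and \<gamma>: "\<gamma> \<in> syn A \<union> inh A" and \<delta>: "\<delta> \<in> syn A \<union> inh A" and ij: "i \<le> k" "j \<le> k"
  have "prod_encode (\<sigma>, k) < nth_code x 2" using \<sigma> components(4) mem_set_decode_less by blast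
  then have "k \<le> x" using component_less[of 2] le_prod_encode_2[of k \<sigma>] by simp
  then show "prod_encode (prod_encode (\<gamma>, i), prod_encode (\<delta>, j)) < mx"
    unfolding order_bound_def less_Suc_eq_le using attr[OF \<gamma>] attr[OF \<delta>] ij
    by (intro prod_encode_mono) auto
qed (rule A)

lemma UN_alphabet: "(\<Union>s\<in>set_decode (nth_code x 2). G s) = (\<Union>s\<in>ialph A. G (prod_encode s))"
  unfolding components(4) by simp

lemma fits_code_eq: "fits_code c (prod_encode l) (code_tree \<xi>) \<longleftrightarrow> fits c l \<xi>"
  unfolding fits_code_def fits_def ball_attrs[symmetric] by simp

lemma root_fits_code_eq: "root_fits_code q (prod_encode l) (code_tree \<xi>) \<longleftrightarrow> root_fits q l \<xi>"
  unfolding root_fits_code_def root_fits_def ball_attrs[symmetric] by simp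

lemma bex_enc_rule:
  "(\<exists>r\<in>enc_rule ` R. pfst r = prod_encode l \<and> P (psnd r)) \<longleftrightarrow> (\<exists>\<xi>. (l, \<xi>) \<in> R \<and> P (code_tree \<xi>))"
  by (force simp: enc_rule_def)

text \<open>The reflexive pairs in \<open>set_decode c\<close> are those of the carrier, so the
  quantifier over all occurrences becomes one over coded pairs.\<close>

lemma valid_code_eq:
  assumes "(\<sigma>, k) \<in> ialph A"
  shows "valid_code x \<sigma> c \<longleftrightarrow> valid A (2 ^ mx) \<sigma> c"
proof -
  have owned: "owned_code x l \<longleftrightarrow> owned A (pfst l) (psnd l)" for l
    by (simp only: owned_code_def owned_def components(1,2))
  have "(\<forall>d\<in>set_decode c. pfst d = psnd d \<and> owned_code x (pfst d) \<longrightarrow>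
       (\<exists>r\<in>coded_rules x (Suc \<sigma>). pfst r = pfst d \<and> fits_code c (pfst d) (psnd r))) \<longleftrightarrow>
     (\<forall>l y. le_in c l y \<longrightarrow> l = y \<and> owned A (pfst l) (psnd l) \<longrightarrow>
       (\<exists>r\<in>enc_rule ` rules A (Some \<sigma>). pfst r = l \<and> fits_code c l (psnd r)))"
    by (simp only: all_le_in owned coded_rules_Some[OF assms])
  also have "\<dots> \<longleftrightarrow> (\<forall>l. le_in c l l \<and> owned A (pfst l) (psnd l) \<longrightarrow>
       (\<exists>r\<in>enc_rule ` rules A (Some \<sigma>). pfst r = l \<and> fits_code c l (psnd r)))"
    by blast
  also have "\<dots> \<longleftrightarrow> (\<forall>\<gamma> i. le_in c (prod_encode (\<gamma>, i)) (prod_encode (\<gamma>, i)) \<and> owned A \<gamma> i \<longrightarrow>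
       (\<exists>r\<in>enc_rule ` rules A (Some \<sigma>). pfst r = prod_encode (\<gamma>, i) \<and> fits_code c (prod_encode (\<gamma>, i)) (psnd r)))"
    by (subst all_prod_encode) simp
  finally show ?thesis unfolding valid_code_def valid_def bex_enc_rule fits_code_eq by simp
qed

lemma root_order_code_eq: "root_order_code x q \<longleftrightarrow> root_order A q"
proof -
  have "(\<exists>r\<in>enc_rule ` rules A None. pfst r = prod_encode (b, 1) \<and> root_fits_code q (pfst r) (psnd r)) \<longleftrightarrow>
      (\<exists>\<xi>. ((b, 1), \<xi>) \<in> rules A None \<and> root_fits q (b, 1) \<xi>)" for b
    using bex_enc_rule[of "rules A None" "(b, 1)" "root_fits_code q (prod_encode (b, 1))"]
    by (simp add: root_fits_code_eq cong: conj_cong)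
  then show ?thesis
    unfolding root_order_code_def root_order_def coded_rules_None components(2,6) by simp
qed

lemma moves_code_eq:
  assumes "(\<sigma>, k) \<in> ialph A"
  shows "moves_code x \<sigma> (list_encode ps) = moves A (2 ^ mx) \<sigma> ps"
  unfolding moves_code_def moves_def valid_code_eq[OF assms]
  by (rule arg_cong[of _ _ set_encode]) (auto simp: valid_def)

lemma labelled_code_eq: "labelled_code x n = prod_encode ` labelled_alphabet (ialph A) n"
  unfolding labelled_code_def components(4) labelled_alphabet_def by force

lemma burel_code_eq: "burel_code x = code_burel (bu_relabeling A mx)"
proof -
  let ?N = "2 ^ 2 ^ mx :: nat" and ?M = "2 ^ mx :: nat"
  have "(\<Union>s\<in>set_decode (nth_code x 2).
        (\<lambda>p. prod_encode (prod_encode (pfst s, p),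
           prod_encode (up (moves_code x (pfst s) p), prod_encode (pfst s, moves_code x (pfst s) p)))) `
        tuples ?N (psnd s)) =
     (\<Union>s\<in>ialph A. (\<lambda>ps. prod_encode (prod_encode (fst s, list_encode ps),
           prod_encode (up (moves A ?M (fst s) ps), prod_encode (fst s, moves A ?M (fst s) ps)))) `
        {ps. length ps = snd s \<and> set ps \<subseteq> {..<?N}})"
    unfolding components(4) tuples_eq image_image UN_simps
    by (intro SUP_cong image_cong refl) (auto simp: moves_code_eq)
  also have "\<dots> = {prod_encode (prod_encode (\<sigma>, list_encode ps), prod_encode (p, \<sigma>')) | \<sigma> ps p \<sigma>'.
        ((\<sigma>, ps), (p, \<sigma>')) \<in> brules (bu_relabeling A mx)}"
    unfolding bu_relabeling_def by force
  finally show ?thesis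
    unfolding burel_code_def code_burel_def root_order_code_eq labelled_code_eq components(3)
    by (simp add: bu_relabeling_def code_ralph_def)
qed

lemma labelled_alphabet_UN:
  "labelled_alphabet \<Sigma> n = (\<Union>s\<in>\<Sigma>. (\<lambda>W. (prod_encode (fst s, W), snd s)) ` {..<n})"
  unfolding labelled_alphabet_def by force

lemma td_rhs_code_eq: "td_rhs_code (prod_encode (\<sigma>, k)) c =
  code_tree (Node (Inl (prod_encode (\<sigma>, c))) (map (\<lambda>j. attr_leaf (2 ^ proj j c) j) [1..<Suc k]))"
proof -
  have "map (\<lambda>i. leaf_code (2 ^ proj (Suc i) c) (Suc i)) [0..<k] =
      map code_tree (map (\<lambda>j. attr_leaf (2 ^ proj j c) j) [1..<Suc k])"
    by (rule nth_equalityI) (auto simp: leaf_code_def sum_encode_def simp del: upt_Suc)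
  then show ?thesis
    unfolding td_rhs_code_def by (simp add: sum_encode_def del: map_map upt_Suc)
qed

lemma td_code_eq: "td_code x = code_att (td_relabeling A mx)"
proof -
  let ?N = "2 ^ 2 ^ mx :: nat" and ?M = "2 ^ mx :: nat"
  have r: "(\<Union>u\<in>{..<?N}. (\<lambda>c. prod_encode (prod_encode (u, 0), td_rhs_code (prod_encode (\<sigma>, k)) c)) `
          {c \<in> {..<?M}. least_move W u c}) = enc_rule ` rules T (Some (prod_encode (\<sigma>, W)))"
    if "(\<sigma>, k) \<in> ialph A" for \<sigma> k W
  proof -
    let ?xi = "\<lambda>c. Node (Inl (prod_encode (\<sigma>, c))) (map (\<lambda>j. attr_leaf (2 ^ proj j c) j) [1..<Suc k])"
    have "rules T (Some (prod_encode (\<sigma>, W))) =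
        (\<Union>u\<in>{..<?N}. (\<lambda>c. ((u, 0), ?xi c)) ` {c \<in> {..<?M}. least_move W u c})" (is "?L = ?R")
    proof (intro equalityI subsetI)
      fix y assume "y \<in> ?L"
      moreover obtain u i \<xi> where y: "y = ((u, i), \<xi>)" by (metis prod.exhaust)
      ultimately have "((u, i), \<xi>) \<in> ?L" by simp
      then show "y \<in> ?R"
      proof (rule td_rulesE)
        fix c k' assume *: "i = 0" "u < ?N" "(pfst (prod_encode (\<sigma>, W)), k') \<in> ialph A" "c < ?M"
          "least_move (psnd (prod_encode (\<sigma>, W))) u c"
          "\<xi> = Node (Inl (prod_encode (pfst (prod_encode (\<sigma>, W)), c))) (map (\<lambda>j. attr_leaf (2 ^ proj j c) j) [1..<Suc k'])"
        have "k' = k" using rank_unique[OF that] *(3) by simp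
        then have "y = ((u, 0), ?xi c)" using y *(1,6) by (simp only: prod_encode_inverse fst_conv)
        moreover have "c \<in> {c \<in> {..<?M}. least_move W u c}" using *(4,5) by simp
        ultimately show "y \<in> ?R" using *(2) by (intro UN_I[of u]) (simp, rule image_eqI)
      qed
    next
      fix y assume "y \<in> ?R"
      then obtain u c where "u < ?N" "c < ?M" "least_move W u c" "y = ((u, 0), ?xi c)" by blast
      then show "y \<in> ?L" using that unfolding td_relabeling_def by (auto simp del: upt_Suc)
    qed
    then show ?thesis
      by (simp only: td_rhs_code_eq image_UN image_image enc_rule_def fst_conv snd_conv)
  qed
  have "(\<Union>s\<in>set_decode (nth_code x 2). \<Union>W\<in>{..<?N}.
        (\<lambda>r. prod_encode (Suc (prod_encode (pfst s, W)), r)) `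
        (\<Union>u\<in>{..<?N}. (\<lambda>c. prod_encode (prod_encode (u, 0), td_rhs_code s c)) `
          {c \<in> {..<?M}. least_move W u c})) =
      (\<Union>s\<in>ialph T. (\<lambda>r. prod_encode (Suc (fst s), r)) ` enc_rule ` rules T (Some (fst s)))"
  proof -
    have "(\<Union>s\<in>set_decode (nth_code x 2). \<Union>W\<in>{..<?N}.
        (\<lambda>r. prod_encode (Suc (prod_encode (pfst s, W)), r)) `
        (\<Union>u\<in>{..<?N}. (\<lambda>c. prod_encode (prod_encode (u, 0), td_rhs_code s c)) `
          {c \<in> {..<?M}. least_move W u c})) =
      (\<Union>s\<in>ialph A. \<Union>W\<in>{..<?N}.
        (\<lambda>r. prod_encode (Suc (prod_encode (fst s, W)), r)) ` enc_rule ` rules T (Some (prod_encode (fst s, W))))"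
      unfolding UN_alphabet
    proof (intro SUP_cong refl)
      fix s W assume "s \<in> ialph A"
      then show "(\<lambda>r. prod_encode (Suc (prod_encode (pfst (prod_encode s), W)), r)) `
        (\<Union>u\<in>{..<?N}. (\<lambda>c. prod_encode (prod_encode (u, 0), td_rhs_code (prod_encode s) c)) `
          {c \<in> {..<?M}. least_move W u c}) = (\<lambda>r. prod_encode (Suc (prod_encode (fst s, W)), r)) `
        enc_rule ` rules T (Some (prod_encode (fst s, W)))"
        using r[of "fst s" "snd s" W] by (simp only: prod.collapse prod_encode_inverse)
    qed
    also have "\<dots> = (\<Union>s\<in>labelled_alphabet (ialph A) ?N.
        (\<lambda>r. prod_encode (Suc (fst s), r)) ` enc_rule ` rules T (Some (fst s)))"
      by (simp add: labelled_alphabet_UN)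
    finally show ?thesis by (simp add: td_relabeling_def)
  qed
  moreover have "syn T = {..<?N}" "inh T = {}" "ialph T = labelled_alphabet (ialph A) ?N"
    "oalph T = labelled_alphabet (ialph A) ?M" "init T = set_encode {q \<in> {..<?M}. root_order A q}" "rules T None = {}"
    by (simp_all add: td_relabeling_def)
  ultimately show ?thesis
    unfolding td_code_def code_att_def code_rules root_order_code_eq labelled_code_eq code_ralph_def
    by (simp only: image_empty Un_empty_left)
qed

text \<open>The fitting predicate is kept abstract so that the same argument serves node rules and
  root rules.\<close>

lemma pick_code:
  assumes P: "\<And>l \<xi>. P' (prod_encode l) (code_tree \<xi>) \<longleftrightarrow> P l \<xi>"
  shows "{r \<in> enc_rule ` R. P' (pfst r) (psnd r) \<and>
     (\<forall>r'\<in>enc_rule ` R. pfst r' = pfst r \<and> P' (pfst r) (psnd r') \<longrightarrow> psnd r \<le> psnd r')} = enc_rule ` pick R P"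
proof -
  have "(\<forall>r'\<in>enc_rule ` R. pfst r' = prod_encode l \<and> P' (prod_encode l) (psnd r') \<longrightarrow> code_tree \<xi> \<le> psnd r') \<longleftrightarrow>
      (\<forall>\<xi>'. (l, \<xi>') \<in> R \<and> P l \<xi>' \<longrightarrow> code_tree \<xi> \<le> code_tree \<xi>')" for l \<xi>
    by (auto simp: enc_rule_def P)
  then show ?thesis
    unfolding pick_def by (auto simp: enc_rule_def P image_iff)
qed

lemma choice_code_eq: "choice_code x = code_att (choice_att A mx x)"
proof -
  let ?M = "2 ^ mx :: nat"
  have N: "enc_rule ` rules C None =
      (\<lambda>b. prod_encode (prod_encode (b, 1), leaf_code (ask x b) 1)) ` inh A \<union>
      (\<lambda>r. prod_encode (prod_encode (answer x (pfst (pfst r)) (psnd r), 1), psnd r)) ` coded_rules x 0"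
    unfolding coded_rules_None choice_simps(6) by (force simp: enc_rule_def code_tree_leaf simp del: code_tree.simps)
  have S: "enc_rule ` rules C (Some (prod_encode (\<sigma>, c))) = picked x \<sigma> c \<union>
      (\<lambda>r. prod_encode (prod_encode (ask x (pfst (pfst r)), 0), leaf_code (answer x (pfst (pfst r)) (psnd r)) 0)) `
        picked_root x (proj 0 c)"
    if "(\<sigma>, k) \<in> ialph A" for \<sigma> k c
  proof -
    have "picked x \<sigma> c = enc_rule ` pick (rules A (Some \<sigma>)) (fits c)"
      unfolding picked_def coded_rules_Some[OF that] by (rule pick_code) (rule fits_code_eq)
    moreover have "picked_root x q = enc_rule ` pick (rules A None) (root_fits q)" for q
      unfolding picked_root_def coded_rules_None by (rule pick_code) (rule root_fits_code_eq)
    moreover have "{((ask x b, 0 :: nat), attr_leaf (answer x b (code_tree \<xi>)) 0 :: (nat + nat \<times> nat) tree) | b i \<xi>.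
          ((b, i), \<xi>) \<in> P} =
        (\<lambda>r. ((ask x (fst (fst r)), 0), attr_leaf (answer x (fst (fst r)) (code_tree (snd r))) 0)) ` P"
      for P :: "((nat \<times> nat) \<times> (nat + nat \<times> nat) tree) set"
      by force
    ultimately show ?thesis
      unfolding choice_simps(7)
      by (simp only: image_Un image_image enc_rule_def fst_conv snd_conv prod_encode_inverse code_tree_leaf)
  qed
  have "(\<Union>s\<in>ialph C. (\<lambda>r. prod_encode (Suc (fst s), r)) ` enc_rule ` rules C (Some (fst s))) =
      (\<Union>s\<in>ialph A. \<Union>c\<in>{..<?M}.
        (\<lambda>r. prod_encode (Suc (prod_encode (fst s, c)), r)) ` enc_rule ` rules C (Some (prod_encode (fst s, c))))"
    unfolding choice_simps(3) by (simp add: labelled_alphabet_UN)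
  also have "\<dots> = (\<Union>s\<in>set_decode (nth_code x 2). \<Union>c\<in>{..<?M}.
          (\<lambda>r. prod_encode (Suc (prod_encode (pfst s, c)), r)) `
          (picked x (pfst s) c \<union>
           (\<lambda>r. prod_encode (prod_encode (ask x (pfst (pfst r)), 0), leaf_code (answer x (pfst (pfst r)) (psnd r)) 0)) `
             picked_root x (proj 0 c)))"
    unfolding UN_alphabet
  proof (intro SUP_cong refl)
    fix s c assume "s \<in> ialph A"
    then have "(fst s, snd s) \<in> ialph A" by simp
    then show "(\<lambda>r. prod_encode (Suc (prod_encode (fst s, c)), r)) ` enc_rule ` rules C (Some (prod_encode (fst s, c))) =
        (\<lambda>r. prod_encode (Suc (prod_encode (pfst (prod_encode s), c)), r)) ` (picked x (pfst (prod_encode s)) c \<union>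
           (\<lambda>r. prod_encode (prod_encode (ask x (pfst (pfst r)), 0), leaf_code (answer x (pfst (pfst r)) (psnd r)) 0)) `
             picked_root x (proj 0 c))"
      by (simp only: S prod_encode_inverse)
  qed
  finally have rules: "(\<Union>s\<in>ialph C. (\<lambda>r. prod_encode (Suc (fst s), r)) ` enc_rule ` rules C (Some (fst s))) = \<dots>" .
  have "inh C = inh A \<union> (\<lambda>r. answer x (pfst (pfst r)) (psnd r)) ` coded_rules x 0"
    unfolding choice_simps(2) coded_rules_None by (force simp: enc_rule_def)
  then show ?thesis
    unfolding choice_code_def code_att_def code_rules unfolding rules N
    unfolding components(1,2,5,6) labelled_code_eq choice_simps(1,3-5) code_ralph_def
    by (simp only:)
qed

lemma uniformizer_code_correct:
  "is_dattU (uniformizing_attU A mx x) \<and> uniformizer_code x = code_attU (uniformizing_attU A mx x) \<and>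
   uniformizer (attU_trans (uniformizing_attU A mx x)) (att_trans A)"
  using is_dattU uniformizer_attU_trans
  by (simp add: uniformizer_code_def uniformizing_attU_def burel_code_eq td_code_eq choice_code_eq)

end

theorem theorem1:
  "\<exists>F. computable F \<and>
     (\<forall>A :: (nat, nat, nat) att. is_att A \<longrightarrow>
        (\<exists>D :: (nat, nat, nat, nat, nat, nat, nat) attU.
           is_dattU D \<and> F (code_att A) = code_attU D \<and>
           uniformizer (attU_trans D) (att_trans A)))"
  using computable_uniformizer_code uniformizer_code_correct by blast

end
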